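(* Let $T>0$ and let $\Lambda$ range over an interval $(0,\Lambda_{\max})$. Keep $T$, $\Theta$, $\beta$ and $c$ fixed, and let the other parameters of the model ($\lambda_0=\underline\lambda$ and $\gamma$) depend on $\Lambda$ in such a way that, for every $\Lambda$: (i) $f(z)=\Lambda z$, the support of $\Theta$ is not bounded, and $cT-M(T)>0$; (ii) $M(T)=\lambda_P T$ with $\lambda_P>0$ not depending on $\Lambda$ (invariance of the expected number of events); (iii) $H[\phi^*_\Lambda]$ does not depend on $\Lambda$ (invariance of the expected cost), where $\phi^*_\Lambda$ is the optimal contract, i.e. the solution of $\sup_{\phi\in\mathcal C}\mathcal U(\phi)$, which has the form $\phi^*_\Lambda(z)=\min\{z;\ \tfrac{b}{b-a}(z-a)_+\}$ with thresholds $0\le a=a(\Lambda)<b=b(\Lambda)$. Then, as $\Lambda$ decreases to $0$, $\phi^*_\Lambda$ converges (pointwise) to an excess-of-loss contract, i.e. a contract of the form $z\mapsto(z-d)_+$ for some $d\ge0$. In particular: - (Decreasing slope) the slope $\frac{b(\Lambda)}{b(\Lambda)-a(\Lambda)}$ of $\phi^*_\Lambda$ in the intermediate region $[a(\Lambda),b(\Lambda)]$ decreases when $\Lambda$ decreases, and converges to $1$ as $\Lambda\to0$; - (Decreasing franchise) the deductible threshold $a(\Lambda)$, below which the optimal contract covers no loss, decreases when $\Lambda$ decreases (i.e. $a(\Lambda_2)\le a(\Lambda_1)$ whenever $\Lambda_2<\Lambda_1$); - (Increasing threshold $b$) the threshold $b(\Lambda)$, above which the optimal contract covers the whole loss, increases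 when $\Lambda$ decreases (i.e. $b(\Lambda_2)\ge b(\Lambda_1)$ whenever $\Lambda_2<\Lambda_1$).
   Context: Let $(\Omega,\mathcal F,(\mathcal F_t)_{t\ge0},\mathbb Q)$ be a filtered probability space satisfying the usual conditions; $\mathbb E$ and $\mathbb V$ denote expectation and variance, $\mathbb R^+=[0,\infty)$, and $x_+=\max(x,0)$. Let $\Theta$ be a measure on $(\mathbb R^+,\mathcal B(\mathbb R^+))$ with finite moments up to order two: $\int_0^\infty(1+z+z^2)\,\Theta(dz)<\infty$. For a $\Theta$-integrable function $g$, $H[g]:=\int_0^\infty g(z)\,\Theta(dz)$, and $\overline\theta:=\int_0^\infty z\,\Theta(dz)$. For each $\Lambda$, let $f(z)=\Lambda z$ with $\Lambda\overline\theta<\beta$, where $\beta$ is a constant. Let $(T_i,Z_i)_{i\ge1}$ be a marked point process (loss times and loss sizes), let $\nu(dt,dz)$ be the associated random counting measure, and assume it is a marked Hawkes process: the compensator of $\nu$ is $\lambda_{t^-}\Theta(dz)\,dt$, where $$\lambda_t=\lambda_0+\beta\int_0^t(\underline\lambda-\lambda_{s^-})\,ds+\int_0^{t^-}\int_{\mathbb R^+}f(z)\,\nu(ds,dz),$$ with here $\lambda_0=\underline\lambda>0$ (contract signed outside a cluster period). Under these assumptions $\lambda$ is well defined and has finite moments up to order two. Set $M(T)=\mathbb E\bigl[\int_0^T\lambda_s\,ds\bigr]$. The set of reinsurance contracts is $\mathcal C=\{h:\mathbb R^+\to\mathbb R\text{ measurable}:\ 0\le h(z)\le z\ \ \Theta\text{-a.s.}\}$,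 viewed as a subset of $L^2(\Theta)$ (so contracts are identified when equal $\Theta$-a.e.). The insurer's wealth under $\phi\in\mathcal C$ is $$R_t(\phi)=R_0+\int_0^t\int_0^\infty(\phi(z)-z)\,\nu(ds,dz)+\rho\,\overline\theta\,t-c\,t\int_0^\infty\phi(z)\,\Theta(dz),$$ where $R_0,\rho,c$ are constants, and the criterion is $\mathcal U(\phi)=\mathbb E[R_T(\phi)]-\gamma\,\mathbb V[R_T(\phi)]$ with a constant $\gamma>0$. The cost rate of a contract $\phi$ is $cH[\phi]$.
   Formalization: If the support of Θ has gaps, φ* need not determine a, b, and monotonicity of slope, a and b can fail for some choices; it is proved for a suitable choice of thresholds, and for every choice if the support is all of R^+. Convergence and slope → 1 hold for every choice. *)

theory Defs
  imports "HOL-Probability.Probability"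
begin

abbreviation borel_nonneg :: "real measure" where
  "borel_nonneg \<equiv> restrict_space borel {0..}"

definition left_lim :: "(real \<Rightarrow> real) \<Rightarrow> real \<Rightarrow> real" where
  "left_lim x t = Lim (at_left t) x"

definition measure_support :: "real measure \<Rightarrow> real set" where
  "measure_support \<Theta> = {x \<in> space \<Theta>. \<forall>U. open U \<longrightarrow> x \<in> U \<longrightarrow> emeasure \<Theta> (U \<inter> space \<Theta>) \<noteq> 0}"

text \<open>Time is indexed by the reals so that the library's \<^locale>\<open>filtration\<close> applies; a filtration
  indexed by the half-line is extended by its value at 0. The conditions below concern nonnegative
  times only.\<close>

definition usual_conditions :: "'w measure \<Rightarrow> (real \<Rightarrow> 'w measure) \<Rightarrow> bool" where
  "usual_conditions Q F \<longleftrightarrow>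
     complete_measure Q \<and>
     (\<forall>t. subalgebra Q (F t)) \<and>
     null_sets Q \<subseteq> sets (F 0) \<and>
     (\<forall>t\<ge>0. sets (F t) = (\<Inter>u\<in>{t<..}. sets (F u)))"

definition predictable :: "'w measure \<Rightarrow> (real \<Rightarrow> 'w measure) \<Rightarrow> (real \<times> 'w) measure" where
  "predictable Q F = sigma ({0..} \<times> space Q)
     ({{0} \<times> A |A. A \<in> sets (F 0)} \<union> {{s<..t} \<times> A |s t A. 0 \<le> s \<and> s \<le> t \<and> A \<in> sets (F s)})"

text \<open>The sum over all \<open>i\<close> of the Dirac masses at \<open>(\<tau> i \<omega>, Z i \<omega>)\<close>. Events are
  numbered from 0.\<close>

definition counting_measure ::
    "(nat \<Rightarrow> 'w \<Rightarrow> real) \<Rightarrow> (nat \<Rightarrow> 'w \<Rightarrow> real) \<Rightarrow> 'w \<Rightarrow> (real \<times> real) measure" where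
  "counting_measure \<tau> Z \<omega> =
     distr (count_space UNIV) (borel \<Otimes>\<^sub>M borel_nonneg) (\<lambda>i. (\<tau> i \<omega>, Z i \<omega>))"

text \<open>The compensator of the random measure \<open>\<nu>\<close> is \<open>x\<^sub>t \<Theta>(dz) dt\<close>: both have the same expected
  integral against every nonnegative predictable function of time, scenario and mark.\<close>

definition has_compensator ::
    "'w measure \<Rightarrow> (real \<Rightarrow> 'w measure) \<Rightarrow> ('w \<Rightarrow> (real \<times> real) measure) \<Rightarrow>
     (real \<Rightarrow> 'w \<Rightarrow> real) \<Rightarrow> real measure \<Rightarrow> bool" where
  "has_compensator Q F \<nu> x \<Theta> \<longleftrightarrow>
     (\<forall>W \<in> borel_measurable (predictable Q F \<Otimes>\<^sub>M borel_nonneg).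
        (\<integral>\<^sup>+\<omega>. (\<integral>\<^sup>+(t, z). W ((t, \<omega>), z) \<partial>\<nu> \<omega>) \<partial>Q) =
        (\<integral>\<^sup>+\<omega>. (\<integral>\<^sup>+t\<in>{0..}. (\<integral>\<^sup>+z. W ((t, \<omega>), z) * ennreal (x t \<omega>) \<partial>\<Theta>) \<partial>lborel) \<partial>Q))"

locale marked_point_process =
  prob_space Q + filtration "space Q" F
  for Q :: "'w measure" and F :: "real \<Rightarrow> 'w measure" +
  fixes \<tau> Z :: "nat \<Rightarrow> 'w \<Rightarrow> real"
  assumes usual: "usual_conditions Q F"
    and times_stopping: "\<And>i. stopping_time F (\<tau> i)"
    and marks_measurable: "\<And>i. Z i \<in> pre_sigma (\<tau> i) \<rightarrow>\<^sub>M borel_nonneg"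
    and times_increasing: "AE \<omega> in Q. 0 < \<tau> 0 \<omega> \<and> (\<forall>i. \<tau> i \<omega> < \<tau> (Suc i) \<omega>)"
    and times_unbounded: "AE \<omega> in Q. filterlim (\<lambda>i. \<tau> i \<omega>) at_top sequentially"

locale marked_hawkes = marked_point_process Q F \<tau> Z
  for Q :: "'w measure" and F :: "real \<Rightarrow> 'w measure" and \<tau> Z :: "nat \<Rightarrow> 'w \<Rightarrow> real" +
  fixes \<Theta> :: "real measure" and f :: "real \<Rightarrow> real" and \<beta> lam_base lam_init :: real
    and lam :: "real \<Rightarrow> 'w \<Rightarrow> real"
  assumes intensity_integrable:
      "AE \<omega> in Q. \<forall>t\<ge>0. set_integrable lborel {0..t} (\<lambda>s. left_lim (\<lambda>u. lam u \<omega>) s)"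
    and intensity_eq:
      "AE \<omega> in Q. \<forall>t\<ge>0. lam t \<omega> = lam_init
         + \<beta> * (\<integral>s\<in>{0..t}. (lam_base - left_lim (\<lambda>u. lam u \<omega>) s) \<partial>lborel)
         + (\<integral>p\<in>{0<..<t} \<times> {0..}. f (snd p) \<partial>counting_measure \<tau> Z \<omega>)"
    and compensator:
      "has_compensator Q F (counting_measure \<tau> Z) (\<lambda>t \<omega>. left_lim (\<lambda>u. lam u \<omega>) t) \<Theta>"

definition expected_intensity :: "'w measure \<Rightarrow> (real \<Rightarrow> 'w \<Rightarrow> real) \<Rightarrow> real \<Rightarrow> real" where
  "expected_intensity Q lam T = prob_space.expectation Q (\<lambda>\<omega>. \<integral>s\<in>{0..T}. lam s \<omega> \<partial>lborel)"

definition contracts :: "real measure \<Rightarrow> (real \<Rightarrow> real) set" where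
  "contracts \<Theta> = {h \<in> borel_measurable \<Theta>. AE z in \<Theta>. 0 \<le> h z \<and> h z \<le> z}"

definition wealth ::
    "(nat \<Rightarrow> 'w \<Rightarrow> real) \<Rightarrow> (nat \<Rightarrow> 'w \<Rightarrow> real) \<Rightarrow> real measure \<Rightarrow> real \<Rightarrow> real \<Rightarrow> real \<Rightarrow>
     (real \<Rightarrow> real) \<Rightarrow> real \<Rightarrow> 'w \<Rightarrow> real" where
  "wealth \<tau> Z \<Theta> R0 \<rho> c \<phi> t \<omega> =
     R0 + (\<integral>p\<in>{0<..t} \<times> {0..}. (\<phi> (snd p) - snd p) \<partial>counting_measure \<tau> Z \<omega>)
       + \<rho> * (\<integral>z. z \<partial>\<Theta>) * t - c * t * (\<integral>z. \<phi> z \<partial>\<Theta>)"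

definition mean_variance :: "'w measure \<Rightarrow> real \<Rightarrow> ('w \<Rightarrow> real) \<Rightarrow> real" where
  "mean_variance Q \<gamma> X = prob_space.expectation Q X - \<gamma> * prob_space.variance Q X"

definition optimal_contract ::
    "'w measure \<Rightarrow> (nat \<Rightarrow> 'w \<Rightarrow> real) \<Rightarrow> (nat \<Rightarrow> 'w \<Rightarrow> real) \<Rightarrow> real measure \<Rightarrow>
     real \<Rightarrow> real \<Rightarrow> real \<Rightarrow> real \<Rightarrow> real \<Rightarrow> (real \<Rightarrow> real) \<Rightarrow> bool" where
  "optimal_contract Q \<tau> Z \<Theta> R0 \<rho> c \<gamma> T \<phi> \<longleftrightarrow>
     is_arg_max (\<lambda>h. mean_variance Q \<gamma> (wealth \<tau> Z \<Theta> R0 \<rho> c h T)) (\<lambda>h. h \<in> contracts \<Theta>) \<phi>"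

definition slope :: "real \<Rightarrow> real \<Rightarrow> real" where
  "slope a b = b / (b - a)"

definition layer :: "real \<Rightarrow> real \<Rightarrow> real \<Rightarrow> real" where
  "layer a b z = min z (slope a b * max (z - a) 0)"

text \<open>Contracts are identified when they agree almost everywhere, so a contract need not determine
  its thresholds when \<open>\<Theta>\<close> has gaps in its support.\<close>

definition has_thresholds :: "real measure \<Rightarrow> (real \<Rightarrow> real) \<Rightarrow> real \<Rightarrow> real \<Rightarrow> bool" where
  "has_thresholds \<Theta> \<phi> a b \<longleftrightarrow> 0 \<le> a \<and> a < b \<and> (AE z in \<Theta>. \<phi> z = layer a b z)"

text \<open>Convergence of the contracts with thresholds \<open>a x\<close>, \<open>b x\<close> to an excess-of-loss contract as
  the parameter \<open>x\<close> decreases to 0.\<close>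

definition tends_to_excess_of_loss :: "(real \<Rightarrow> real) \<Rightarrow> (real \<Rightarrow> real) \<Rightarrow> bool" where
  "tends_to_excess_of_loss a b \<longleftrightarrow>
     (\<exists>d\<ge>0. \<forall>z\<ge>0. ((\<lambda>x. layer (a x) (b x) z) \<longlongrightarrow> max (z - d) 0) (at_right 0)) \<and>
     ((\<lambda>x. slope (a x) (b x)) \<longlongrightarrow> 1) (at_right 0)"

definition monotone_thresholds :: "real set \<Rightarrow> (real \<Rightarrow> real) \<Rightarrow> (real \<Rightarrow> real) \<Rightarrow> bool" where
  "monotone_thresholds I a b \<longleftrightarrow>
     mono_on I (\<lambda>x. slope (a x) (b x)) \<and> mono_on I a \<and> antimono_on I b"

end

theory Submission
  imports Defs
begin

text \<open>Write \<open>\<theta>\<close> for the mean of \<open>\<Theta>\<close>, \<open>H\<close> for integration against \<open>\<Theta>\<close>, and \<open>\<psi> z = z - \<phi> z\<close> for the retained loss. An event at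
  time \<open>s\<close> with mark \<open>z\<close> raises the intensity by \<open>\<Lambda> z\<close>. The offspring of an event die out at the net rate
  \<open>\<kappa> = \<beta> - \<Lambda> \<theta>\<close>, so this raises the expected number of events in the remaining time by \<open>\<Lambda> z g (T - s)\<close>, where
  \<open>g\<close> is the integral of \<open>exp (- \<kappa> u)\<close>. Hence the conditional expectation of the aggregate retained loss jumps by
  \<open>\<psi> z + H[\<psi>] \<Lambda> z g (T - s)\<close>, and the variance of the aggregate is
  \<open>M H[\<psi>\<^sup>2] + 2 \<Lambda> G\<^sub>1 H[\<psi>] H[z \<psi>] + \<Lambda>\<^sup>2 G\<^sub>2 H[z\<^sup>2] H[\<psi>]\<^sup>2\<close>,
  where \<open>M\<close>, \<open>G\<^sub>1\<close>, \<open>G\<^sub>2\<close> are the expected integrals of the intensity against \<open>1\<close>, \<open>g (T - s)\<close> and its square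
  (\<open>aggregate_variance\<close>, \<open>mean_kernel_square\<close>). This is obtained from the compensator alone: squares of sums over events are
  split according to the order of the two events, which leaves sums of predictable integrands
  (\<open>compensated_isometry\<close>).

  The criterion is thus a concave quadratic functional of \<open>\<psi>\<close>, and its first-order condition makes \<open>\<psi> z\<close> the projection of
  \<open>\<alpha> - k z\<close> onto the interval from \<open>0\<close> to \<open>z\<close>, where \<open>k = \<Lambda> G\<^sub>1 H[\<psi>] / M\<close>. So \<open>\<phi>\<close> is a layer of slope
  \<open>1 + k\<close> (\<open>optimal_retention\<close>, \<open>optimal_cover\<close>).

  Since \<open>H[\<psi>]\<close> is the same for all \<open>\<Lambda>\<close>, the slope is governed by \<open>\<Lambda> G\<^sub>1 / M\<close>. Put \<open>x = \<Lambda> \<theta>\<close> and let \<open>D x\<close>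
  be \<open>M\<close> divided by the baseline intensity. Then \<open>x G\<^sub>1 / M = x D' x / D x\<close>. Counting events by generation shows
  that \<open>D\<close> is a power series in \<open>x\<close> with nonnegative coefficients, so this logarithmic derivative is the mean
  of a distribution on generations that shifts upwards as \<open>x\<close> grows; it tends to \<open>0\<close> with \<open>x\<close>
  (\<open>branching_ratio_mono\<close>, \<open>branching_ratio_tendsto_0\<close>).

  The rest concerns layers of a fixed cost. If the slope decreases, a higher deductible would make the new layer
  smaller than the old one, and a lower upper threshold would make it larger; equal costs exclude both. When the support of
  \<open>\<Theta>\<close> has gaps, this argument only yields equality almost everywhere, and monotone thresholds are obtained by
  choosing the least deductible of the given cost (\<open>least_deductible_mono\<close>, \<open>least_full_cover_antimono\<close>). As
  \<open>\<Lambda>\<close> tends to \<open>0\<close>, the deductible stays away from \<open>0\<close>, the slope tends to \<open>1\<close> and so the upper threshold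
  tends to infinity. Because the support is unbounded, the sloping part finally contains two points of it, and these
  determine the layer; therefore every choice of thresholds has the same limit (\<open>threshold_family\<close>).\<close>

section \<open>Layers of a given slope\<close>

text \<open>A layer is parametrised here by its deductible \<open>a\<close> and its excess slope \<open>k\<close>, since the optimisation fixes the slope
  while the deductible is pinned down only by the cost.\<close>

definition cover :: "real \<Rightarrow> real \<Rightarrow> real \<Rightarrow> real" where
  "cover k a z = min z ((1 + k) * max (z - a) 0)"

lemma layer_eq_cover:
  assumes "0 < k" "0 < a"
  shows "slope a (a * (1 + k) / k) = 1 + k" "layer a (a * (1 + k) / k) = cover k a"
    "a < a * (1 + k) / k"
proof -
  have "a * (1 + k) / k - a = a / k" using assms by (simp add: field_simps)
  then show s: "slope a (a * (1 + k) / k) = 1 + k"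
    unfolding slope_def using assms by (simp add: field_simps)
  show "layer a (a * (1 + k) / k) = cover k a"
    by (simp add: fun_eq_iff layer_def cover_def s)
  show "a < a * (1 + k) / k" using assms by (simp add: field_simps)
qed

lemma cover_bounds: "0 \<le> k \<Longrightarrow> 0 \<le> z \<Longrightarrow> 0 \<le> cover k a z" "cover k a z \<le> z"
  by (auto simp: cover_def)

lemma cover_antimono: "0 \<le> k \<Longrightarrow> a \<le> a' \<Longrightarrow> cover k a' z \<le> cover k a z"
  unfolding cover_def by (intro min.mono mult_left_mono) auto

lemma cover_mono: "k \<le> k' \<Longrightarrow> cover k a z \<le> cover k' a z"
  unfolding cover_def by (intro min.mono mult_right_mono) auto

lemma cover_zero: "0 \<le> k \<Longrightarrow> 0 \<le> z \<Longrightarrow> cover k 0 z = z"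
  unfolding cover_def by (auto simp: algebra_simps)

lemma cover_lipschitz:
  assumes "0 \<le> k" shows "\<bar>cover k a z - cover k a' z\<bar> \<le> (1 + k) * \<bar>a - a'\<bar>"
proof -
  have "\<bar>cover k a z - cover k a' z\<bar> \<le> \<bar>(1 + k) * max (z - a) 0 - (1 + k) * max (z - a') 0\<bar>"
    unfolding cover_def by linarith
  also have "\<dots> = (1 + k) * \<bar>max (z - a) 0 - max (z - a') 0\<bar>"
    using assms by (simp add: abs_mult right_diff_distrib[symmetric])
  also have "\<dots> \<le> (1 + k) * \<bar>a - a'\<bar>" using assms by (intro mult_left_mono) auto
  finally show ?thesis .
qed

lemma retained_le:
  assumes "0 \<le> k" "0 \<le> a" shows "z - cover k a z \<le> (1 + k) * a"
proof -
  have "z \<le> (1 + k) * a + (1 + k) * max (z - a) 0"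
  proof (cases "0 \<le> z")
    case True
    have "z \<le> (1+k) * z" using assms True by (simp add: algebra_simps)
    also have "\<dots> \<le> (1 + k) * (a + max (z - a) 0)" using assms by (intro mult_left_mono) auto
    finally show ?thesis by (simp add: algebra_simps)
  next
    case False
    then have "z \<le> 0" by simp
    also have "0 \<le> (1 + k) * a + (1 + k) * max (z - a) 0" using assms by simp
    finally show ?thesis .
  qed
  then show ?thesis using assms unfolding cover_def by (auto simp: min_def)
qed

text \<open>Seen from the upper threshold, the retained loss is the line \<open>k (b - z)\<close>. Two layers are compared in this form
  when their upper thresholds are ordered.\<close>

lemma cover_eq_upper:
  assumes "0 < k" "0 < a" "0 \<le> z"
  shows "cover k a z = max 0 (z - k * max (a * (1 + k) / k - z) 0)"
proof -
  have e: "(1 + k) * (z - a) = z - k * (a * (1 + k) / k - z)" using assms by (simp add: field_simps)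
  consider "z < a" | "a \<le> z" "z < a * (1 + k) / k" | "a * (1 + k) / k \<le> z" by linarith
  then show ?thesis
  proof cases
    case 1
    have "(1 + k) * (z - a) < 0" using 1 assms by (simp add: mult_pos_neg)
    moreover have "z < a * (1 + k) / k" using 1 assms layer_eq_cover(3)[of k a] by linarith
    ultimately show ?thesis using 1 assms by (simp add: cover_def e)
  next
    case 2
    have "0 \<le> (1 + k) * (z - a)" "0 < k * (a * (1 + k) / k - z)" using 2 assms
      by (auto intro!: mult_nonneg_nonneg mult_pos_pos)
    with 2 show ?thesis using e by (simp add: cover_def)
  next
    case 3
    then have "k * (a * (1 + k) / k - z) \<le> 0" using assms by (intro mult_nonneg_nonpos) auto
    then have "z \<le> (1 + k) * (z - a)" using e by linarith
    moreover have "a \<le> z" using 3 assms layer_eq_cover(3)[of k a] by linarith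
    ultimately show ?thesis using 3 assms by (simp add: cover_def)
  qed
qed

section \<open>Layers of equal cost\<close>

locale loss_distribution =
  fixes \<Theta> :: "real measure"
  assumes sets_loss: "sets \<Theta> = sets borel_nonneg"
    and moments: "integrable \<Theta> (\<lambda>z. 1 + z + z\<^sup>2)"
    and unbounded_support: "\<not> bounded (measure_support \<Theta>)"
begin

lemma space_loss: "space \<Theta> = {0..}"
  using sets_eq_imp_space_eq[OF sets_loss] by (simp add: space_restrict_space)

lemma measurable_loss: "borel_measurable \<Theta> = borel_measurable borel_nonneg"
  by (rule measurable_cong_sets) (simp_all add: sets_loss)

lemma borel_measurable_loss: "f \<in> borel_measurable borel \<Longrightarrow> f \<in> borel_measurable \<Theta>"
  unfolding measurable_loss by (rule measurable_restrict_space1)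

lemma AE_loss_nonneg: "AE z in \<Theta>. 0 \<le> z"
  by (rule AE_I2) (simp add: space_loss)

lemma integrable_const_loss [simp]: "integrable \<Theta> (\<lambda>z. c :: real)"
proof -
  have "integrable \<Theta> (\<lambda>z. 1 :: real)"
    by (rule Bochner_Integration.integrable_bound[OF moments]) (auto intro!: AE_I2 simp: space_loss)
  from integrable_mult_left[OF this, of c] show ?thesis by simp
qed

sublocale finite_measure \<Theta>
proof
  have "emeasure \<Theta> (space \<Theta>) < \<infinity>"
    using integrable_const_loss[of 1] by (simp add: integrable_iff_bounded)
  then show "emeasure \<Theta> (space \<Theta>) \<noteq> \<infinity>" by simp
qed

lemma integrable_loss [simp]: "integrable \<Theta> (\<lambda>z. z)"
  by (rule Bochner_Integration.integrable_bound[OF moments])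
     (auto intro!: AE_I2 borel_measurable_loss simp: space_loss)

lemma integrable_loss2 [simp]: "integrable \<Theta> (\<lambda>z. z\<^sup>2)"
  by (rule Bochner_Integration.integrable_bound[OF moments])
     (auto intro!: AE_I2 borel_measurable_loss simp: space_loss)

lemma integrable_dominated:
  assumes "h \<in> borel_measurable \<Theta>" "AE z in \<Theta>. 0 \<le> h z \<and> h z \<le> z"
  shows "integrable \<Theta> h"
  by (rule Bochner_Integration.integrable_bound[OF integrable_loss]) (use assms in auto)

text \<open>The set where two continuous functions differ is open, so it misses the support as soon as it is null.\<close>

lemma eq_on_support:
  assumes "AE z in \<Theta>. f z = g z" "continuous_on UNIV f" "continuous_on UNIV (g :: real \<Rightarrow> real)"
    and z: "z \<in> measure_support \<Theta>"
  shows "f z = g z"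
proof (rule ccontr)
  assume "f z \<noteq> g z"
  define U where "U = {z. f z \<noteq> g z}"
  have "open U" unfolding U_def using assms by (intro open_Collect_neq) auto
  then have "emeasure \<Theta> (U \<inter> space \<Theta>) \<noteq> 0" using z \<open>f z \<noteq> g z\<close> by (auto simp: measure_support_def U_def)
  moreover have U: "U \<inter> space \<Theta> \<in> sets \<Theta>"
    unfolding sets_loss sets_restrict_space space_loss using borel_open[OF \<open>open U\<close>] by blast
  have "AE z in \<Theta>. z \<notin> U \<inter> space \<Theta>" using assms(1) by eventually_elim (auto simp: U_def)
  then have "emeasure \<Theta> (U \<inter> space \<Theta>) = 0" using AE_iff_null_sets[OF U] by (simp add: null_sets_def)
  ultimately show False by simp
qed

lemma support_above: "\<exists>z\<in>measure_support \<Theta>. B < z"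
proof (rule ccontr)
  assume "\<not> ?thesis"
  then have "measure_support \<Theta> \<subseteq> {0..B}" by (force simp: measure_support_def space_loss)
  then show False using unbounded_support bounded_subset bounded_closed_interval by blast
qed

lemma total_mass_pos: "0 < measure \<Theta> (space \<Theta>)"
proof -
  obtain z where "z \<in> measure_support \<Theta>" using support_above by blast
  then have "emeasure \<Theta> (UNIV \<inter> space \<Theta>) \<noteq> 0" unfolding measure_support_def by blast
  then show ?thesis by (simp add: emeasure_eq_measure zero_less_measure_iff)
qed

lemma mean_pos: "0 < (\<integral>z. z \<partial>\<Theta>)"
proof -
  have "0 \<le> (\<integral>z. z \<partial>\<Theta>)" by (rule integral_nonneg_AE[OF AE_loss_nonneg])
  moreover have "(\<integral>z. z \<partial>\<Theta>) \<noteq> 0"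
  proof
    assume "(\<integral>z. z \<partial>\<Theta>) = 0"
    then have "AE z in \<Theta>. z = 0"
      using integral_nonneg_eq_0_iff_AE[OF integrable_loss AE_loss_nonneg] by simp
    moreover obtain z where "z \<in> measure_support \<Theta>" "0 < z" using support_above by blast
    ultimately show False using eq_on_support[of "\<lambda>z. z" "\<lambda>z. 0" z] by auto
  qed
  ultimately show ?thesis by linarith
qed

lemma AE_eq_of_le_integral_eq:
  fixes f g :: "real \<Rightarrow> real"
  assumes "integrable \<Theta> f" "integrable \<Theta> g" "AE z in \<Theta>. f z \<le> g z"
    "(\<integral>z. f z \<partial>\<Theta>) = (\<integral>z. g z \<partial>\<Theta>)"
  shows "AE z in \<Theta>. f z = g z"
proof -
  have "AE z in \<Theta>. g z - f z = 0"
    using integral_nonneg_eq_0_iff_AE[of \<Theta> "\<lambda>z. g z - f z"] assms by simp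
  then show ?thesis by eventually_elim simp
qed

definition cost :: "real \<Rightarrow> real \<Rightarrow> real" where
  "cost k a = (\<integral>z. cover k a z \<partial>\<Theta>)"

lemma cover_measurable: "cover k a \<in> borel_measurable \<Theta>"
  unfolding cover_def[abs_def] by (intro borel_measurable_loss) measurable

lemma cover_integrable: "0 \<le> k \<Longrightarrow> integrable \<Theta> (cover k a)"
  by (intro integrable_dominated cover_measurable AE_I2) (simp add: space_loss cover_bounds)

lemma cost_antimono: "0 \<le> k \<Longrightarrow> a \<le> a' \<Longrightarrow> cost k a' \<le> cost k a"
  unfolding cost_def by (intro integral_mono cover_integrable cover_antimono)

lemma cost_mono: "0 \<le> k \<Longrightarrow> k \<le> k' \<Longrightarrow> cost k a \<le> cost k' a"
  unfolding cost_def by (intro integral_mono cover_integrable cover_mono) auto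

lemma cost_zero: "0 \<le> k \<Longrightarrow> cost k 0 = (\<integral>z. z \<partial>\<Theta>)"
  unfolding cost_def by (intro Bochner_Integration.integral_cong refl) (simp add: space_loss cover_zero)

lemma cost_lipschitz:
  assumes "0 \<le> k" shows "\<bar>cost k a - cost k a'\<bar> \<le> ((1 + k) * measure \<Theta> (space \<Theta>)) * \<bar>a - a'\<bar>"
proof -
  have "\<bar>cost k a - cost k a'\<bar> = \<bar>\<integral>z. cover k a z - cover k a' z \<partial>\<Theta>\<bar>"
    unfolding cost_def using assms by (simp add: cover_integrable)
  also have "\<dots> \<le> (\<integral>z. \<bar>cover k a z - cover k a' z\<bar> \<partial>\<Theta>)" by (rule integral_abs_bound)
  also have "\<dots> \<le> (\<integral>z. (1 + k) * \<bar>a - a'\<bar> \<partial>\<Theta>)"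
    using assms by (intro integral_mono integrable_abs Bochner_Integration.integrable_diff
      cover_integrable cover_lipschitz) auto
  finally show ?thesis by (simp add: mult_ac)
qed

lemma retained_cost_le:
  assumes "0 \<le> k" "0 \<le> a"
  shows "(\<integral>z. z \<partial>\<Theta>) - cost k a \<le> (1 + k) * a * measure \<Theta> (space \<Theta>)"
proof -
  have "(\<integral>z. z \<partial>\<Theta>) - cost k a = (\<integral>z. z - cover k a z \<partial>\<Theta>)"
    unfolding cost_def using assms by (simp add: cover_integrable)
  also have "\<dots> \<le> (\<integral>z. (1 + k) * a \<partial>\<Theta>)"
    using assms by (intro integral_mono Bochner_Integration.integrable_diff cover_integrable retained_le) auto
  finally show ?thesis by (simp add: mult_ac)
qed

text \<open>If \<open>\<Theta>\<close> has gaps, a whole interval of deductibles can have the same cost; taking the least one makes the choice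
  monotone in the slope.\<close>

definition least_deductible :: "real \<Rightarrow> real \<Rightarrow> real" where
  "least_deductible C k = Inf {a. 0 \<le> a \<and> cost k a \<le> C}"

lemma least_deductible_le:
  assumes "0 \<le> a" "cost k a \<le> C" shows "least_deductible C k \<le> a"
  unfolding least_deductible_def using assms by (intro cInf_lower bdd_belowI[of _ 0]) auto

lemma least_deductible:
  assumes k: "0 \<le> k" and a: "0 \<le> a" "cost k a = C"
  shows "0 \<le> least_deductible C k" "cost k (least_deductible C k) = C"
proof -
  let ?S = "{a. 0 \<le> a \<and> cost k a \<le> C}"
  have "continuous_on UNIV (cost k)"
  proof (rule lipschitz_on_continuous_on)
    show "((1 + k) * measure \<Theta> (space \<Theta>))-lipschitz_on UNIV (cost k)"
      using k cost_lipschitz[OF k] by (intro lipschitz_onI) (auto simp: dist_real_def)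
  qed
  then have "closed ({0..} \<inter> {a. cost k a \<le> C})"
    by (intro closed_Int closed_atLeast closed_Collect_le continuous_on_const)
  then have "closed ?S" by (simp add: Int_def atLeast_def)
  then have *: "least_deductible C k \<in> ?S"
    unfolding least_deductible_def using a by (intro closed_contains_Inf bdd_belowI[of _ 0]) auto
  then show "0 \<le> least_deductible C k" by simp
  show "cost k (least_deductible C k) = C"
    using * least_deductible_le[of a k C] cost_antimono[OF k, of "least_deductible C k" a] a by auto
qed

text \<open>A steeper layer costs more, so fewer deductibles keep its cost below \<open>C\<close>.\<close>

lemma least_deductible_mono:
  assumes k: "0 \<le> k" "k \<le> k'" and a: "0 \<le> a'" "cost k' a' = C"
  shows "least_deductible C k \<le> least_deductible C k'"
  using least_deductible[of k' a' C] cost_mono[of k k' "least_deductible C k'"] assms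
  by (intro least_deductible_le) auto

text \<open>If the flatter layer (slope \<open>1 + k\<close>) had the lower upper threshold, it would dominate the steeper one, and equal cost would make both agree almost
  everywhere. They differ strictly between the lower deductible and the higher upper threshold, so \<open>\<Theta>\<close> does not
  charge that interval. Then the steeper layer keeps its cost when its deductible is lowered to that of the flatter
  layer. By minimality the deductibles are equal, which contradicts the order of the upper thresholds.\<close>

lemma least_full_cover_antimono:
  assumes k: "0 < k" "k \<le> k'" and ex: "0 \<le> a" "cost k a = C" "0 \<le> a'" "cost k' a' = C"
    and pos: "0 < least_deductible C k"
  shows "least_deductible C k' * (1 + k') / k' \<le> least_deductible C k * (1 + k) / k"
proof (rule ccontr)
  let ?a = "least_deductible C k" and ?a' = "least_deductible C k'"
  let ?b = "?a * (1 + k) / k" and ?b' = "?a' * (1 + k') / k'"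
  assume "\<not> ?thesis"
  then have less: "?b < ?b'" by simp
  have aa': "?a \<le> ?a'" using k ex by (intro least_deductible_mono[of k k' a']) auto
  note pos' = less_le_trans[OF pos aa']
  have line: "k * max (?b - z) 0 \<le> k' * max (?b' - z) 0" for z
    using k less by (intro mult_mono) auto
  have le: "cover k' ?a' z \<le> cover k ?a z" if "0 \<le> z" for z
    using line[of z] k pos pos' that by (simp add: cover_eq_upper)
  have eq: "AE z in \<Theta>. cover k' ?a' z = cover k ?a z"
  proof (rule AE_eq_of_le_integral_eq)
    show "AE z in \<Theta>. cover k' ?a' z \<le> cover k ?a z" using AE_loss_nonneg by eventually_elim (rule le)
    show "(\<integral>z. cover k' ?a' z \<partial>\<Theta>) = (\<integral>z. cover k ?a z \<partial>\<Theta>)"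
      using least_deductible(2)[of k a C] least_deductible(2)[of k' a' C] k ex by (simp add: cost_def)
  qed (use k in \<open>auto intro: cover_integrable\<close>)
  have "AE z in \<Theta>. cover k' ?a z = cover k' ?a' z"
    using eq AE_loss_nonneg
  proof eventually_elim
    case (elim z)
    consider "z \<le> ?a" | "?b' \<le> z" | "?a < z" "z < ?b'" by linarith
    then show ?case
    proof cases
      case 1
      then show ?thesis using aa' by (simp add: cover_def)
    next
      case 2
      then have "cover k' ?a' z = z" using k pos' elim(2) by (simp add: cover_eq_upper)
      then show ?thesis using cover_antimono[of k' ?a ?a' z] cover_bounds(2)[of k' ?a z] aa' k by auto
    next
      case 3
      have "0 < k' * (?b' - z)" using 3 k by simp
      then have "cover k' ?a' z < z" using 3 k pos' elim(2) pos by (simp add: cover_eq_upper)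
      moreover have "0 < cover k ?a z" using 3 pos k by (simp add: cover_def)
      ultimately have "0 < cover k ?a z" "0 < cover k' ?a' z" "cover k ?a z < z" "cover k' ?a' z < z"
        using elim(1) by auto
      then have "z < ?b" "cover k ?a z = z - k * (?b - z)" "cover k' ?a' z = z - k' * (?b' - z)"
        using 3 k pos pos' elim(2) cover_eq_upper[of k ?a z] cover_eq_upper[of k' ?a' z]
        by (auto simp: max_def split: if_splits)
      then have "k * (?b - z) = k' * (?b' - z)" using elim(1) by linarith
      moreover have "k * (?b - z) \<le> k' * (?b - z)" using k \<open>z < ?b\<close> by (intro mult_right_mono) auto
      moreover have "k' * (?b - z) < k' * (?b' - z)" using k less by (intro mult_strict_left_mono) auto
      ultimately have False by linarith
      then show ?thesis ..
    qed
  qed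
  then have "cost k' ?a = cost k' ?a'"
    unfolding cost_def by (intro integral_cong_AE cover_measurable)
  then have "cost k' ?a = C" using least_deductible(2)[of k' a' C] k ex by simp
  then have "?a' \<le> ?a" using pos by (intro least_deductible_le) auto
  with aa' have "?a = ?a'" by simp
  moreover have "(1 + k') / k' \<le> (1 + k) / k" using k by (simp add: field_simps)
  then have "?a * ((1 + k') / k') \<le> ?a * ((1 + k) / k)" using pos by (intro mult_left_mono) auto
  ultimately show False using less by simp
qed

text \<open>At a support point where the cover lies strictly between \<open>0\<close> and \<open>z\<close>, its value lies on the sloping line; two such
  points determine the line.\<close>

lemma thresholds_unique:
  assumes ab: "has_thresholds \<Theta> \<phi> a b" and ab': "has_thresholds \<Theta> \<phi> a' b'" and "0 < a"
    and z: "z1 \<in> measure_support \<Theta>" "z2 \<in> measure_support \<Theta>" "a < z1" "z1 < z2" "z2 < b"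
  shows "a' = a \<and> b' = b"
proof -
  have lt: "0 \<le> a'" "a' < b'" "a < b" "0 \<le> a" using ab ab' by (auto simp: has_thresholds_def)
  have "AE z in \<Theta>. \<phi> z = layer a b z" "AE z in \<Theta>. \<phi> z = layer a' b' z"
    using ab ab' unfolding has_thresholds_def by blast+
  then have "AE z in \<Theta>. layer a b z = layer a' b' z" by eventually_elim simp
  moreover have "continuous_on UNIV (layer p q)" for p q
    unfolding layer_def[abs_def] by (intro continuous_intros)
  ultimately have eq: "layer a b z = layer a' b' z" if "z \<in> measure_support \<Theta>" for z
    using eq_on_support that by blast
  have line: "slope a b * (z - a) = slope a' b' * (z - a')"
    if s: "z \<in> measure_support \<Theta>" and "a < z" "z < b" for z
  proof -
    have sp: "0 < slope a b" "0 < slope a' b'" using lt \<open>0 < a\<close> by (auto simp: slope_def)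
    have "z - slope a b * (z - a) = a * (b - z) / (b - a)"
      using lt by (simp add: slope_def divide_simps) (simp add: algebra_simps)
    also have "\<dots> > 0" using that lt \<open>0 < a\<close> by auto
    finally have "slope a b * (z - a) < z" by simp
    moreover have "0 < slope a b * (z - a)" using sp that by simp
    ultimately have *: "layer a b z = slope a b * (z - a)" "0 < layer a b z" "layer a b z < z"
      using that by (auto simp: layer_def)
    then have "0 < layer a' b' z" "layer a' b' z < z" using eq[OF s] by auto
    then have "layer a' b' z = slope a' b' * (z - a')"
      by (auto simp: layer_def min_def max_def split: if_splits)
    then show ?thesis using * eq[OF s] by simp
  qed
  have l1: "slope a b * (z1 - a) = slope a' b' * (z1 - a')" using line[of z1] z by simp
  moreover have l2: "slope a b * (z2 - a) = slope a' b' * (z2 - a')" using line[of z2] z by simp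
  ultimately have "slope a b * (z2 - z1) = slope a' b' * (z2 - z1)" by (simp add: algebra_simps)
  then have s: "slope a b = slope a' b'" using z by simp
  moreover have "slope a b \<noteq> 0" using lt \<open>0 < a\<close> by (auto simp: slope_def)
  ultimately have "a' = a" using l1 by simp
  with s have "b * (b' - a) = b' * (b - a)" using lt by (simp add: slope_def field_simps)
  then have "a * (b' - b) = 0" by (simp add: algebra_simps)
  then show ?thesis using \<open>a' = a\<close> \<open>0 < a\<close> by auto
qed

end

lemma mono_on_tendsto_at_right:
  fixes a :: "real \<Rightarrow> real"
  assumes "0 < L" "mono_on {0<..<L} a" "\<And>x. x \<in> {0<..<L} \<Longrightarrow> m \<le> a x"
  shows "\<exists>d\<ge>m. (a \<longlongrightarrow> d) (at_right 0)"
proof -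
  let ?d = "Inf (a ` {0<..<L})"
  have ne: "a ` {0<..<L} \<noteq> {}" using assms(1) by (auto intro!: exI[of _ "L/2"])
  have bdd: "bdd_below (a ` {0<..<L})" using assms(3) by (intro bdd_belowI[of _ m]) auto
  have "m \<le> ?d" using assms(3) ne by (intro cInf_greatest) auto
  moreover have "(a \<longlongrightarrow> ?d) (at_right 0)"
  proof (rule order_tendstoI)
    fix e assume "e < ?d"
    have "\<forall>\<^sub>F x in at_right 0. x \<in> {0<..<L}" using assms(1) by (rule eventually_at_right_real)
    then show "\<forall>\<^sub>F x in at_right 0. e < a x"
      by eventually_elim (use \<open>e < ?d\<close> in \<open>meson bdd cInf_lower image_eqI less_le_trans\<close>)
  next
    fix e assume "?d < e"
    then obtain x0 where x0: "x0 \<in> {0<..<L}" "a x0 < e" using cInf_lessD[OF ne] by blast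
    have "\<forall>\<^sub>F x in at_right 0. x \<in> {0<..<x0}" using x0 by (intro eventually_at_right_real) auto
    then show "\<forall>\<^sub>F x in at_right 0. a x < e"
    proof eventually_elim
      case (elim x)
      then have "a x \<le> a x0" using x0 by (intro mono_onD[OF assms(2)]) auto
      then show ?case using x0 by simp
    qed
  qed
  ultimately show ?thesis by blast
qed

context loss_distribution
begin

text \<open>The deductible cannot approach \<open>0\<close>: the retained loss is at most \<open>(1 + k) a\<close>, while its mean is the fixed positive number
  \<open>\<theta> - C\<close>. With \<open>k\<close> tending to \<open>0\<close> this drives the upper threshold \<open>a (1 + k) / k\<close> to infinity.\<close>

lemma threshold_family:
  fixes k a0 :: "real \<Rightarrow> real" and \<phi> :: "real \<Rightarrow> real \<Rightarrow> real" and L C :: real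
  defines "I \<equiv> {0<..<L}"
  assumes L: "0 < L"
    and k_pos: "\<And>x. x \<in> I \<Longrightarrow> 0 < k x" and k_mono: "mono_on I k"
    and k_lim: "(k \<longlongrightarrow> 0) (at_right 0)"
    and a0: "\<And>x. x \<in> I \<Longrightarrow> 0 \<le> a0 x"
    and \<phi>: "\<And>x. x \<in> I \<Longrightarrow> AE z in \<Theta>. \<phi> x z = cover (k x) (a0 x) z"
    and \<phi>_meas: "\<And>x. x \<in> I \<Longrightarrow> \<phi> x \<in> borel_measurable \<Theta>"
    and \<phi>_cost: "\<And>x. x \<in> I \<Longrightarrow> (\<integral>z. \<phi> x z \<partial>\<Theta>) = C"
    and C: "C < (\<integral>z. z \<partial>\<Theta>)"
  shows "(\<exists>a b. (\<forall>x\<in>I. has_thresholds \<Theta> (\<phi> x) (a x) (b x)) \<and>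
            tends_to_excess_of_loss a b \<and> monotone_thresholds I a b) \<and>
         (\<forall>a b. (\<forall>x\<in>I. has_thresholds \<Theta> (\<phi> x) (a x) (b x)) \<longrightarrow>
            tends_to_excess_of_loss a b \<and>
            (measure_support \<Theta> = {0..} \<longrightarrow> monotone_thresholds I a b))"
proof -
  define a where "a x = least_deductible C (k x)" for x
  define b where "b x = a x * (1 + k x) / k x" for x
  have ex: "cost (k x) (a0 x) = C" if "x \<in> I" for x
  proof -
    have "C = cost (k x) (a0 x)" unfolding cost_def \<phi>_cost[OF that, symmetric]
      by (intro integral_cong_AE cover_measurable \<phi> \<phi>_meas that)
    then show ?thesis by simp
  qed
  have a_cost: "cost (k x) (a x) = C" if "x \<in> I" for x
    unfolding a_def using k_pos[OF that] a0[OF that] ex[OF that] by (intro least_deductible(2)) auto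
  have a_pos: "0 < a x" if "x \<in> I" for x
  proof -
    have "0 \<le> a x" unfolding a_def using k_pos[OF that] a0[OF that] ex[OF that]
      by (intro least_deductible(1)) auto
    moreover have "a x \<noteq> 0" using a_cost[OF that] cost_zero[of "k x"] k_pos[OF that] C by auto
    ultimately show ?thesis by simp
  qed
  have thr: "has_thresholds \<Theta> (\<phi> x) (a x) (b x)" if "x \<in> I" for x
  proof -
    have "AE z in \<Theta>. cover (k x) (a0 x) z = cover (k x) (a x) z"
    proof (rule AE_eq_of_le_integral_eq)
      have "a x \<le> a0 x" unfolding a_def using a0[OF that] ex[OF that] by (intro least_deductible_le) auto
      then show "AE z in \<Theta>. cover (k x) (a0 x) z \<le> cover (k x) (a x) z"
        using k_pos[OF that] by (auto intro!: AE_I2 cover_antimono)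
    qed (use k_pos[OF that] a_cost[OF that] ex[OF that] in
          \<open>auto intro!: cover_integrable simp: cost_def\<close>)
    with \<phi>[OF that] have "AE z in \<Theta>. \<phi> x z = layer (a x) (b x) z"
      by eventually_elim (simp add: b_def layer_eq_cover(2) k_pos[OF that] a_pos[OF that])
    then show ?thesis
      using a_pos[OF that] layer_eq_cover(3)[of "k x" "a x"] k_pos[OF that]
      by (simp add: has_thresholds_def b_def)
  qed
  have slope: "slope (a x) (b x) = 1 + k x" if "x \<in> I" for x
    unfolding b_def using k_pos[OF that] a_pos[OF that] by (intro layer_eq_cover)
  have a_mono: "a x \<le> a y" if "x \<in> I" "y \<in> I" "x \<le> y" for x y
    unfolding a_def using that k_pos[of x] mono_onD[OF k_mono, of x y] a0[of y] ex[of y]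
    by (intro least_deductible_mono[of _ _ "a0 y"]) auto
  have b_anti: "b y \<le> b x" if "x \<in> I" "y \<in> I" "x \<le> y" for x y
    unfolding b_def a_def
    using that k_pos[of x] mono_onD[OF k_mono, of x y] a0[of x] a0[of y] ex[of x] ex[of y] a_pos[of x]
    by (intro least_full_cover_antimono[of "k x" "k y" "a0 x" C "a0 y"]) (auto simp: a_def)
  have mono: "monotone_thresholds I a b"
    unfolding monotone_thresholds_def
    using a_mono b_anti mono_onD[OF k_mono] by (auto simp: monotone_on_def slope)
  have ev: "\<forall>\<^sub>F x in at_right 0. x \<in> I" unfolding I_def using L by (rule eventually_at_right_real)
  define p where "p = ((\<integral>z. z \<partial>\<Theta>) - C) / measure \<Theta> (space \<Theta>)"
  have p: "0 < p" unfolding p_def using C total_mass_pos by simp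
  have a_low: "p / (1 + k x) \<le> a x" if "x \<in> I" for x
  proof -
    have "(\<integral>z. z \<partial>\<Theta>) - C \<le> (1 + k x) * a x * measure \<Theta> (space \<Theta>)"
      using retained_cost_le[of "k x" "a x"] k_pos[OF that] a_pos[OF that] a_cost[OF that] by simp
    then have "p \<le> (1 + k x) * a x"
      using total_mass_pos unfolding p_def by (simp add: pos_divide_le_eq)
    then show ?thesis using k_pos[OF that] by (simp add: pos_divide_le_eq mult.commute)
  qed
  obtain d where d: "0 \<le> d" "(a \<longlongrightarrow> d) (at_right 0)"
    using mono_on_tendsto_at_right[of L a 0] L a_mono a_pos
    unfolding I_def monotone_on_def by (meson less_imp_le)
  have slope_lim: "((\<lambda>x. slope (a x) (b x)) \<longlongrightarrow> 1) (at_right 0)"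
  proof (rule Lim_transform_eventually)
    show "((\<lambda>x. 1 + k x) \<longlongrightarrow> 1) (at_right 0)" using tendsto_add[OF tendsto_const k_lim, of 1] by simp
    show "\<forall>\<^sub>F x in at_right 0. 1 + k x = slope (a x) (b x)"
      using ev by eventually_elim (simp add: slope)
  qed
  have lim: "tends_to_excess_of_loss a b"
    unfolding tends_to_excess_of_loss_def
  proof (intro conjI exI[of _ d] allI impI)
    fix z :: real assume "0 \<le> z"
    have "((\<lambda>x. layer (a x) (b x) z) \<longlongrightarrow> min z (1 * max (z - d) 0)) (at_right 0)"
      unfolding layer_def by (intro tendsto_intros slope_lim d)
    also have "min z (1 * max (z - d) 0) = max (z - d) 0" using \<open>0 \<le> z\<close> d by auto
    finally show "((\<lambda>x. layer (a x) (b x) z) \<longlongrightarrow> max (z - d) 0) (at_right 0)" .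
  qed (use d slope_lim in auto)
  have uniq_ev: "\<forall>\<^sub>F x in at_right 0. \<forall>a' b'. has_thresholds \<Theta> (\<phi> x) a' b' \<longrightarrow> a' = a x \<and> b' = b x"
  proof -
    obtain z1 where z1: "z1 \<in> measure_support \<Theta>" "d + 1 < z1" using support_above by blast
    obtain z2 where z2: "z2 \<in> measure_support \<Theta>" "z1 < z2" using support_above by blast
    have "\<forall>\<^sub>F x in at_right 0. a x < z1" using order_tendstoD(2)[OF d(2), of z1] z1 by simp
    moreover have "\<forall>\<^sub>F x in at_right 0. k x < p / z2"
      using order_tendstoD(2)[OF k_lim, of "p / z2"] p z1 z2 d by simp
    ultimately show ?thesis using ev
    proof eventually_elim
      case (elim x)
      have "z2 < p / k x" using elim k_pos[OF elim(3)] z1 z2 d by (simp add: field_simps)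
      also have "p / k x \<le> b x"
        using a_low[OF elim(3)] k_pos[OF elim(3)] unfolding b_def
        by (intro divide_right_mono) (auto simp: pos_divide_le_eq)
      finally have "z2 < b x" .
      then show ?case
        using thresholds_unique[OF thr[OF elim(3)] _ a_pos[OF elim(3)] z1(1) z2(1)] elim(1) z2(2) by blast
    qed
  qed
  have all: "tends_to_excess_of_loss a' b' \<and> (measure_support \<Theta> = {0..} \<longrightarrow> monotone_thresholds I a' b')"
    if thr': "\<forall>x\<in>I. has_thresholds \<Theta> (\<phi> x) (a' x) (b' x)" for a' b'
  proof (intro conjI impI)
    have eq: "\<forall>\<^sub>F x in at_right 0. a x = a' x \<and> b x = b' x"
      using ev uniq_ev by eventually_elim (use thr' in auto)
    show "tends_to_excess_of_loss a' b'"
      using lim unfolding tends_to_excess_of_loss_def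
    proof (elim conjE exE, intro conjI exI allI impI)
      fix d z assume "\<forall>z\<ge>0. ((\<lambda>x. layer (a x) (b x) z) \<longlongrightarrow> max (z - d) 0) (at_right 0)" "0 \<le> (z::real)"
      then have "((\<lambda>x. layer (a x) (b x) z) \<longlongrightarrow> max (z - d) 0) (at_right 0)" by blast
      then show "((\<lambda>x. layer (a' x) (b' x) z) \<longlongrightarrow> max (z - d) 0) (at_right 0)"
        by (rule Lim_transform_eventually) (use eq in eventually_elim, simp)
    next
      assume "((\<lambda>x. slope (a x) (b x)) \<longlongrightarrow> 1) (at_right 0)"
      then show "((\<lambda>x. slope (a' x) (b' x)) \<longlongrightarrow> 1) (at_right 0)"
        by (rule Lim_transform_eventually) (use eq in eventually_elim, simp)
    qed
  next
    assume supp: "measure_support \<Theta> = {0..}"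
    have "a' x = a x \<and> b' x = b x" if "x \<in> I" for x
    proof -
      have ab: "0 < a x" "a x < b x" using a_pos[OF that] thr[OF that] by (auto simp: has_thresholds_def)
      show ?thesis
      proof (rule thresholds_unique[OF thr[OF that] thr'[rule_format, OF that] ab(1)])
        show "a x < (2 * a x + b x) / 3" "(2 * a x + b x) / 3 < (a x + 2 * b x) / 3"
          "(a x + 2 * b x) / 3 < b x" using ab by auto
      qed (use ab supp in auto)
    qed
    then show "monotone_thresholds I a' b'"
      using mono unfolding monotone_thresholds_def monotone_on_def by simp
  qed
  show ?thesis using thr lim mono all by blast
qed

end

section \<open>The optimal retention\<close>

lemma first_order_condition:
  fixes J1 J2 :: real
  assumes "\<And>e. 0 < e \<Longrightarrow> e \<le> 1 \<Longrightarrow> e * J1 + e\<^sup>2 * J2 \<le> 0"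
  shows "J1 \<le> 0"
proof (rule ccontr)
  assume "\<not> J1 \<le> 0"
  \<comment> \<open>With this step size the quadratic term is at most half of the linear one.\<close>
  define e where "e = min 1 (J1 / (2 * (\<bar>J2\<bar> + 1)))"
  have e: "0 < e" "e \<le> 1" unfolding e_def using \<open>\<not> J1 \<le> 0\<close> by auto
  have "e * \<bar>J2\<bar> \<le> J1 / (2 * (\<bar>J2\<bar> + 1)) * \<bar>J2\<bar>" unfolding e_def by (intro mult_right_mono) auto
  also have "\<dots> \<le> J1 / 2" using \<open>\<not> J1 \<le> 0\<close> by (simp add: field_simps)
  finally have "\<bar>e * J2\<bar> \<le> J1 / 2" using e by (simp add: abs_mult)
  then have "0 < J1 + e * J2" using \<open>\<not> J1 \<le> 0\<close> by linarith
  then have "0 < e * (J1 + e * J2)" using e by simp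
  also have "\<dots> = e * J1 + e\<^sup>2 * J2" by (simp add: algebra_simps power2_eq_square)
  finally show False using assms[OF e] by simp
qed

text \<open>The obtuse angle property of the projection of \<open>x\<close> onto the interval from \<open>0\<close> to \<open>z\<close>.\<close>

lemma clamp_projection:
  fixes u x z :: real
  assumes "0 \<le> u" "u \<le> z" defines "p \<equiv> max 0 (min z x)"
  shows "(p - u)\<^sup>2 \<le> (p - u) * (x - u)"
proof -
  have "0 \<le> (p - u) * (x - p)"
  proof -
    consider "x \<le> 0" "p = 0" | "p = x" | "z \<le> x" "p = z" unfolding p_def using assms by linarith
    then show ?thesis
      by cases (use assms in \<open>auto intro: mult_nonneg_nonpos mult_nonneg_nonneg\<close>)
  qed
  then show ?thesis by (simp add: algebra_simps power2_eq_square)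
qed

lemma uncovered_clamp:
  assumes "0 \<le> k" "0 \<le> z"
  shows "z - max 0 (min z (\<alpha> - k * z)) = cover k (\<alpha> / (1 + k)) z"
proof -
  have "(1 + k) * max (z - \<alpha> / (1 + k)) 0 = max ((1 + k) * (z - \<alpha> / (1 + k))) ((1 + k) * 0)"
    using assms by (simp add: max_mult_distrib_left)
  also have "\<dots> = max ((1 + k) * z - \<alpha>) 0" using assms by (simp add: right_diff_distrib)
  finally show ?thesis using assms by (auto simp: cover_def algebra_simps)
qed

context loss_distribution
begin

lemma contracts_iff: "\<psi> \<in> contracts \<Theta> \<longleftrightarrow> \<psi> \<in> borel_measurable \<Theta> \<and> (AE z in \<Theta>. 0 \<le> \<psi> z \<and> \<psi> z \<le> z)"
  by (simp add: contracts_def)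

lemma integrable_contract: "\<psi> \<in> contracts \<Theta> \<Longrightarrow> integrable \<Theta> \<psi>"
  by (intro integrable_dominated) (auto simp: contracts_iff)

lemma integrable_contract_mult:
  assumes "\<psi> \<in> contracts \<Theta>" "\<eta> \<in> contracts \<Theta>" shows "integrable \<Theta> (\<lambda>z. \<psi> z * \<eta> z)"
proof (rule Bochner_Integration.integrable_bound[OF integrable_loss2])
  have "AE z in \<Theta>. 0 \<le> \<psi> z \<and> \<psi> z \<le> z" "AE z in \<Theta>. 0 \<le> \<eta> z \<and> \<eta> z \<le> z"
    using assms by (simp_all add: contracts_iff)
  then show "AE z in \<Theta>. norm (\<psi> z * \<eta> z) \<le> norm (z\<^sup>2)"
    by eventually_elim (auto simp: power2_eq_square abs_mult intro!: mult_mono)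
qed (use assms in \<open>auto simp: contracts_iff\<close>)

lemma id_contract: "(\<lambda>z. z) \<in> contracts \<Theta>"
  using AE_loss_nonneg by (auto simp: contracts_iff intro!: borel_measurable_loss)

lemma uncovered_contract:
  assumes "\<psi> \<in> contracts \<Theta>" shows "(\<lambda>z. z - \<psi> z) \<in> contracts \<Theta>"
  unfolding contracts_iff
proof
  have \<psi>: "\<psi> \<in> borel_measurable \<Theta>" "AE z in \<Theta>. 0 \<le> \<psi> z \<and> \<psi> z \<le> z"
    using assms by (auto simp: contracts_def)
  show "(\<lambda>z. z - \<psi> z) \<in> borel_measurable \<Theta>"
    by (intro borel_measurable_diff \<psi> borel_measurable_loss) simp
  show "AE z in \<Theta>. 0 \<le> z - \<psi> z \<and> z - \<psi> z \<le> z" using \<psi>(2) by eventually_elim simp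
qed

definition retained_variance :: "real \<Rightarrow> real \<Rightarrow> real \<Rightarrow> (real \<Rightarrow> real) \<Rightarrow> real" where
  "retained_variance M G W \<psi> = M * (\<integral>z. (\<psi> z)\<^sup>2 \<partial>\<Theta>)
     + 2 * G * (\<integral>z. \<psi> z \<partial>\<Theta>) * (\<integral>z. z * \<psi> z \<partial>\<Theta>) + W * (\<integral>z. \<psi> z \<partial>\<Theta>)\<^sup>2"

text \<open>Moving from \<open>\<psi>\<close> towards the projection \<open>\<eta>\<close> of \<open>\<alpha> - k z\<close> stays in the convex set of contracts, so the derivative of the
  criterion in this direction is at most \<open>0\<close>. This derivative is a positive multiple of
  \<open>H[(\<eta> - \<psi>) (\<alpha> - k z - \<psi>)]\<close>, which by the projection property is at least \<open>H[(\<eta> - \<psi>)\<^sup>2]\<close>.\<close>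

lemma optimal_retention:
  assumes M: "0 < M" and \<gamma>: "0 < \<gamma>" and \<psi>: "\<psi> \<in> contracts \<Theta>"
    and opt: "\<And>\<eta>. \<eta> \<in> contracts \<Theta> \<Longrightarrow>
      l * (\<integral>z. \<eta> z \<partial>\<Theta>) - \<gamma> * retained_variance M G W \<eta>
      \<le> l * (\<integral>z. \<psi> z \<partial>\<Theta>) - \<gamma> * retained_variance M G W \<psi>"
  defines "k \<equiv> G * (\<integral>z. \<psi> z \<partial>\<Theta>) / M"
    and "\<alpha> \<equiv> (l / (2 * \<gamma>) - G * (\<integral>z. z * \<psi> z \<partial>\<Theta>) - W * (\<integral>z. \<psi> z \<partial>\<Theta>)) / M"
  shows "AE z in \<Theta>. \<psi> z = max 0 (min z (\<alpha> - k * z))"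
proof -
  define \<eta> where "\<eta> z = max 0 (min z (\<alpha> - k * z))" for z
  have \<eta>: "\<eta> \<in> contracts \<Theta>"
    using AE_loss_nonneg unfolding contracts_iff \<eta>_def[abs_def] by (auto intro!: borel_measurable_loss)
  define d where "d z = \<eta> z - \<psi> z" for z
  note int [simp] = integrable_contract[OF \<psi>] integrable_contract[OF \<eta>]
    integrable_contract_mult[OF \<psi> \<psi>] integrable_contract_mult[OF \<psi> \<eta>]
    integrable_contract_mult[OF \<eta> \<eta>] integrable_contract_mult[OF id_contract \<psi>]
    integrable_contract_mult[OF id_contract \<eta>]
  have d_int [simp]: "integrable \<Theta> d" "integrable \<Theta> (\<lambda>z. z * d z)" "integrable \<Theta> (\<lambda>z. \<psi> z * d z)"
    "integrable \<Theta> (\<lambda>z. d z * d z)"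
    using int by (simp_all add: d_def[abs_def] right_diff_distrib left_diff_distrib mult.commute[of "\<eta> _" "\<psi> _"])
  define J1 where "J1 = l * (\<integral>z. d z \<partial>\<Theta>) - \<gamma> * (2 * M * (\<integral>z. \<psi> z * d z \<partial>\<Theta>)
     + 2 * G * ((\<integral>z. d z \<partial>\<Theta>) * (\<integral>z. z * \<psi> z \<partial>\<Theta>) + (\<integral>z. \<psi> z \<partial>\<Theta>) * (\<integral>z. z * d z \<partial>\<Theta>))
     + 2 * W * (\<integral>z. \<psi> z \<partial>\<Theta>) * (\<integral>z. d z \<partial>\<Theta>))"
  define J2 where "J2 = - \<gamma> * (M * (\<integral>z. d z * d z \<partial>\<Theta>) + 2 * G * (\<integral>z. d z \<partial>\<Theta>) * (\<integral>z. z * d z \<partial>\<Theta>)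
     + W * (\<integral>z. d z \<partial>\<Theta>)\<^sup>2)"
  have "J1 \<le> 0"
  proof (rule first_order_condition)
    fix e :: real assume e: "0 < e" "e \<le> 1"
    let ?\<psi> = "\<lambda>z. \<psi> z + e * d z"
    have "AE z in \<Theta>. 0 \<le> \<psi> z \<and> \<psi> z \<le> z" "AE z in \<Theta>. 0 \<le> \<eta> z \<and> \<eta> z \<le> z"
      using \<psi> \<eta> by (simp_all add: contracts_iff)
    then have "AE z in \<Theta>. 0 \<le> ?\<psi> z \<and> ?\<psi> z \<le> z"
    proof eventually_elim
      case (elim z)
      have "?\<psi> z = (1 - e) * \<psi> z + e * \<eta> z" by (simp add: d_def algebra_simps)
      moreover have "(1 - e) * \<psi> z + e * \<eta> z \<le> (1 - e) * z + e * z"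
        using elim e by (intro add_mono mult_left_mono) auto
      moreover have "0 \<le> (1 - e) * \<psi> z + e * \<eta> z" using elim e by simp
      moreover have "(1 - e) * z + e * z = z" by (simp add: algebra_simps)
      ultimately show ?case by simp
    qed
    then have "?\<psi> \<in> contracts \<Theta>" using \<psi> \<eta> by (auto simp: contracts_iff d_def)
    note le = opt[OF this]
    have H1: "(\<integral>z. ?\<psi> z \<partial>\<Theta>) = (\<integral>z. \<psi> z \<partial>\<Theta>) + e * (\<integral>z. d z \<partial>\<Theta>)" by simp
    have H2: "(\<integral>z. z * ?\<psi> z \<partial>\<Theta>) = (\<integral>z. z * \<psi> z \<partial>\<Theta>) + e * (\<integral>z. z * d z \<partial>\<Theta>)"
      by (simp add: distrib_left mult.left_commute[of _ e])
    have "(?\<psi> z)\<^sup>2 = \<psi> z * \<psi> z + (2 * e * (\<psi> z * d z) + e\<^sup>2 * (d z * d z))" for z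
      by (simp add: algebra_simps power2_eq_square)
    then have H3: "(\<integral>z. (?\<psi> z)\<^sup>2 \<partial>\<Theta>) = (\<integral>z. (\<psi> z)\<^sup>2 \<partial>\<Theta>) + (2 * e * (\<integral>z. \<psi> z * d z \<partial>\<Theta>)
        + e\<^sup>2 * (\<integral>z. d z * d z \<partial>\<Theta>))"
      by (simp add: power2_eq_square)
    from le show "e * J1 + e\<^sup>2 * J2 \<le> 0"
      unfolding retained_variance_def H1 H2 H3 J1_def J2_def
      by (simp add: algebra_simps power2_eq_square)
  qed
  have "J1 = 2 * \<gamma> * M * (\<integral>z. d z * (\<alpha> - k * z - \<psi> z) \<partial>\<Theta>)"
  proof -
    have "(\<integral>z. d z * (\<alpha> - k * z - \<psi> z) \<partial>\<Theta>) = (\<integral>z. \<alpha> * d z - k * (z * d z) - \<psi> z * d z \<partial>\<Theta>)"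
      by (simp add: algebra_simps)
    also have "\<dots> = \<alpha> * (\<integral>z. d z \<partial>\<Theta>) - k * (\<integral>z. z * d z \<partial>\<Theta>) - (\<integral>z. \<psi> z * d z \<partial>\<Theta>)"
      by simp
    finally show ?thesis unfolding J1_def \<alpha>_def k_def using M \<gamma> by (simp add: field_simps)
  qed
  with \<open>J1 \<le> 0\<close> have "(\<integral>z. d z * (\<alpha> - k * z - \<psi> z) \<partial>\<Theta>) \<le> 0"
    using M \<gamma> by (simp add: mult_le_0_iff)
  moreover have "(\<integral>z. (d z)\<^sup>2 \<partial>\<Theta>) \<le> (\<integral>z. d z * (\<alpha> - k * z - \<psi> z) \<partial>\<Theta>)"
  proof (rule integral_mono_AE)
    have "integrable \<Theta> (\<lambda>z. \<alpha> * d z - k * (z * d z) - \<psi> z * d z)" by simp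
    then show "integrable \<Theta> (\<lambda>z. d z * (\<alpha> - k * z - \<psi> z))" by (simp add: algebra_simps)
    have "AE z in \<Theta>. 0 \<le> \<psi> z \<and> \<psi> z \<le> z" using \<psi> by (simp add: contracts_iff)
    then show "AE z in \<Theta>. (d z)\<^sup>2 \<le> d z * (\<alpha> - k * z - \<psi> z)"
      unfolding d_def \<eta>_def by eventually_elim (rule clamp_projection, auto)
  qed (simp add: power2_eq_square)
  moreover have "0 \<le> (\<integral>z. (d z)\<^sup>2 \<partial>\<Theta>)" by simp
  ultimately have "(\<integral>z. (d z)\<^sup>2 \<partial>\<Theta>) = 0" by linarith
  then have "AE z in \<Theta>. (d z)\<^sup>2 = 0"
    using integral_nonneg_eq_0_iff_AE[of \<Theta> "\<lambda>z. (d z)\<^sup>2"] by (simp add: power2_eq_square)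
  then show ?thesis by eventually_elim (simp add: d_def \<eta>_def)
qed

text \<open>A positive loading \<open>l\<close> excludes full cover: without retention the first-order condition would have \<open>k = 0\<close> and
  \<open>\<alpha> > 0\<close>, and so prescribe a positive retention.\<close>

lemma optimal_cover:
  assumes M: "0 < M" and \<gamma>: "0 < \<gamma>" and l: "0 < l" and G: "0 \<le> G" and \<phi>: "\<phi> \<in> contracts \<Theta>"
    and opt: "\<And>h. h \<in> contracts \<Theta> \<Longrightarrow>
      l * (\<integral>z. z - h z \<partial>\<Theta>) - \<gamma> * retained_variance M G W (\<lambda>z. z - h z)
      \<le> l * (\<integral>z. z - \<phi> z \<partial>\<Theta>) - \<gamma> * retained_variance M G W (\<lambda>z. z - \<phi> z)"
  defines "k \<equiv> G * ((\<integral>z. z \<partial>\<Theta>) - (\<integral>z. \<phi> z \<partial>\<Theta>)) / M"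
  shows "(\<integral>z. \<phi> z \<partial>\<Theta>) < (\<integral>z. z \<partial>\<Theta>)" "\<exists>a\<ge>0. AE z in \<Theta>. \<phi> z = cover k a z"
proof -
  define \<psi> where "\<psi> z = z - \<phi> z" for z
  have \<psi>: "\<psi> \<in> contracts \<Theta>" unfolding \<psi>_def[abs_def] by (rule uncovered_contract[OF \<phi>])
  have mean: "(\<integral>z. \<psi> z \<partial>\<Theta>) = (\<integral>z. z \<partial>\<Theta>) - (\<integral>z. \<phi> z \<partial>\<Theta>)"
    unfolding \<psi>_def using integrable_contract[OF \<phi>] by simp
  define \<alpha> where "\<alpha> = (l / (2 * \<gamma>) - G * (\<integral>z. z * \<psi> z \<partial>\<Theta>) - W * (\<integral>z. \<psi> z \<partial>\<Theta>)) / M"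
  have clamp: "AE z in \<Theta>. \<psi> z = max 0 (min z (\<alpha> - k * z))"
    unfolding k_def mean[symmetric] \<alpha>_def
  proof (rule optimal_retention[OF M \<gamma> \<psi>, of l])
    fix \<eta> assume "\<eta> \<in> contracts \<Theta>"
    from opt[OF uncovered_contract[OF this]]
    show "l * (\<integral>z. \<eta> z \<partial>\<Theta>) - \<gamma> * retained_variance M G W \<eta>
        \<le> l * (\<integral>z. \<psi> z \<partial>\<Theta>) - \<gamma> * retained_variance M G W \<psi>"
      by (simp add: \<psi>_def[abs_def])
  qed
  have nonneg: "AE z in \<Theta>. 0 \<le> \<psi> z" using \<psi> by (auto simp: contracts_iff)
  have "0 \<le> (\<integral>z. \<psi> z \<partial>\<Theta>)" by (rule integral_nonneg_AE[OF nonneg])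
  moreover have "(\<integral>z. \<psi> z \<partial>\<Theta>) \<noteq> 0"
  proof
    assume 0: "(\<integral>z. \<psi> z \<partial>\<Theta>) = 0"
    then have z: "AE z in \<Theta>. \<psi> z = 0"
      using integral_nonneg_eq_0_iff_AE[OF integrable_contract[OF \<psi>] nonneg] by simp
    then have "(\<integral>z. z * \<psi> z \<partial>\<Theta>) = (\<integral>z. 0 \<partial>\<Theta>)"
      using integrable_contract_mult[OF id_contract \<psi>] by (intro integral_cong_AE) auto
    then have "k = 0" "0 < \<alpha>" using 0 M l \<gamma> mean by (simp_all add: k_def \<alpha>_def)
    have "AE z in \<Theta>. z = 0"
      using z clamp AE_loss_nonneg
    proof eventually_elim
      case (elim z)
      then show ?case using \<open>k = 0\<close> \<open>0 < \<alpha>\<close> by (auto simp: max_def min_def split: if_splits)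
    qed
    then have "(\<integral>z. z \<partial>\<Theta>) = (\<integral>z. 0 \<partial>\<Theta>)" by (intro integral_cong_AE borel_measurable_loss) auto
    then show False using mean_pos by simp
  qed
  ultimately have pos: "0 < (\<integral>z. \<psi> z \<partial>\<Theta>)" by simp
  then show "(\<integral>z. \<phi> z \<partial>\<Theta>) < (\<integral>z. z \<partial>\<Theta>)" using mean by simp
  have k: "0 \<le> k" using pos G M mean by (simp add: k_def)
  have "0 \<le> \<alpha>"
  proof (rule ccontr)
    assume "\<not> 0 \<le> \<alpha>"
    from clamp AE_loss_nonneg have "AE z in \<Theta>. \<psi> z = 0"
    proof eventually_elim
      case (elim z)
      have "0 \<le> k * z" using k elim by simp
      then have "\<alpha> - k * z \<le> 0" using \<open>\<not> 0 \<le> \<alpha>\<close> by linarith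
      then show ?case using elim by (auto simp: max_def min_def)
    qed
    then have "(\<integral>z. \<psi> z \<partial>\<Theta>) = (\<integral>z. 0 \<partial>\<Theta>)" using \<psi> by (intro integral_cong_AE) (auto simp: contracts_iff)
    then show False using pos by simp
  qed
  moreover from clamp AE_loss_nonneg have "AE z in \<Theta>. \<phi> z = cover k (\<alpha> / (1 + k)) z"
  proof eventually_elim
    case (elim z)
    have "\<phi> z = z - \<psi> z" by (simp add: \<psi>_def)
    then show ?case using elim uncovered_clamp[OF k elim(2), of \<alpha>] by simp
  qed
  ultimately show "\<exists>a\<ge>0. AE z in \<Theta>. \<phi> z = cover k a z" using k by (intro exI[of _ "\<alpha> / (1 + k)"]) auto
qed

end

section \<open>Dependence of the slope on the branching coefficient\<close>

text \<open>The integral of \<open>exp (- \<kappa> u)\<close> over \<open>u\<close> from \<open>0\<close> to \<open>t\<close>.\<close>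

definition gain :: "real \<Rightarrow> real \<Rightarrow> real" where
  "gain \<kappa> t = (1 - exp (- \<kappa> * t)) / \<kappa>"

text \<open>The integral of \<open>u exp (- \<kappa> u)\<close> over \<open>u\<close> from \<open>0\<close> to \<open>t\<close>; it is also the derivative of \<open>gain (\<beta> - x) t\<close> in \<open>x\<close>.\<close>

definition gain2 :: "real \<Rightarrow> real \<Rightarrow> real" where
  "gain2 \<kappa> t = (1 - exp (- \<kappa> * t) * (1 + \<kappa> * t)) / \<kappa>\<^sup>2"

lemma gain_deriv:
  assumes "\<kappa> \<noteq> 0" shows "(gain \<kappa> has_real_derivative exp (- \<kappa> * t)) (at t within S)"
  unfolding gain_def[abs_def] using assms by (auto intro!: derivative_eq_intros)

lemma gain2_deriv:
  assumes "\<kappa> \<noteq> 0" shows "(gain2 \<kappa> has_real_derivative t * exp (- \<kappa> * t)) (at t within S)"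
  unfolding gain2_def[abs_def] using assms
  by (auto intro!: derivative_eq_intros simp: field_simps power2_eq_square)

lemma gain_deriv_eq: "\<kappa> \<noteq> 0 \<Longrightarrow> exp (- \<kappa> * t) = 1 - \<kappa> * gain \<kappa> t"
  by (simp add: gain_def)

lemma gain2_deriv_eq: "\<kappa> \<noteq> 0 \<Longrightarrow> t * exp (- \<kappa> * t) = gain \<kappa> t - \<kappa> * gain2 \<kappa> t"
  by (simp add: gain_def gain2_def field_simps power2_eq_square)

lemma gain_0 [simp]: "gain \<kappa> 0 = 0" "gain2 \<kappa> 0 = 0"
  by (simp_all add: gain_def gain2_def)

lemma continuous_on_gain [continuous_intros]:
  "continuous_on S f \<Longrightarrow> continuous_on S (\<lambda>t. gain \<kappa> (f t))"
  "continuous_on S f \<Longrightarrow> continuous_on S (\<lambda>t. gain2 \<kappa> (f t))"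
  unfolding gain_def gain2_def divide_inverse by (intro continuous_intros; assumption)+

lemma gain_bounds:
  assumes "0 < \<kappa>" "0 \<le> t"
  shows "0 \<le> gain \<kappa> t" "gain \<kappa> t \<le> t" "0 \<le> gain2 \<kappa> t" "gain2 \<kappa> t \<le> t\<^sup>2"
proof -
  show "0 \<le> gain \<kappa> t" using assms by (simp add: gain_def)
  have "1 - \<kappa> * t \<le> exp (- \<kappa> * t)" using exp_ge_add_one_self[of "- \<kappa> * t"] by simp
  then show "gain \<kappa> t \<le> t" using assms by (simp add: gain_def divide_le_eq mult.commute)
  have "1 + \<kappa> * t \<le> exp (\<kappa> * t)" by (rule exp_ge_add_one_self)
  then have "exp (- \<kappa> * t) * (1 + \<kappa> * t) \<le> exp (- \<kappa> * t) * exp (\<kappa> * t)" by (intro mult_left_mono) auto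
  also have "\<dots> = 1" by (simp add: exp_add[symmetric])
  finally show "0 \<le> gain2 \<kappa> t" using assms by (simp add: gain2_def)
  have "(1 - \<kappa> * t) * (1 + \<kappa> * t) \<le> exp (- \<kappa> * t) * (1 + \<kappa> * t)"
    using \<open>1 - \<kappa> * t \<le> exp (- \<kappa> * t)\<close> assms by (intro mult_right_mono) auto
  then show "gain2 \<kappa> t \<le> t\<^sup>2"
    using assms by (simp add: gain2_def divide_le_eq power2_eq_square algebra_simps)
qed

text \<open>The denominator \<open>D x\<close> is the expected number of events per unit of baseline intensity, as a function of the mean excitation \<open>x\<close>
  per event. The integral in the numerator is \<open>D' x\<close>.\<close>

definition branching_ratio :: "real \<Rightarrow> real \<Rightarrow> real \<Rightarrow> real" where
  "branching_ratio \<beta> T x =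
     x * integral {0..T} (\<lambda>t. gain (\<beta> - x) t + x * gain2 (\<beta> - x) t)
       / integral {0..T} (\<lambda>t. 1 + x * gain (\<beta> - x) t)"

lemma branching_ratio_denominator:
  assumes "0 < T" "0 \<le> x" "x < \<beta>"
  shows "T \<le> integral {0..T} (\<lambda>t. 1 + x * gain (\<beta> - x) t)"
proof -
  have "integral {0..T} (\<lambda>t. 1 :: real) \<le> integral {0..T} (\<lambda>t. 1 + x * gain (\<beta> - x) t)"
    using assms gain_bounds[of "\<beta> - x"]
    by (intro integral_le integrable_continuous_interval continuous_intros) auto
  then show ?thesis using assms by simp
qed

lemma branching_ratio_nonneg:
  assumes "0 < T" "0 \<le> x" "x < \<beta>" shows "0 \<le> branching_ratio \<beta> T x"
  unfolding branching_ratio_def using assms gain_bounds[of "\<beta> - x"] branching_ratio_denominator[OF assms]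
  by (intro divide_nonneg_nonneg mult_nonneg_nonneg integral_nonneg integrable_continuous_interval
      continuous_intros) auto

lemma branching_ratio_le:
  assumes "0 < T" "0 \<le> x" "x < \<beta>"
  shows "branching_ratio \<beta> T x \<le> x * (T + x * T\<^sup>2)"
proof -
  let ?N = "integral {0..T} (\<lambda>t. gain (\<beta> - x) t + x * gain2 (\<beta> - x) t)"
  let ?D = "integral {0..T} (\<lambda>t. 1 + x * gain (\<beta> - x) t)"
  have "?N \<le> integral {0..T} (\<lambda>t. T + x * T\<^sup>2)"
  proof (intro integral_le integrable_continuous_interval continuous_intros)
    fix t assume t: "t \<in> {0..T}"
    then have "t\<^sup>2 \<le> T\<^sup>2" by (intro power_mono) auto
    then have "gain2 (\<beta> - x) t \<le> T\<^sup>2" by (rule order_trans[rotated]) (use assms t in \<open>auto intro: gain_bounds\<close>)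
    then show "gain (\<beta> - x) t + x * gain2 (\<beta> - x) t \<le> T + x * T\<^sup>2"
      using gain_bounds[of "\<beta> - x" t] assms t by (intro add_mono mult_left_mono) auto
  qed
  also have "\<dots> = T * (T + x * T\<^sup>2)" using assms by simp
  also have "\<dots> \<le> ?D * (T + x * T\<^sup>2)"
    using branching_ratio_denominator[OF assms] assms by (intro mult_right_mono) auto
  finally have "?N / ?D \<le> T + x * T\<^sup>2"
    using branching_ratio_denominator[OF assms] assms by (simp add: divide_le_eq mult.commute)
  then have "x * (?N / ?D) \<le> x * (T + x * T\<^sup>2)" using assms by (intro mult_left_mono) auto
  then show ?thesis by (simp add: branching_ratio_def)
qed

lemma branching_ratio_pos:
  assumes "0 < T" "0 < x" "x < \<beta>" shows "0 < branching_ratio \<beta> T x"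
proof -
  have "integral {0..T} (\<lambda>t. gain (\<beta> - x) t + x * gain2 (\<beta> - x) t) \<noteq> 0"
  proof
    assume "integral {0..T} (\<lambda>t. gain (\<beta> - x) t + x * gain2 (\<beta> - x) t) = 0"
    then have "gain (\<beta> - x) T + x * gain2 (\<beta> - x) T = 0"
      using integral_eq_0_iff[of 0 T "\<lambda>t. gain (\<beta> - x) t + x * gain2 (\<beta> - x) t"] assms
        gain_bounds[of "\<beta> - x"] by (force intro!: continuous_intros)
    moreover have "0 < gain (\<beta> - x) T"
      using assms unfolding gain_def by (intro divide_pos_pos) (auto simp: mult_neg_pos)
    moreover have "0 \<le> x * gain2 (\<beta> - x) T" using assms gain_bounds(3)[of "\<beta> - x" T] by simp
    ultimately show False by linarith
  qed
  then have "branching_ratio \<beta> T x \<noteq> 0"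
    unfolding branching_ratio_def using branching_ratio_denominator[of T x \<beta>] assms by simp
  then show ?thesis using branching_ratio_nonneg[of T x \<beta>] assms by simp
qed

text \<open>Put \<open>r = x D' x / D x\<close>. The claim \<open>y D' y \<ge> r D y\<close> says that a certain double integral of
  \<open>y exp (- (\<beta> - y) s) (1 + y s - r)\<close> is at least \<open>r T\<close>, with equality for \<open>x\<close> in place of \<open>y\<close>. The factor
  \<open>1 + x s - r\<close> changes sign once, from negative to positive, and the quotient of the exponentials increases in
  \<open>s\<close>. So the integrand for \<open>y\<close> is at least \<open>K\<close> times that for \<open>x\<close>, where \<open>K \<ge> 1\<close> is \<open>y / x\<close> times the value of this quotient at the
  sign change.\<close>

lemma branching_ratio_mono:
  assumes "0 < T" "0 < x" "x \<le> y" "y < \<beta>"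
  shows "branching_ratio \<beta> T x \<le> branching_ratio \<beta> T y"
proof -
  define r where "r = branching_ratio \<beta> T x"
  define F where "F u t = u * gain (\<beta> - u) t + u\<^sup>2 * gain2 (\<beta> - u) t - r * (u * gain (\<beta> - u) t)" for u t
  have r: "0 \<le> r" unfolding r_def using assms by (intro branching_ratio_nonneg) auto
  have F_integral: "((\<lambda>s. u * exp (- (\<beta> - u) * s) * (1 + u * s - r)) has_integral F u t) {0..t}"
    if "u < \<beta>" "0 \<le> t" for u t
  proof -
    have "((\<lambda>s. u * exp (- (\<beta> - u) * s) * (1 + u * s - r)) has_integral (F u t - F u 0)) {0..t}"
    proof (rule fundamental_theorem_of_calculus)
      fix s assume "s \<in> {0..t}"
      show "(F u has_vector_derivative u * exp (- (\<beta> - u) * s) * (1 + u * s - r)) (at s within {0..t})"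
        unfolding F_def[abs_def] has_real_derivative_iff_has_vector_derivative[symmetric]
        using \<open>u < \<beta>\<close>
        by (auto intro!: derivative_eq_intros gain_deriv gain2_deriv simp: algebra_simps power2_eq_square)
    qed (use that in auto)
    then show ?thesis by (simp add: F_def)
  qed
  have F_int: "integral {0..T} (F u) =
      u * integral {0..T} (\<lambda>t. gain (\<beta> - u) t + u * gain2 (\<beta> - u) t)
      - r * (integral {0..T} (\<lambda>t. 1 + u * gain (\<beta> - u) t) - T)" if "u < \<beta>" for u
  proof -
    have "integral {0..T} (F u) = integral {0..T} (\<lambda>t. u * (gain (\<beta> - u) t + u * gain2 (\<beta> - u) t)
        - r * ((1 + u * gain (\<beta> - u) t) - 1))"
      unfolding F_def[abs_def] by (simp add: algebra_simps power2_eq_square)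
    also have "\<dots> = u * integral {0..T} (\<lambda>t. gain (\<beta> - u) t + u * gain2 (\<beta> - u) t)
      - r * (integral {0..T} (\<lambda>t. 1 + u * gain (\<beta> - u) t) - integral {0..T} (\<lambda>t. 1))"
      by (subst Henstock_Kurzweil_Integration.integral_diff integral_mult_right;
          (intro integrable_continuous_interval continuous_intros)?)+ simp
    finally show ?thesis using assms by simp
  qed
  have D: "0 < integral {0..T} (\<lambda>t. 1 + u * gain (\<beta> - u) t)" if "0 \<le> u" "u < \<beta>" for u
    using branching_ratio_denominator[of T u \<beta>] assms that by simp
  have Fx: "integral {0..T} (F x) = r * T"
    using F_int[of x] D[of x] assms by (simp add: r_def branching_ratio_def field_simps)
  \<comment> \<open>The sign change of \<open>1 + x s - r\<close>, or \<open>0\<close> if it is negative.\<close>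
  define s0 where "s0 = max 0 ((r - 1) / x)"
  define K where "K = y / x * exp ((y - x) * s0)"
  have "1 * 1 \<le> y / x * exp ((y - x) * s0)"
    using assms by (intro mult_mono) (auto simp: s0_def)
  then have K: "1 \<le> K" by (simp add: K_def)
  have pw: "K * (x * exp (- (\<beta> - x) * s) * (1 + x * s - r)) \<le> y * exp (- (\<beta> - y) * s) * (1 + y * s - r)"
    if "0 \<le> s" for s
  proof -
    have "exp ((y - x) * s0) * (1 + x * s - r) \<le> exp ((y - x) * s) * (1 + x * s - r)"
    proof (cases "s0 \<le> s")
      case True
      then have "(r - 1) / x \<le> s" by (simp add: s0_def)
      then have "0 \<le> 1 + x * s - r" using assms by (simp add: pos_divide_le_eq mult.commute)
      with True show ?thesis using assms by (intro mult_right_mono) (auto intro!: mult_left_mono)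
    next
      case False
      then have "s < (r - 1) / x" using that by (auto simp: s0_def max_def split: if_splits)
      then have "1 + x * s - r \<le> 0" using assms by (simp add: pos_less_divide_eq mult.commute)
      with False show ?thesis using assms by (intro mult_right_mono_neg) (auto intro!: mult_left_mono)
    qed
    also have "\<dots> \<le> exp ((y - x) * s) * (1 + y * s - r)"
      using assms that by (intro mult_left_mono) (auto intro!: mult_right_mono)
    finally have "y * exp (- (\<beta> - x) * s) * (exp ((y - x) * s0) * (1 + x * s - r))
        \<le> y * exp (- (\<beta> - x) * s) * (exp ((y - x) * s) * (1 + y * s - r))"
      using assms by (intro mult_left_mono) auto
    moreover have "exp (- (\<beta> - x) * s) * (exp ((y - x) * s) * c) = exp (- (\<beta> - y) * s) * c" for c
      unfolding mult.assoc[symmetric] exp_add[symmetric] by (simp add: algebra_simps)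
    ultimately have "y * (exp (- (\<beta> - x) * s) * (exp ((y - x) * s0) * (1 + x * s - r)))
        \<le> y * (exp (- (\<beta> - y) * s) * (1 + y * s - r))"
      by (simp only: mult.assoc)
    moreover have "K * (x * c) = y * (exp ((y - x) * s0) * c)" for c using assms by (simp add: K_def)
    ultimately show ?thesis by (simp only: mult.assoc mult.left_commute[of "exp (- (\<beta> - x) * s)"])
  qed
  have F_le: "K * F x t \<le> F y t" if "0 \<le> t" for t
  proof (rule has_integral_le)
    show "((\<lambda>s. K * (x * exp (- (\<beta> - x) * s) * (1 + x * s - r))) has_integral K * F x t) {0..t}"
      using F_integral[of x t] assms that by (intro has_integral_mult_right) auto
    show "((\<lambda>s. y * exp (- (\<beta> - y) * s) * (1 + y * s - r)) has_integral F y t) {0..t}"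
      using F_integral[of y t] assms that by auto
  qed (use pw in auto)
  have "1 * (r * T) \<le> K * (r * T)" using K r assms by (intro mult_right_mono) auto
  then have "r * T \<le> K * (r * T)" by simp
  also have "\<dots> = integral {0..T} (\<lambda>t. K * F x t)" by (simp add: Fx)
  also have "\<dots> \<le> integral {0..T} (F y)"
  proof (rule integral_le)
    show "(\<lambda>t. K * F x t) integrable_on {0..T}" "F y integrable_on {0..T}"
      unfolding F_def[abs_def] by (intro integrable_continuous_interval continuous_intros)+
  qed (use F_le in auto)
  finally have "r * integral {0..T} (\<lambda>t. 1 + y * gain (\<beta> - y) t)
      \<le> y * integral {0..T} (\<lambda>t. gain (\<beta> - y) t + y * gain2 (\<beta> - y) t)"
    using F_int[of y] assms by (simp add: algebra_simps)
  then show ?thesis using D[of y] assms by (simp add: r_def branching_ratio_def[of \<beta> T y] pos_le_divide_eq)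
qed

lemma branching_ratio_tendsto_0:
  assumes "0 < T" "0 < \<beta>" shows "(branching_ratio \<beta> T \<longlongrightarrow> 0) (at_right 0)"
proof (rule tendsto_sandwich)
  have ev: "\<forall>\<^sub>F x in at_right 0. x \<in> {0<..<\<beta>}" using assms(2) by (rule eventually_at_right_real)
  show "\<forall>\<^sub>F x in at_right 0. 0 \<le> branching_ratio \<beta> T x"
    using ev by eventually_elim (use assms branching_ratio_nonneg in auto)
  show "\<forall>\<^sub>F x in at_right 0. branching_ratio \<beta> T x \<le> x * (T + x * T\<^sup>2)"
    using ev by eventually_elim (use assms branching_ratio_le in auto)
  show "((\<lambda>x. x * (T + x * T\<^sup>2)) \<longlongrightarrow> 0) (at_right 0)" by (auto intro!: tendsto_eq_intros)
qed auto

section \<open>Shot noise\<close>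

lemma (in complete_measure) borel_measurable_AE_eq:
  fixes f g :: "'a \<Rightarrow> real"
  assumes g: "g \<in> borel_measurable M" and eq: "AE x in M. f x = g x"
  shows "f \<in> borel_measurable M"
proof (rule measurableI)
  fix A :: "real set" assume A: "A \<in> sets borel"
  obtain N where N: "N \<in> null_sets M" "{x \<in> space M. f x \<noteq> g x} \<subseteq> N"
    using eq by (auto simp: eventually_ae_filter)
  have sub: "B \<in> sets M" if "B \<subseteq> N" for B using complete[OF that N(1)] by auto
  have "f -` A \<inter> space M = ((g -` A \<inter> space M) - N) \<union> (f -` A \<inter> space M \<inter> N)"
    using N(2) by auto
  also have "\<dots> \<in> sets M"
    using measurable_sets[OF g A] N(1) sub[of "f -` A \<inter> space M \<inter> N"] by auto
  finally show "f -` A \<inter> space M \<in> sets M" .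
qed simp

lemma shot_noise_has_integral:
  fixes c s :: "nat \<Rightarrow> real"
  assumes \<beta>: "0 < \<beta>" and fin: "\<And>t. finite {i. s i < t}" and pos: "\<And>i. 0 < s i" and t: "0 \<le> t"
  shows "((\<lambda>u. \<Sum>i | s i < u. c i * exp (- \<beta> * (u - s i))) has_integral
      (\<Sum>i | s i < t. c i * (1 - exp (- \<beta> * (t - s i))) / \<beta>)) {0..t}"
proof -
  have one: "((\<lambda>u. if s i < u then c i * exp (- \<beta> * (u - s i)) else 0) has_integral
      c i * (1 - exp (- \<beta> * (t - s i))) / \<beta>) {0..t}" if "s i < t" for i
  proof -
    have "((\<lambda>u. c i * exp (- \<beta> * (u - s i))) has_integral
        (- c i * exp (- \<beta> * (t - s i)) / \<beta> - (- c i * exp (- \<beta> * (s i - s i)) / \<beta>))) {s i..t}"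
    proof (rule fundamental_theorem_of_calculus)
      fix u assume "u \<in> {s i..t}"
      show "((\<lambda>u. - c i * exp (- \<beta> * (u - s i)) / \<beta>) has_vector_derivative
          c i * exp (- \<beta> * (u - s i))) (at u within {s i..t})"
        unfolding has_real_derivative_iff_has_vector_derivative[symmetric]
        using \<beta> by (auto intro!: derivative_eq_intros)
    qed (use that in simp)
    then have "((\<lambda>u. c i * exp (- \<beta> * (u - s i))) has_integral
        c i * (1 - exp (- \<beta> * (t - s i))) / \<beta>) {s i..t}" by (simp add: right_diff_distrib diff_divide_distrib)
    then have "((\<lambda>u. if u \<in> {s i..t} then c i * exp (- \<beta> * (u - s i)) else 0) has_integral
        c i * (1 - exp (- \<beta> * (t - s i))) / \<beta>) {0..t}"
      using pos[of i] by (subst has_integral_restrict) auto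
    then show ?thesis
      by (rule has_integral_spike[where S="{s i}", rotated 2]) auto
  qed
  have "((\<lambda>u. \<Sum>i | s i < t. if s i < u then c i * exp (- \<beta> * (u - s i)) else 0) has_integral
      (\<Sum>i | s i < t. c i * (1 - exp (- \<beta> * (t - s i))) / \<beta>)) {0..t}"
    using fin one by (intro has_integral_sum) auto
  moreover have "(\<Sum>i | s i < t. if s i < u then c i * exp (- \<beta> * (u - s i)) else 0)
      = (\<Sum>i | s i < u. c i * exp (- \<beta> * (u - s i)))" if "u \<in> {0..t}" for u
    using that fin by (intro sum.mono_neutral_cong_right) auto
  ultimately show ?thesis by (subst has_integral_cong[symmetric]) auto
qed

lemma zero_of_linear_integral_equation:
  fixes \<delta> :: "real \<Rightarrow> real"
  assumes int: "\<And>t. 0 \<le> t \<Longrightarrow> \<delta> integrable_on {0..t}"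
    and eq: "\<And>t. 0 \<le> t \<Longrightarrow> \<delta> t = - \<beta> * integral {0..t} \<delta>" and "0 \<le> t"
  shows "\<delta> t = 0"
proof -
  have cont: "continuous_on {0..t} \<delta>"
    unfolding continuous_on_cong[OF refl eq[unfolded atLeastAtMost_iff], of "{0..t}" "\<lambda>_. _", simplified]
    using indefinite_integral_continuous_1[OF int[OF \<open>0 \<le> t\<close>]]
    by (subst continuous_on_cong[OF refl eq]) (auto intro!: continuous_intros)
  define D where "D u = exp (\<beta> * u) * integral {0..u} \<delta>" for u
  have der: "(D has_real_derivative 0) (at u within {0..t})" if u: "u \<in> {0..t}" for u
  proof -
    have "((\<lambda>u. integral {0..u} \<delta>) has_real_derivative \<delta> u) (at u within {0..t})"
      using integral_has_real_derivative[OF cont u] .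
    then have "(D has_real_derivative (exp (\<beta> * u) * \<beta> * integral {0..u} \<delta> + exp (\<beta> * u) * \<delta> u)) (at u within {0..t})"
      unfolding D_def[abs_def] by (auto intro!: derivative_eq_intros)
    then show ?thesis using eq[of u] u by simp
  qed
  have "\<exists>c. \<forall>x\<in>{0..t}. D x = c"
    by (rule has_field_derivative_zero_constant) (use der in auto)
  then have "D t = D 0" using \<open>0 \<le> t\<close> by auto
  then have "integral {0..t} \<delta> = 0" by (simp add: D_def)
  then show ?thesis using eq[OF \<open>0 \<le> t\<close>] by simp
qed

text \<open>The difference between \<open>l\<close> and the shot noise satisfies a homogeneous linear integral equation. The left limits can be
  dropped because the jumps are counted strictly before \<open>t\<close>, which makes \<open>l\<close> left-continuous.\<close>

lemma shot_noise_unique: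
  fixes c s :: "nat \<Rightarrow> real" and l :: "real \<Rightarrow> real"
  assumes \<beta>: "0 < \<beta>" and fin: "\<And>t. finite {i. s i < t}" and pos: "\<And>i. 0 < s i"
    and int: "\<forall>t\<ge>0. set_integrable lborel {0..t} (left_lim l)"
    and l: "\<forall>t\<ge>0. l t = l0 + \<beta> * (\<integral>u\<in>{0..t}. (l0 - left_lim l u) \<partial>lborel) + (\<Sum>i | s i < t. c i)"
  shows "\<forall>t\<ge>0. l t = l0 + (\<Sum>i | s i < t. c i * exp (- \<beta> * (t - s i)))"
    and "\<forall>t>0. left_lim l t = l t"
proof -
  have int': "set_integrable lborel {0..t} (\<lambda>u. l0 - left_lim l u)" if "0 \<le> t" for t
    using int that by (intro set_integral_diff) (auto intro!: borel_integrable_atLeastAtMost')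
  have HK: "(\<lambda>u. l0 - left_lim l u) integrable_on {0..t}"
    "(\<integral>u\<in>{0..t}. (l0 - left_lim l u) \<partial>lborel) = integral {0..t} (\<lambda>u. l0 - left_lim l u)"
    if "0 \<le> t" for t
    using set_borel_integral_eq_integral[OF int'[OF that]] by auto
  show left: "\<forall>t>0. left_lim l t = l t"
  proof (intro allI impI)
    fix t :: real assume t: "0 < t"
    have "((\<lambda>x. integral {0..x} (\<lambda>u. l0 - left_lim l u)) \<longlongrightarrow>
        integral {0..t} (\<lambda>u. l0 - left_lim l u)) (at t within {0..t})"
      using indefinite_integral_continuous_1[OF HK(1)[of t]] t by (auto simp: continuous_on_def)
    then have I: "((\<lambda>x. integral {0..x} (\<lambda>u. l0 - left_lim l u)) \<longlongrightarrow>
        integral {0..t} (\<lambda>u. l0 - left_lim l u)) (at_left t)"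
      using at_within_Icc_at_left[OF t] by simp
    define m where "m = Max (insert 0 (s ` {i. s i < t}))"
    have m: "m < t" unfolding m_def using fin[of t] t by (subst Max_less_iff) auto
    have le: "s i \<le> m" if "s i < t" for i
      unfolding m_def using fin[of t] that by (intro Max_ge) auto
    have ev: "\<forall>\<^sub>F x in at_left t. x \<in> {max m 0<..<t}"
      using m t by (intro eventually_at_left_real) auto
    have "((\<lambda>x. l0 + \<beta> * integral {0..x} (\<lambda>u. l0 - left_lim l u) + (\<Sum>i | s i < t. c i)) \<longlongrightarrow>
        l0 + \<beta> * integral {0..t} (\<lambda>u. l0 - left_lim l u) + (\<Sum>i | s i < t. c i)) (at_left t)"
      by (intro tendsto_intros I)
    then have "(l \<longlongrightarrow> l0 + \<beta> * integral {0..t} (\<lambda>u. l0 - left_lim l u) + (\<Sum>i | s i < t. c i)) (at_left t)"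
    proof (rule Lim_transform_eventually)
      show "\<forall>\<^sub>F x in at_left t. l0 + \<beta> * integral {0..x} (\<lambda>u. l0 - left_lim l u) + (\<Sum>i | s i < t. c i) = l x"
        using ev
      proof eventually_elim
        case (elim x)
        have "{i. s i < x} = {i. s i < t}" using elim le by (auto intro: le_less_trans)
        then show ?case using l elim HK(2)[of x] by simp
      qed
    qed
    moreover have "l t = l0 + \<beta> * integral {0..t} (\<lambda>u. l0 - left_lim l u) + (\<Sum>i | s i < t. c i)"
      using l t HK(2)[of t] by simp
    ultimately show "left_lim l t = l t"
      unfolding left_lim_def by (intro tendsto_Lim) (auto simp: trivial_limit_at_left_real)
  qed
  define e where "e t = (\<Sum>i | s i < t. c i * exp (- \<beta> * (t - s i)))" for t
  define \<delta> where "\<delta> t = l t - l0 - e t" for t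
  have e_int: "(e has_integral (\<Sum>i | s i < t. c i * (1 - exp (- \<beta> * (t - s i))) / \<beta>)) {0..t}" if "0 \<le> t" for t
    unfolding e_def[abs_def] by (rule shot_noise_has_integral) (use \<beta> fin pos that in auto)
  have l_int: "((\<lambda>u. l0 - l u) has_integral integral {0..t} (\<lambda>u. l0 - left_lim l u)) {0..t}" if "0 \<le> t" for t
    using integrable_integral[OF HK(1)[OF that]]
    by (rule has_integral_spike[where S="{0}", rotated 2]) (use left in auto)
  have d_int: "(\<delta> has_integral (- integral {0..t} (\<lambda>u. l0 - left_lim l u)
      - (\<Sum>i | s i < t. c i * (1 - exp (- \<beta> * (t - s i))) / \<beta>))) {0..t}" if "0 \<le> t" for t
    using has_integral_diff[OF has_integral_neg[OF l_int[OF that]] e_int[OF that]]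
    by (simp add: \<delta>_def[abs_def])
  have "\<delta> t = 0" if "0 \<le> t" for t
  proof (rule zero_of_linear_integral_equation[OF _ _ that])
    fix t :: real assume t: "0 \<le> t"
    show "\<delta> integrable_on {0..t}" using d_int[OF t] by blast
    have "\<beta> * (\<Sum>i | s i < t. c i * (1 - exp (- \<beta> * (t - s i))) / \<beta>)
        = (\<Sum>i | s i < t. c i) - e t"
      using \<beta> unfolding e_def sum_distrib_left sum_subtractf[symmetric]
      by (intro sum.cong) (simp_all add: field_simps)
    moreover have "\<delta> t = \<beta> * integral {0..t} (\<lambda>u. l0 - left_lim l u) + (\<Sum>i | s i < t. c i) - e t"
      using l t HK(2)[OF t] by (simp add: \<delta>_def)
    ultimately show "\<delta> t = - \<beta> * integral {0..t} \<delta>"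
      unfolding integral_unique[OF d_int[OF t]] by (simp add: algebra_simps)
  qed
  then show "\<forall>t\<ge>0. l t = l0 + (\<Sum>i | s i < t. c i * exp (- \<beta> * (t - s i)))"
    by (simp add: \<delta>_def e_def diff_eq_eq add.commute)
qed

context marked_point_process
begin

section \<open>Predictable functionals of the past\<close>

lemma Q_complete: "complete_measure Q" and subalgebra_F: "subalgebra Q (F t)"
  using usual by (auto simp: usual_conditions_def)

lemma space_F': "space (F t) = space Q" by (rule space_F)

lemma sets_F_subset: "sets (F t) \<subseteq> sets Q"
  using subalgebra_F by (auto simp: subalgebra_def)

lemma space_predictable: "space (predictable Q F) = {0..} \<times> space Q"
  and sets_predictable: "sets (predictable Q F) = sigma_sets ({0..} \<times> space Q)
     ({{0} \<times> A |A. A \<in> sets (F 0)} \<union> {{s<..t} \<times> A |s t A. 0 \<le> s \<and> s \<le> t \<and> A \<in> sets (F s)})"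
proof -
  have "{{0} \<times> A |A. A \<in> sets (F 0)} \<union> {{s<..t} \<times> A |s t A. 0 \<le> s \<and> s \<le> t \<and> A \<in> sets (F s)}
      \<subseteq> Pow ({0..} \<times> space Q)"
    using sets.sets_into_space[of _ "F _"] by (auto simp: space_F')
  then show "space (predictable Q F) = {0..} \<times> space Q"
    "sets (predictable Q F) = sigma_sets ({0..} \<times> space Q)
     ({{0} \<times> A |A. A \<in> sets (F 0)} \<union> {{s<..t} \<times> A |s t A. 0 \<le> s \<and> s \<le> t \<and> A \<in> sets (F s)})"
    unfolding predictable_def by (auto simp: space_measure_of_conv sets_measure_of)
qed

lemma predictable_after:
  assumes "0 \<le> q" "A \<in> sets (F q)" shows "{q<..} \<times> A \<in> sets (predictable Q F)"
proof -
  have "{q<..} = (\<Union>n::nat. {q<..q + real n})"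
    by (auto intro: real_arch_simple simp: ) (metis diff_le_eq add.commute real_arch_simple)
  then have "{q<..} \<times> A = (\<Union>n::nat. {q<..q + real n} \<times> A)" by auto
  also have "\<dots> \<in> sets (predictable Q F)"
  proof (rule sets.countable_nat_UN, rule subsetI)
    fix B assume "B \<in> range (\<lambda>n::nat. {q<..q + real n} \<times> A)"
    then show "B \<in> sets (predictable Q F)"
      unfolding sets_predictable using assms by (intro sigma_sets.Basic UnI2) fastforce
  qed
  finally show ?thesis .
qed

lemma predictable_time: "fst \<in> borel_measurable (predictable Q F)"
proof (rule borel_measurableI_greater)
  fix q :: real
  show "{p \<in> space (predictable Q F). q < fst p} \<in> sets (predictable Q F)"
  proof (cases "0 \<le> q")
    case True
    then have "{p \<in> space (predictable Q F). q < fst p} = {q<..} \<times> space (F q)"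
      by (auto simp: space_predictable space_F')
    then show ?thesis using predictable_after[OF True sets.top] by simp
  next
    case False
    then have "{p \<in> space (predictable Q F). q < fst p} = space (predictable Q F)"
      by (auto simp: space_predictable)
    then show ?thesis by simp
  qed
qed

text \<open>The guard \<open>0 < fst p\<close> matters only for scenarios of probability zero, in which event times may be negative: without it,
  the set would have a part at time \<open>0\<close>.\<close>

definition past :: "nat \<Rightarrow> real \<times> 'w \<Rightarrow> bool" where
  "past i p \<longleftrightarrow> 0 < fst p \<and> \<tau> i (snd p) < fst p"

text \<open>A rational time between the event and the present shows that the set is a countable union of predictable
  rectangles.\<close>

lemma predictable_past_set:
  assumes A: "A \<in> sets (pre_sigma (\<tau> i))"
  shows "{p \<in> space (predictable Q F). past i p \<and> snd p \<in> A} \<in> sets (predictable Q F)"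
proof -
  have AQ: "A \<subseteq> space Q" using sets.sets_into_space[OF A] by (simp add: space_pre_sigma)
  have "{p \<in> space (predictable Q F). past i p \<and> snd p \<in> A}
      = (\<Union>q\<in>\<rat> \<inter> {0..}. {q<..} \<times> {\<omega> \<in> A. \<tau> i \<omega> \<le> q})" (is "?L = ?R")
  proof (intro set_eqI iffI)
    fix p assume "p \<in> ?L"
    then have *: "0 < fst p" "\<tau> i (snd p) < fst p" "snd p \<in> A" by (auto simp: past_def)
    then obtain q where "q \<in> \<rat>" "max 0 (\<tau> i (snd p)) < q" "q < fst p"
      using Rats_dense_in_real[of "max 0 (\<tau> i (snd p))" "fst p"] by auto
    then show "p \<in> ?R" using * by (cases p) force
  next
    fix p assume "p \<in> ?R"
    then show "p \<in> ?L" using AQ by (auto simp: past_def space_predictable)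
  qed
  also have "\<dots> \<in> sets (predictable Q F)"
    using countable_rat by (intro sets.countable_UN'' predictable_after sets_pre_sigmaD[OF times_stopping A]) auto
  finally show ?thesis .
qed

lemma pred_past [measurable]: "Measurable.pred (predictable Q F) (past i)"
proof -
  have "{p \<in> space (predictable Q F). past i p}
      = {p \<in> space (predictable Q F). past i p \<and> snd p \<in> space (pre_sigma (\<tau> i))}"
    by (auto simp: space_predictable space_pre_sigma)
  then show ?thesis unfolding pred_def using predictable_past_set[OF sets.top, of i] by simp
qed

lemma predictable_past_value:
  fixes y :: "'w \<Rightarrow> real"
  assumes y: "y \<in> borel_measurable (pre_sigma (\<tau> i))"
  shows "(\<lambda>p. if past i p then y (snd p) else 0) \<in> borel_measurable (predictable Q F)"
proof (rule measurableI)
  fix B :: "real set" assume B: "B \<in> sets borel"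
  have "{p \<in> space (predictable Q F). past i p \<and> snd p \<in> y -` B \<inter> space (pre_sigma (\<tau> i))}
      \<union> (if 0 \<in> B then {p \<in> space (predictable Q F). \<not> past i p} else {}) \<in> sets (predictable Q F)"
    using predictable_past_set[OF measurable_sets[OF y B]] by simp
  also have "{p \<in> space (predictable Q F). past i p \<and> snd p \<in> y -` B \<inter> space (pre_sigma (\<tau> i))}
      \<union> (if 0 \<in> B then {p \<in> space (predictable Q F). \<not> past i p} else {})
      = (\<lambda>p. if past i p then y (snd p) else 0) -` B \<inter> space (predictable Q F)"
    by (auto simp: space_predictable space_pre_sigma split: if_splits)
  finally show "(\<lambda>p. if past i p then y (snd p) else 0) -` B \<inter> space (predictable Q F) \<in> sets (predictable Q F)" .
qed simp

text \<open>The time and mark of an event once it has occurred are the coordinates in which every functional of the past is written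
  to prove it predictable.\<close>

definition past_time :: "nat \<Rightarrow> real \<times> 'w \<Rightarrow> real" where
  "past_time i p = (if past i p then \<tau> i (snd p) else 0)"

definition past_mark :: "nat \<Rightarrow> real \<times> 'w \<Rightarrow> real" where
  "past_mark i p = (if past i p then Z i (snd p) else 0)"

lemma predictable_past_time [measurable]: "past_time i \<in> borel_measurable (predictable Q F)"
  unfolding past_time_def[abs_def]
  by (intro predictable_past_value measurable_stopping_time_pre_sigma times_stopping)

lemma mark_measurable_pre: "Z i \<in> borel_measurable (pre_sigma (\<tau> i))"
proof -
  have "(\<lambda>x. x) \<in> borel_nonneg \<rightarrow>\<^sub>M borel" by (intro measurable_restrict_space1) simp
  from measurable_comp[OF marks_measurable this] show ?thesis by (simp add: comp_def)
qed

lemma predictable_past_mark [measurable]: "past_mark i \<in> borel_measurable (predictable Q F)"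
  unfolding past_mark_def[abs_def] by (intro predictable_past_value mark_measurable_pre)

lemma measurable_pre_sigma_Q:
  assumes f: "f \<in> pre_sigma (\<tau> i) \<rightarrow>\<^sub>M N" shows "f \<in> Q \<rightarrow>\<^sub>M N"
proof -
  have "sets (pre_sigma (\<tau> i)) \<subseteq> sets Q"
  proof
    fix A assume A: "A \<in> sets (pre_sigma (\<tau> i))"
    have "A = (\<Union>n::nat. {\<omega> \<in> A. \<tau> i \<omega> \<le> real n})" using real_arch_simple by auto
    also have "\<dots> \<in> sets Q"
      using sets_pre_sigmaD[OF times_stopping A] sets_F_subset by (intro sets.countable_nat_UN) auto
    finally show "A \<in> sets Q" .
  qed
  then show ?thesis
    using measurable_mono[OF order_refl refl, of "pre_sigma (\<tau> i)" Q N] f by (auto simp: space_pre_sigma)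
qed

lemma time_measurable [measurable]: "\<tau> i \<in> borel_measurable Q"
  by (rule measurable_pre_sigma_Q[OF measurable_stopping_time_pre_sigma[OF times_stopping]])

lemma mark_measurable [measurable]: "Z i \<in> borel_measurable Q"
  by (rule measurable_pre_sigma_Q[OF mark_measurable_pre])

lemma mark_nonneg: "\<omega> \<in> space Q \<Longrightarrow> 0 \<le> Z i \<omega>"
  using measurable_space[OF marks_measurable, of \<omega> i] by (simp add: space_pre_sigma space_restrict_space)

definition proper :: "'w \<Rightarrow> bool" where
  "proper \<omega> \<longleftrightarrow> \<omega> \<in> space Q \<and> 0 < \<tau> 0 \<omega> \<and> (\<forall>i. \<tau> i \<omega> < \<tau> (Suc i) \<omega>)
     \<and> filterlim (\<lambda>i. \<tau> i \<omega>) at_top sequentially"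

lemma AE_proper: "AE \<omega> in Q. proper \<omega>"
  using times_increasing times_unbounded by (auto simp: proper_def)

lemma proper_less_iff: "proper \<omega> \<Longrightarrow> \<tau> i \<omega> < \<tau> j \<omega> \<longleftrightarrow> i < j"
  unfolding proper_def by (intro strict_mono_less) (auto simp: strict_mono_Suc_iff)

lemma proper_pos: "proper \<omega> \<Longrightarrow> 0 < \<tau> i \<omega>"
  using proper_less_iff[of \<omega> 0 i] by (cases i) (auto simp: proper_def)

lemma proper_finite: "proper \<omega> \<Longrightarrow> finite {i. \<tau> i \<omega> < t}" "proper \<omega> \<Longrightarrow> finite {i. \<tau> i \<omega> \<le> t}"
proof -
  assume "proper \<omega>"
  then have "\<forall>\<^sub>F i in sequentially. t < \<tau> i \<omega>" by (auto simp: proper_def filterlim_at_top_dense)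
  then obtain N where N: "\<And>i. i \<ge> N \<Longrightarrow> t < \<tau> i \<omega>" by (auto simp: eventually_sequentially)
  have "{i. \<tau> i \<omega> \<le> t} \<subseteq> {..<N}" using N by (force simp: not_le[symmetric])
  then show f: "finite {i. \<tau> i \<omega> \<le> t}" by (rule finite_subset) simp
  show "finite {i. \<tau> i \<omega> < t}" by (rule finite_subset[OF _ f]) auto
qed

lemma event_measurable:
  "\<omega> \<in> space Q \<Longrightarrow> (\<lambda>i. (\<tau> i \<omega>, Z i \<omega>)) \<in> count_space UNIV \<rightarrow>\<^sub>M borel \<Otimes>\<^sub>M borel_nonneg"
  by (auto simp: space_pair_measure space_restrict_space mark_nonneg)

lemma counting_integral:
  fixes f :: "real \<Rightarrow> real"
  assumes \<omega>: "proper \<omega>" and f: "f \<in> borel_measurable borel_nonneg"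
    and S: "S \<in> sets borel" "finite {i. \<tau> i \<omega> \<in> S}"
  shows "(\<integral>p\<in>S \<times> {0..}. f (snd p) \<partial>counting_measure \<tau> Z \<omega>) = (\<Sum>i | \<tau> i \<omega> \<in> S. f (Z i \<omega>))"
proof -
  have \<omega>': "\<omega> \<in> space Q" using \<omega> by (simp add: proper_def)
  have "(\<lambda>p. indicator (S \<times> {0..}) p *\<^sub>R f (snd p)) \<in> borel_measurable (borel \<Otimes>\<^sub>M borel_nonneg)"
  proof -
    have "(\<lambda>p. indicator S (fst p) * f (snd p)) \<in> borel_measurable (borel \<Otimes>\<^sub>M borel_nonneg)"
      using S(1) f by measurable
    moreover have "indicator S (fst p) * f (snd p) = indicator (S \<times> {0..}) p *\<^sub>R f (snd p)"
      if "p \<in> space (borel \<Otimes>\<^sub>M borel_nonneg)" for p :: "real \<times> real"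
      using that by (auto simp: space_pair_measure space_restrict_space indicator_def mem_Times_iff)
    ultimately show ?thesis by (subst measurable_cong) (auto simp del: real_scaleR_def)
  qed
  then have "(\<integral>p\<in>S \<times> {0..}. f (snd p) \<partial>counting_measure \<tau> Z \<omega>)
      = (\<integral>i. indicator (S \<times> {0..}) (\<tau> i \<omega>, Z i \<omega>) *\<^sub>R f (Z i \<omega>) \<partial>count_space UNIV)"
    unfolding set_lebesgue_integral_def counting_measure_def
    by (subst integral_distr[OF event_measurable[OF \<omega>']]) auto
  also have "\<dots> = (\<integral>i. (if \<tau> i \<omega> \<in> S then f (Z i \<omega>) else 0) \<partial>count_space UNIV)"
    using mark_nonneg[OF \<omega>'] by (intro Bochner_Integration.integral_cong) (auto simp: indicator_def)
  also have "\<dots> = (\<Sum>i | \<tau> i \<omega> \<in> S. f (Z i \<omega>))"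
  proof (subst lebesgue_integral_count_space_finite_support)
    show "finite {i \<in> UNIV. (if \<tau> i \<omega> \<in> S then f (Z i \<omega>) else 0) \<noteq> 0}"
      by (rule finite_subset[OF _ S(2)]) auto
    show "(\<Sum>i | i \<in> UNIV \<and> (if \<tau> i \<omega> \<in> S then f (Z i \<omega>) else 0) \<noteq> 0. if \<tau> i \<omega> \<in> S then f (Z i \<omega>) else 0)
        = (\<Sum>i | \<tau> i \<omega> \<in> S. f (Z i \<omega>))"
      using S(2) by (intro sum.mono_neutral_cong_left) auto
  qed
  finally show ?thesis .
qed

end

section \<open>The intensity and the compensator\<close>

lemma ennreal_suminf_swap: "(\<Sum>i. \<Sum>j. f i j) = (\<Sum>j. \<Sum>i. f i j :: ennreal)"
proof -
  have "(\<Sum>i. \<Sum>j. f i j) = (\<integral>\<^sup>+j. (\<Sum>i. f i j) \<partial>count_space UNIV)"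
    by (subst nn_integral_suminf) (auto simp: nn_integral_count_space_nat)
  then show ?thesis by (simp add: nn_integral_count_space_nat)
qed

lemma ennreal_suminf_add: "(\<Sum>i. f i + g i) = (\<Sum>i. f i) + (\<Sum>i. g i :: ennreal)"
  by (rule suminf_add[symmetric]) auto

locale linear_hawkes = law: loss_distribution \<Theta> +
  marked_hawkes Q F \<tau> Z \<Theta> "\<lambda>z. \<Lambda> * z" \<beta> lam0 lam0 lam
  for \<Theta> :: "real measure" and Q :: "'w measure" and F :: "real \<Rightarrow> 'w measure"
    and \<tau> Z :: "nat \<Rightarrow> 'w \<Rightarrow> real" and \<Lambda> \<beta> lam0 :: real and lam :: "real \<Rightarrow> 'w \<Rightarrow> real" +
  assumes excitation_pos: "0 < \<Lambda>" and baseline_pos: "0 < lam0"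
    and subcritical: "\<Lambda> * (\<integral>z. z \<partial>\<Theta>) < \<beta>"
begin

lemma decay_pos: "0 < \<beta>"
  using subcritical law.mean_pos excitation_pos by (meson less_trans mult_pos_pos)

lemma sets_borel_loss [measurable_cong]: "sets \<Theta> = sets borel_nonneg"
  by (rule law.sets_loss)

text \<open>The solution of the intensity equation as an extended nonnegative function. It is defined in every scenario, so it is jointly
  measurable without reference to the exceptional null set of \<open>lam\<close>.\<close>

definition intens :: "'w \<Rightarrow> real \<Rightarrow> ennreal" where
  "intens \<omega> t = ennreal lam0 +
     (\<Sum>i. if past i (t, \<omega>) then ennreal (\<Lambda> * Z i \<omega> * exp (- \<beta> * (t - \<tau> i \<omega>))) else 0)"

lemma intensity_explicit:
  "AE \<omega> in Q. proper \<omega> \<and> (\<forall>t\<ge>0. 0 \<le> lam t \<omega> \<and> ennreal (lam t \<omega>) = intens \<omega> t)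
     \<and> (\<forall>t>0. left_lim (\<lambda>u. lam u \<omega>) t = lam t \<omega>)"
  using AE_proper intensity_integrable intensity_eq
proof eventually_elim
  case (elim \<omega>)
  have \<omega>: "\<omega> \<in> space Q" using elim(1) by (simp add: proper_def)
  have "(\<integral>p\<in>{0<..<t} \<times> {0..}. \<Lambda> * snd p \<partial>counting_measure \<tau> Z \<omega>) = (\<Sum>i | \<tau> i \<omega> < t. \<Lambda> * Z i \<omega>)" for t
  proof -
    have "(\<lambda>z. \<Lambda> * z) \<in> borel_measurable borel_nonneg" by (intro measurable_restrict_space1) simp
    moreover have "{i. \<tau> i \<omega> \<in> {0<..<t}} = {i. \<tau> i \<omega> < t}" using proper_pos[OF elim(1)] by auto
    ultimately show ?thesis
      using counting_integral[OF elim(1), of "\<lambda>z. \<Lambda> * z" "{0<..<t}"] proper_finite[OF elim(1)] by simp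
  qed
  then have eq: "\<forall>t\<ge>0. lam t \<omega> = lam0
      + \<beta> * (\<integral>u\<in>{0..t}. (lam0 - left_lim (\<lambda>u. lam u \<omega>) u) \<partial>lborel) + (\<Sum>i | \<tau> i \<omega> < t. \<Lambda> * Z i \<omega>)"
    using elim(3) by simp
  note sol = shot_noise_unique[OF decay_pos proper_finite(1)[OF elim(1)] proper_pos[OF elim(1)] elim(2) eq]
  have "0 \<le> lam t \<omega> \<and> ennreal (lam t \<omega>) = intens \<omega> t" if t: "0 \<le> t" for t
  proof -
    let ?c = "\<lambda>i. \<Lambda> * Z i \<omega> * exp (- \<beta> * (t - \<tau> i \<omega>))"
    have c: "0 \<le> ?c i" for i using mark_nonneg[OF \<omega>] excitation_pos by simp
    have p: "past i (t, \<omega>) \<longleftrightarrow> \<tau> i \<omega> < t" for i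
      using proper_pos[OF elim(1), of i] by (auto simp: past_def)
    have "intens \<omega> t = ennreal lam0 + (\<Sum>i | \<tau> i \<omega> < t. ennreal (?c i))"
      unfolding intens_def p
      by (subst suminf_finite[OF proper_finite(1)[OF elim(1), of t]]) (auto intro!: sum.cong)
    also have "\<dots> = ennreal (lam0 + (\<Sum>i | \<tau> i \<omega> < t. ?c i))"
      using baseline_pos c by (simp add: sum_ennreal sum_nonneg)
    finally show ?thesis using sol(1) t c baseline_pos by (auto intro!: add_nonneg_nonneg sum_nonneg)
  qed
  then show ?case using sol(2) elim(1) by blast
qed

lemma predictable_section: "\<omega> \<in> space Q \<Longrightarrow> (\<lambda>t. (max 0 t, \<omega>)) \<in> borel \<rightarrow>\<^sub>M predictable Q F"
proof (rule measurable_sigma_sets[OF sets_predictable])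
  assume \<omega>: "\<omega> \<in> space Q"
  show "{{0} \<times> A |A. A \<in> sets (F 0)} \<union> {{s<..t} \<times> A |s t A. 0 \<le> s \<and> s \<le> t \<and> A \<in> sets (F s)}
      \<subseteq> Pow ({0..} \<times> space Q)"
    using sets.sets_into_space[of _ "F _"] by (auto simp: space_F')
  show "(\<lambda>t::real. (max 0 t, \<omega>)) \<in> space borel \<rightarrow> {0..} \<times> space Q" using \<omega> by auto
  fix y assume "y \<in> {{0} \<times> A |A. A \<in> sets (F 0)} \<union> {{s<..t} \<times> A |s t A. 0 \<le> s \<and> s \<le> t \<and> A \<in> sets (F s)}"
  then obtain I A where y: "y = I \<times> A" "I \<in> sets borel" by auto
  have "(\<lambda>t. (max 0 t, \<omega>)) -` y = (if \<omega> \<in> A then (\<lambda>t. max 0 t) -` I else {})" using y by auto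
  moreover have "(\<lambda>t::real. max 0 t) -` I \<in> sets borel"
    using measurable_sets[of "\<lambda>t::real. max 0 t" borel borel I] y by simp
  ultimately show "(\<lambda>t. (max 0 t, \<omega>)) -` y \<inter> space borel \<in> sets borel" by simp
qed

text \<open>Events carry strictly positive times almost surely and Lebesgue measure does not charge time \<open>0\<close>, so the
  compensator identity can be stated over strictly positive times. Multiplying \<open>W\<close> by the indicator of nonnegative
  times makes its sections measurable on the whole line, which is needed for integration against the
  counting measure.\<close>

lemma compensator_explicit:
  assumes W: "W \<in> borel_measurable (predictable Q F \<Otimes>\<^sub>M borel_nonneg)"
  shows "(\<integral>\<^sup>+\<omega>. (\<Sum>i. W ((\<tau> i \<omega>, \<omega>), Z i \<omega>)) \<partial>Q) =
    (\<integral>\<^sup>+\<omega>. (\<integral>\<^sup>+t. (if 0 < t then intens \<omega> t * (\<integral>\<^sup>+z. W ((t, \<omega>), z) \<partial>\<Theta>) else 0) \<partial>lborel) \<partial>Q)"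
proof -
  define V where "V p = indicator {0..} (fst (fst p)) * W p" for p
  have "V p = W p" if "p \<in> space (predictable Q F \<Otimes>\<^sub>M borel_nonneg)" for p
    using that by (auto simp: V_def space_pair_measure space_predictable)
  then have V: "V \<in> borel_measurable (predictable Q F \<Otimes>\<^sub>M borel_nonneg)"
    using W by (subst measurable_cong) auto
  have sect: "(\<lambda>(t, z). V ((t, \<omega>), z)) \<in> borel_measurable (borel \<Otimes>\<^sub>M borel_nonneg)"
    if "\<omega> \<in> space Q" for \<omega>
  proof -
    note [measurable] = predictable_section[OF that] W
    have "(\<lambda>p. indicator {0..} (fst p) * W ((max 0 (fst p), \<omega>), snd p)) \<in> borel_measurable (borel \<Otimes>\<^sub>M borel_nonneg)"
      by measurable
    moreover have "(\<lambda>(t, z). V ((t, \<omega>), z)) = (\<lambda>p. indicator {0..} (fst p) * W ((max 0 (fst p), \<omega>), snd p))"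
      by (auto simp: V_def fun_eq_iff indicator_def)
    ultimately show ?thesis by simp
  qed
  have "(\<integral>\<^sup>+\<omega>. (\<Sum>i. W ((\<tau> i \<omega>, \<omega>), Z i \<omega>)) \<partial>Q) =
      (\<integral>\<^sup>+\<omega>. (\<integral>\<^sup>+(t, z). V ((t, \<omega>), z) \<partial>counting_measure \<tau> Z \<omega>) \<partial>Q)"
  proof (rule nn_integral_cong_AE, use AE_proper in eventually_elim)
    case (elim \<omega>)
    then have \<omega>: "\<omega> \<in> space Q" by (simp add: proper_def)
    have "(\<integral>\<^sup>+(t, z). V ((t, \<omega>), z) \<partial>counting_measure \<tau> Z \<omega>) = (\<Sum>i. V ((\<tau> i \<omega>, \<omega>), Z i \<omega>))"
      unfolding counting_measure_def
      using sect[OF \<omega>]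
      by (subst nn_integral_distr[OF event_measurable[OF \<omega>]]) (simp_all add: nn_integral_count_space_nat)
    then show ?case using proper_pos[OF elim] by (simp add: V_def less_imp_le)
  qed
  also have "\<dots> = (\<integral>\<^sup>+\<omega>. (\<integral>\<^sup>+t\<in>{0..}. (\<integral>\<^sup>+z. V ((t, \<omega>), z) * ennreal (left_lim (\<lambda>u. lam u \<omega>) t) \<partial>\<Theta>) \<partial>lborel) \<partial>Q)"
    using compensator V unfolding has_compensator_def by blast
  also have "\<dots> = (\<integral>\<^sup>+\<omega>. (\<integral>\<^sup>+t. (if 0 < t then intens \<omega> t * (\<integral>\<^sup>+z. W ((t, \<omega>), z) \<partial>\<Theta>) else 0) \<partial>lborel) \<partial>Q)"
  proof (rule nn_integral_cong_AE, use intensity_explicit in eventually_elim)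
    case (elim \<omega>)
    then have \<omega>: "\<omega> \<in> space Q" by (simp add: proper_def)
    have "AE t in lborel. t \<noteq> (0::real)" by (rule AE_lborel_singleton)
    then show ?case
    proof (intro nn_integral_cong_AE, eventually_elim)
      case (elim t)
      show ?case
      proof (cases "0 < t")
        case True
        have "(\<lambda>z. case (t, z) of (t, z) \<Rightarrow> V ((t, \<omega>), z)) \<in> borel_measurable borel_nonneg"
          using measurable_Pair2[OF sect[OF \<omega>], of t] by simp
        then have [measurable]: "(\<lambda>z. V ((t, \<omega>), z)) \<in> borel_measurable \<Theta>"
          unfolding law.measurable_loss by simp
        have "(\<integral>\<^sup>+z. V ((t, \<omega>), z) * ennreal (left_lim (\<lambda>u. lam u \<omega>) t) \<partial>\<Theta>)
            = (\<integral>\<^sup>+z. V ((t, \<omega>), z) \<partial>\<Theta>) * intens \<omega> t"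
          using \<open>proper \<omega> \<and> _\<close> True by (simp add: nn_integral_multc)
        then show ?thesis using True by (simp add: V_def mult.commute)
      next
        case False
        then show ?thesis using elim by (simp add: indicator_def)
      qed
    qed
  qed
  finally show ?thesis .
qed

lemma past_measurable_Q [measurable]: "Measurable.pred (borel \<Otimes>\<^sub>M Q) (past i)"
  unfolding past_def[abs_def] by measurable

lemma intens_measurable: "(\<lambda>p. intens (snd p) (fst p)) \<in> borel_measurable (borel \<Otimes>\<^sub>M Q)"
  unfolding intens_def[abs_def] past_def by measurable

section \<open>The isometry for compensated sums\<close>

lemma mark_to_real [measurable]: "(\<lambda>x. x) \<in> borel_nonneg \<rightarrow>\<^sub>M borel" "(\<lambda>x. x) \<in> \<Theta> \<rightarrow>\<^sub>M borel"
  by (auto intro: measurable_restrict_space1 law.borel_measurable_loss)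

context
  fixes h :: "real \<Rightarrow> real \<Rightarrow> ennreal" and J :: "nat set"
begin

text \<open>The weights \<open>h\<close> are stopped at the first of the events with index in \<open>J\<close>, that event still being counted. The set \<open>J\<close> is empty for the
  process itself and a singleton for localisation. The event times enter only through \<open>past\<close>, so that the stopped
  weights are predictable.\<close>

definition active :: "real \<times> 'w \<Rightarrow> bool" where
  "active p \<longleftrightarrow> (\<forall>n\<in>J. \<not> past n p)"

definition atom :: "'w \<Rightarrow> nat \<Rightarrow> ennreal" where
  "atom \<omega> i = (if active (\<tau> i \<omega>, \<omega>) then h (\<tau> i \<omega>) (Z i \<omega>) else 0)"

definition drift :: "'w \<Rightarrow> real \<Rightarrow> ennreal" where
  "drift \<omega> t = (if 0 < t \<and> active (t, \<omega>) then intens \<omega> t * (\<integral>\<^sup>+z. h t z \<partial>\<Theta>) else 0)"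

definition atoms_before :: "real \<times> 'w \<Rightarrow> ennreal" where
  "atoms_before p = (\<Sum>i. if past i p then atom (snd p) i else 0)"

definition drift_before :: "real \<times> 'w \<Rightarrow> ennreal" where
  "drift_before p = (\<integral>\<^sup>+s. (if s < fst p then drift (snd p) s else 0) \<partial>lborel)"

definition atom_total :: "'w \<Rightarrow> ennreal" where
  "atom_total \<omega> = (\<Sum>i. atom \<omega> i)"

definition drift_total :: "'w \<Rightarrow> ennreal" where
  "drift_total \<omega> = (\<integral>\<^sup>+t. drift \<omega> t \<partial>lborel)"

definition quadratic_total :: "'w \<Rightarrow> ennreal" where
  "quadratic_total \<omega> = (\<Sum>i. (atom \<omega> i)\<^sup>2)"

context
  assumes h: "(\<lambda>p. h (fst p) (snd p)) \<in> borel_measurable (borel \<Otimes>\<^sub>M borel)"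
begin

lemma h_compose:
  assumes [measurable]: "f \<in> borel_measurable M" "g \<in> borel_measurable M"
  shows "(\<lambda>x. h (f x) (g x)) \<in> borel_measurable M"
  using measurable_compose[of "\<lambda>x. (f x, g x)" M "borel \<Otimes>\<^sub>M borel", OF _ h] by simp

lemma mark_mean_measurable: "(\<lambda>t. \<integral>\<^sup>+z. h t z \<partial>\<Theta>) \<in> borel_measurable borel"
proof -
  have "(\<lambda>(t, z). h t z) \<in> borel_measurable (borel \<Otimes>\<^sub>M \<Theta>)"
    unfolding case_prod_beta by (rule h_compose) measurable
  then show ?thesis by (rule law.borel_measurable_nn_integral)
qed

lemma active_measurable [measurable]:
  "Measurable.pred (predictable Q F) active" "Measurable.pred (borel \<Otimes>\<^sub>M Q) active"
  unfolding active_def[abs_def] by measurable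

lemma atom_measurable [measurable]: "(\<lambda>\<omega>. atom \<omega> i) \<in> borel_measurable Q"
proof -
  have [measurable]: "(\<lambda>\<omega>. h (\<tau> i \<omega>) (Z i \<omega>)) \<in> borel_measurable Q" by (rule h_compose) measurable
  show ?thesis unfolding atom_def[abs_def] by measurable
qed

lemma drift_measurable [measurable]: "(\<lambda>p. drift (snd p) (fst p)) \<in> borel_measurable (borel \<Otimes>\<^sub>M Q)"
proof -
  note [measurable] = intens_measurable mark_mean_measurable
  show ?thesis unfolding drift_def[abs_def] by (simp, measurable)
qed

lemma drift_measurable_time [measurable]: "\<omega> \<in> space Q \<Longrightarrow> drift \<omega> \<in> borel_measurable borel"
  using measurable_compose[OF _ drift_measurable, of "\<lambda>t. (t, \<omega>)" borel] by simp

lemma atoms_before_measurable [measurable]: "atoms_before \<in> borel_measurable (borel \<Otimes>\<^sub>M Q)"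
  unfolding atoms_before_def[abs_def] by measurable

lemma drift_before_measurable [measurable]: "drift_before \<in> borel_measurable (borel \<Otimes>\<^sub>M Q)"
proof -
  have [measurable]: "(\<lambda>q. drift (snd (fst q)) (snd q)) \<in> borel_measurable ((borel \<Otimes>\<^sub>M Q) \<Otimes>\<^sub>M lborel)"
    using measurable_compose[OF _ drift_measurable, of "\<lambda>q. (snd q, snd (fst q))" "(borel \<Otimes>\<^sub>M Q) \<Otimes>\<^sub>M lborel"]
    by simp
  have "(\<lambda>(p, s). if s < fst p then drift (snd p) s else 0) \<in> borel_measurable ((borel \<Otimes>\<^sub>M Q) \<Otimes>\<^sub>M lborel)"
    unfolding case_prod_beta by measurable
  then show ?thesis unfolding drift_before_def[abs_def] by (rule lborel.borel_measurable_nn_integral)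
qed

lemma atoms_before_predictable [measurable]: "atoms_before \<in> borel_measurable (predictable Q F)"
proof -
  let ?g = "\<lambda>p. \<Sum>i. if past i p \<and> (\<forall>n\<in>J. past n p \<longrightarrow> 0 < past_time i p \<longrightarrow> past_time i p \<le> past_time n p)
      then h (past_time i p) (past_mark i p) else 0"
  have [measurable]: "(\<lambda>p. h (past_time i p) (past_mark i p)) \<in> borel_measurable (predictable Q F)" for i
    by (rule h_compose) measurable
  have "?g \<in> borel_measurable (predictable Q F)" by measurable
  moreover have "atoms_before p = ?g p" for p
    unfolding atoms_before_def
  proof (intro arg_cong[where f=suminf] ext)
    fix i
    show "(if past i p then atom (snd p) i else 0) =
      (if past i p \<and> (\<forall>n\<in>J. past n p \<longrightarrow> 0 < past_time i p \<longrightarrow> past_time i p \<le> past_time n p)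
      then h (past_time i p) (past_mark i p) else 0)"
      by (auto simp: atom_def active_def past_time_def past_mark_def past_def not_less)
  qed
  ultimately show ?thesis by presburger
qed

text \<open>For \<open>s\<close> before the present, the intensity at \<open>s\<close> depends only on events that have already occurred, and so it is a function of \<open>s\<close> and the
  past coordinates at the present.\<close>

lemma drift_before_predictable [measurable]: "drift_before \<in> borel_measurable (predictable Q F)"
proof -
  let ?I = "\<lambda>p s. ennreal lam0 + (\<Sum>i. if past i p \<and> past_time i p < s
      then ennreal (\<Lambda> * past_mark i p * exp (- \<beta> * (s - past_time i p))) else 0)"
  let ?g = "\<lambda>p s. if 0 < s \<and> s < fst p \<and> (\<forall>n\<in>J. past n p \<longrightarrow> s \<le> past_time n p)
      then ?I p s * (\<integral>\<^sup>+z. h s z \<partial>\<Theta>) else 0"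
  note [measurable] = predictable_time mark_mean_measurable
  have "(\<lambda>(p, s). ?g p s) \<in> borel_measurable (predictable Q F \<Otimes>\<^sub>M lborel)"
    unfolding case_prod_beta by measurable
  then have "(\<lambda>p. \<integral>\<^sup>+s. ?g p s \<partial>lborel) \<in> borel_measurable (predictable Q F)"
    by (rule lborel.borel_measurable_nn_integral)
  moreover have "(if s < fst p then drift (snd p) s else 0) = ?g p s" for p s
  proof (cases "0 < s \<and> s < fst p")
    case True
    have i: "intens (snd p) s = ?I p s"
      unfolding intens_def
      by (rule arg_cong[where f="\<lambda>x. ennreal lam0 + suminf x"])
         (use True in \<open>auto simp: fun_eq_iff past_def past_time_def past_mark_def\<close>)
    have "active (s, snd p) \<longleftrightarrow> (\<forall>n\<in>J. past n p \<longrightarrow> s \<le> past_time n p)"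
      using True by (force simp: active_def past_def past_time_def not_less)
    then show ?thesis using True unfolding drift_def i by presburger
  qed (auto simp: drift_def)
  ultimately show ?thesis unfolding drift_before_def[abs_def] by presburger
qed

lemma atom_total_measurable [measurable]: "atom_total \<in> borel_measurable Q"
  unfolding atom_total_def[abs_def] by measurable

lemma drift_total_measurable [measurable]: "drift_total \<in> borel_measurable Q"
proof -
  have "(\<lambda>(\<omega>, t). drift \<omega> t) \<in> borel_measurable (Q \<Otimes>\<^sub>M lborel)"
    using measurable_compose[OF _ drift_measurable, of "\<lambda>q. (snd q, fst q)" "Q \<Otimes>\<^sub>M lborel"]
    by (simp add: case_prod_beta)
  then show ?thesis unfolding drift_total_def[abs_def] by (rule lborel.borel_measurable_nn_integral)
qed

text \<open>The next three identities split a product of two sums over times according to which time comes first. Only products with a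
  factor from the strict past remain, and these have predictable integrands.\<close>

lemma atom_total_square:
  assumes "proper \<omega>"
  shows "(atom_total \<omega>)\<^sup>2 = (\<Sum>i. (atom \<omega> i)\<^sup>2) + 2 * (\<Sum>i. atom \<omega> i * atoms_before (\<tau> i \<omega>, \<omega>))"
proof -
  have p: "past j (\<tau> i \<omega>, \<omega>) \<longleftrightarrow> j < i" for i j
    using proper_pos[OF assms] proper_less_iff[OF assms] by (simp add: past_def)
  let ?K = "atom \<omega>"
  have split: "?K i * ?K j = (if j = i then (?K i)\<^sup>2 else 0) + ((if j < i then ?K i * ?K j else 0)
      + (if i < j then ?K i * ?K j else 0))" for i j
    by (auto simp: power2_eq_square dest: less_trans)
  have diag: "(\<Sum>j. if j = i then (?K i)\<^sup>2 else 0) = (?K i)\<^sup>2" for i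
    by (subst suminf_finite[of "{i}"]) auto
  have before: "(\<Sum>j. if j < i then ?K i * ?K j else 0) = ?K i * atoms_before (\<tau> i \<omega>, \<omega>)" for i
    unfolding atoms_before_def p ennreal_suminf_cmult[symmetric] by (rule arg_cong[where f=suminf]) auto
  have after: "(\<Sum>i. \<Sum>j. if i < j then ?K i * ?K j else 0) = (\<Sum>j. ?K j * atoms_before (\<tau> j \<omega>, \<omega>))"
    by (subst ennreal_suminf_swap, subst before[symmetric]) (simp add: mult.commute cong: if_cong)
  have "(atom_total \<omega>)\<^sup>2 = (\<Sum>i. \<Sum>j. ?K i * ?K j)"
    by (simp add: atom_total_def power2_eq_square)
  also have "\<dots> = (\<Sum>i. (?K i)\<^sup>2) + ((\<Sum>i. ?K i * atoms_before (\<tau> i \<omega>, \<omega>))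
      + (\<Sum>i. \<Sum>j. if i < j then ?K i * ?K j else 0))"
    by (subst split) (simp only: ennreal_suminf_add diag before)
  finally show ?thesis unfolding after by (simp add: mult_2)
qed

lemma atom_drift_product:
  assumes "proper \<omega>"
  shows "atom_total \<omega> * drift_total \<omega> = (\<Sum>i. atom \<omega> i * drift_before (\<tau> i \<omega>, \<omega>))
      + (\<integral>\<^sup>+t. drift \<omega> t * atoms_before (t, \<omega>) \<partial>lborel)"
proof -
  have \<omega>: "\<omega> \<in> space Q" using assms by (simp add: proper_def)
  note [measurable] = drift_measurable_time[OF \<omega>]
  have split: "drift_total \<omega> = drift_before (\<tau> i \<omega>, \<omega>)
      + (\<integral>\<^sup>+t. (if past i (t, \<omega>) then drift \<omega> t else 0) \<partial>lborel)" for i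
  proof -
    have "drift_total \<omega> = (\<integral>\<^sup>+t. (if t < \<tau> i \<omega> then drift \<omega> t else 0)
        + (if past i (t, \<omega>) then drift \<omega> t else 0) \<partial>lborel)"
      unfolding drift_total_def
    proof (rule nn_integral_cong_AE, use AE_lborel_singleton[of "\<tau> i \<omega>"] in eventually_elim)
      case (elim t)
      then show ?case using proper_pos[OF assms, of i] by (auto simp: past_def)
    qed
    also have "\<dots> = drift_before (\<tau> i \<omega>, \<omega>) + (\<integral>\<^sup>+t. (if past i (t, \<omega>) then drift \<omega> t else 0) \<partial>lborel)"
      unfolding drift_before_def past_def by (subst nn_integral_add) (auto cong: if_cong)
    finally show ?thesis .
  qed
  have "atom_total \<omega> * drift_total \<omega> = (\<Sum>i. atom \<omega> i * drift_total \<omega>)" by (simp add: atom_total_def)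
  also have "\<dots> = (\<Sum>i. atom \<omega> i * drift_before (\<tau> i \<omega>, \<omega>)
      + (\<integral>\<^sup>+t. atom \<omega> i * (if past i (t, \<omega>) then drift \<omega> t else 0) \<partial>lborel))"
  proof (intro arg_cong[where f=suminf] ext)
    fix i
    have "(\<integral>\<^sup>+t. atom \<omega> i * (if past i (t, \<omega>) then drift \<omega> t else 0) \<partial>lborel)
        = atom \<omega> i * (\<integral>\<^sup>+t. (if past i (t, \<omega>) then drift \<omega> t else 0) \<partial>lborel)"
      by (rule nn_integral_cmult) (simp add: past_def)
    then show "atom \<omega> i * drift_total \<omega> = atom \<omega> i * drift_before (\<tau> i \<omega>, \<omega>)
      + (\<integral>\<^sup>+t. atom \<omega> i * (if past i (t, \<omega>) then drift \<omega> t else 0) \<partial>lborel)"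
      by (simp only: split[of i] distrib_left)
  qed
  also have "\<dots> = (\<Sum>i. atom \<omega> i * drift_before (\<tau> i \<omega>, \<omega>))
      + (\<integral>\<^sup>+t. (\<Sum>i. atom \<omega> i * (if past i (t, \<omega>) then drift \<omega> t else 0)) \<partial>lborel)"
    unfolding ennreal_suminf_add by (subst nn_integral_suminf) (auto simp: past_def)
  also have "(\<lambda>t. \<Sum>i. atom \<omega> i * (if past i (t, \<omega>) then drift \<omega> t else 0))
      = (\<lambda>t. drift \<omega> t * atoms_before (t, \<omega>))"
    unfolding atoms_before_def ennreal_suminf_cmult[symmetric]
    by (intro ext arg_cong[where f=suminf]) (auto simp: mult.commute)
  finally show ?thesis .
qed

lemma drift_total_square:
  assumes \<omega>: "\<omega> \<in> space Q"
  shows "(drift_total \<omega>)\<^sup>2 = 2 * (\<integral>\<^sup>+t. drift \<omega> t * drift_before (t, \<omega>) \<partial>lborel)"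
proof -
  note [measurable] = drift_measurable_time[OF \<omega>]
  let ?b = "drift \<omega>"
  have total: "drift_total \<omega> = drift_before (t, \<omega>) + (\<integral>\<^sup>+s. (if t < s then ?b s else 0) \<partial>lborel)" for t
  proof -
    have "drift_total \<omega> = (\<integral>\<^sup>+s. (if s < t then ?b s else 0) + (if t < s then ?b s else 0) \<partial>lborel)"
      unfolding drift_total_def
      by (rule nn_integral_cong_AE, use AE_lborel_singleton[of t] in eventually_elim) auto
    also have "\<dots> = drift_before (t, \<omega>) + (\<integral>\<^sup>+s. (if t < s then ?b s else 0) \<partial>lborel)"
      unfolding drift_before_def by (subst nn_integral_add) (auto cong: if_cong)
    finally show ?thesis .
  qed
  have before: "?b t * drift_before (t, \<omega>) = (\<integral>\<^sup>+s. ?b t * (if s < t then ?b s else 0) \<partial>lborel)" for t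
    unfolding drift_before_def by (simp add: nn_integral_cmult cong: if_cong)
  have [measurable]: "(\<lambda>t. drift_before (t, \<omega>)) \<in> borel_measurable borel"
    using measurable_compose[OF _ drift_before_measurable, of "\<lambda>t. (t, \<omega>)" borel] \<omega> by simp
  have "(drift_total \<omega>)\<^sup>2 = (\<integral>\<^sup>+t. ?b t * drift_total \<omega> \<partial>lborel)"
    by (subst nn_integral_multc) (auto simp: power2_eq_square drift_total_def)
  also have "\<dots> = (\<integral>\<^sup>+t. ?b t * drift_before (t, \<omega>)
      + (\<integral>\<^sup>+s. ?b t * (if t < s then ?b s else 0) \<partial>lborel) \<partial>lborel)"
  proof (rule nn_integral_cong)
    fix t
    have "(\<integral>\<^sup>+s. ?b t * (if t < s then ?b s else 0) \<partial>lborel) = ?b t * (\<integral>\<^sup>+s. (if t < s then ?b s else 0) \<partial>lborel)"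
      by (rule nn_integral_cmult) simp
    then show "?b t * drift_total \<omega> = ?b t * drift_before (t, \<omega>)
        + (\<integral>\<^sup>+s. ?b t * (if t < s then ?b s else 0) \<partial>lborel)"
      by (simp only: total[of t] distrib_left)
  qed
  also have "\<dots> = (\<integral>\<^sup>+t. ?b t * drift_before (t, \<omega>) \<partial>lborel)
      + (\<integral>\<^sup>+t. (\<integral>\<^sup>+s. ?b t * (if t < s then ?b s else 0) \<partial>lborel) \<partial>lborel)"
    by (subst nn_integral_add) auto
  also have "(\<integral>\<^sup>+t. (\<integral>\<^sup>+s. ?b t * (if t < s then ?b s else 0) \<partial>lborel) \<partial>lborel)
      = (\<integral>\<^sup>+s. (\<integral>\<^sup>+t. ?b t * (if t < s then ?b s else 0) \<partial>lborel) \<partial>lborel)"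
    by (rule lborel_pair.Fubini') measurable
  also have "\<dots> = (\<integral>\<^sup>+s. ?b s * drift_before (s, \<omega>) \<partial>lborel)"
    unfolding before by (intro nn_integral_cong) (auto simp: mult.commute)
  finally show ?thesis by (simp add: mult_2)
qed

lemma expected_atom_weighted:
  assumes G [measurable]: "G \<in> borel_measurable (predictable Q F)"
  shows "(\<integral>\<^sup>+\<omega>. (\<Sum>i. atom \<omega> i * G (\<tau> i \<omega>, \<omega>)) \<partial>Q) = (\<integral>\<^sup>+\<omega>. (\<integral>\<^sup>+t. drift \<omega> t * G (t, \<omega>) \<partial>lborel) \<partial>Q)"
proof -
  let ?W = "\<lambda>q. (if active (fst q) then h (fst (fst q)) (snd q) else 0) * G (fst q)"
  note [measurable] = predictable_time
  have [measurable]: "(\<lambda>q. h (fst (fst q)) (snd q)) \<in> borel_measurable (predictable Q F \<Otimes>\<^sub>M borel_nonneg)"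
    by (rule h_compose) measurable
  have "?W \<in> borel_measurable (predictable Q F \<Otimes>\<^sub>M borel_nonneg)" by measurable
  from compensator_explicit[OF this]
  have comp: "(\<integral>\<^sup>+\<omega>. (\<Sum>i. (if active (\<tau> i \<omega>, \<omega>) then h (\<tau> i \<omega>) (Z i \<omega>) else 0) * G (\<tau> i \<omega>, \<omega>)) \<partial>Q) =
    (\<integral>\<^sup>+\<omega>. (\<integral>\<^sup>+t. (if 0 < t then intens \<omega> t *
      (\<integral>\<^sup>+z. (if active (t, \<omega>) then h t z else 0) * G (t, \<omega>) \<partial>\<Theta>) else 0) \<partial>lborel) \<partial>Q)"
    by (simp only: fst_conv snd_conv)
  have "(if 0 < t then intens \<omega> t * (\<integral>\<^sup>+z. (if active (t, \<omega>) then h t z else 0) * G (t, \<omega>) \<partial>\<Theta>) else 0)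
      = drift \<omega> t * G (t, \<omega>)" for t \<omega>
  proof -
    have "(\<lambda>z. h t z) \<in> borel_measurable \<Theta>" by (rule h_compose) measurable
    then have "(\<integral>\<^sup>+z. h t z * G (t, \<omega>) \<partial>\<Theta>) = (\<integral>\<^sup>+z. h t z \<partial>\<Theta>) * G (t, \<omega>)" by (rule nn_integral_multc)
    then show ?thesis by (simp add: drift_def mult.assoc)
  qed
  then show ?thesis unfolding atom_def comp by simp
qed

text \<open>This says that the difference of \<open>atom_total\<close> and \<open>drift_total\<close> has the second moment \<open>E[quadratic_total]\<close>. It is written
  without subtraction so that it holds before any moment is known to be finite. All three expectations reduce to
  those of \<open>drift\<close> times \<open>atoms_before\<close> and \<open>drift\<close> times \<open>drift_before\<close>, because the compensator turns sums over
  events into drift integrals.\<close>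

lemma compensated_isometry:
  "(\<integral>\<^sup>+\<omega>. (atom_total \<omega>)\<^sup>2 \<partial>Q) + (\<integral>\<^sup>+\<omega>. (drift_total \<omega>)\<^sup>2 \<partial>Q)
    = (\<integral>\<^sup>+\<omega>. quadratic_total \<omega> \<partial>Q) + 2 * (\<integral>\<^sup>+\<omega>. atom_total \<omega> * drift_total \<omega> \<partial>Q)"
proof -
  have [measurable]: "(\<lambda>\<omega>. atoms_before (\<tau> i \<omega>, \<omega>)) \<in> borel_measurable Q"
    "(\<lambda>\<omega>. drift_before (\<tau> i \<omega>, \<omega>)) \<in> borel_measurable Q" for i
    by (rule measurable_compose[OF _ atoms_before_measurable] measurable_compose[OF _ drift_before_measurable], measurable)+
  have joint: "(\<lambda>\<omega>. \<integral>\<^sup>+t. drift \<omega> t * G (t, \<omega>) \<partial>lborel) \<in> borel_measurable Q"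
    if G: "G \<in> borel_measurable (borel \<Otimes>\<^sub>M Q)" for G :: "_ \<Rightarrow> ennreal"
  proof -
    have "(\<lambda>p. drift (snd p) (fst p) * G p) \<in> borel_measurable (borel \<Otimes>\<^sub>M Q)" using G by measurable
    from measurable_compose[OF _ this, of "\<lambda>q. (snd q, fst q)" "Q \<Otimes>\<^sub>M lborel"]
    have "(\<lambda>(\<omega>, t). drift \<omega> t * G (t, \<omega>)) \<in> borel_measurable (Q \<Otimes>\<^sub>M lborel)"
      by (simp add: case_prod_beta)
    then show ?thesis by (rule lborel.borel_measurable_nn_integral)
  qed
  let ?bX = "\<integral>\<^sup>+\<omega>. (\<integral>\<^sup>+t. drift \<omega> t * atoms_before (t, \<omega>) \<partial>lborel) \<partial>Q"
  let ?bB = "\<integral>\<^sup>+\<omega>. (\<integral>\<^sup>+t. drift \<omega> t * drift_before (t, \<omega>) \<partial>lborel) \<partial>Q"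
  note [measurable] = joint[OF atoms_before_measurable] joint[OF drift_before_measurable]
  have "(\<integral>\<^sup>+\<omega>. (atom_total \<omega>)\<^sup>2 \<partial>Q) =
      (\<integral>\<^sup>+\<omega>. (\<Sum>i. (atom \<omega> i)\<^sup>2) + 2 * (\<Sum>i. atom \<omega> i * atoms_before (\<tau> i \<omega>, \<omega>)) \<partial>Q)"
    by (rule nn_integral_cong_AE, use AE_proper in eventually_elim) (rule atom_total_square)
  also have "\<dots> = (\<integral>\<^sup>+\<omega>. quadratic_total \<omega> \<partial>Q) + 2 * ?bX"
    unfolding quadratic_total_def expected_atom_weighted[OF atoms_before_predictable, symmetric]
    by (subst nn_integral_add) (auto simp: nn_integral_cmult)
  finally have AA: "(\<integral>\<^sup>+\<omega>. (atom_total \<omega>)\<^sup>2 \<partial>Q) = (\<integral>\<^sup>+\<omega>. quadratic_total \<omega> \<partial>Q) + 2 * ?bX" .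
  have "(\<integral>\<^sup>+\<omega>. atom_total \<omega> * drift_total \<omega> \<partial>Q) =
      (\<integral>\<^sup>+\<omega>. (\<Sum>i. atom \<omega> i * drift_before (\<tau> i \<omega>, \<omega>))
      + (\<integral>\<^sup>+t. drift \<omega> t * atoms_before (t, \<omega>) \<partial>lborel) \<partial>Q)"
    by (rule nn_integral_cong_AE, use AE_proper in eventually_elim) (rule atom_drift_product)
  also have "\<dots> = ?bB + ?bX"
    unfolding expected_atom_weighted[OF drift_before_predictable, symmetric]
    by (subst nn_integral_add) auto
  finally have AB: "(\<integral>\<^sup>+\<omega>. atom_total \<omega> * drift_total \<omega> \<partial>Q) = ?bB + ?bX" .
  have "(\<integral>\<^sup>+\<omega>. (drift_total \<omega>)\<^sup>2 \<partial>Q) =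
      (\<integral>\<^sup>+\<omega>. 2 * (\<integral>\<^sup>+t. drift \<omega> t * drift_before (t, \<omega>) \<partial>lborel) \<partial>Q)"
    by (rule nn_integral_cong) (rule drift_total_square)
  also have "\<dots> = 2 * ?bB" by (subst nn_integral_cmult) auto
  finally show ?thesis unfolding AA AB by (simp add: distrib_left ac_simps)
qed

end

end

end

section \<open>Renewal equations for the mean intensity\<close>

lemma has_integral_reverse:
  fixes q :: "real \<Rightarrow> real"
  assumes "(q has_integral I) {0..T}"
  shows "((\<lambda>t. q (T - t)) has_integral I) {0..T}"
proof -
  have "((\<lambda>x. q (- 1 *\<^sub>R x + T)) has_integral (1 / \<bar>- 1\<bar> ^ DIM(real)) *\<^sub>R I)
      ((\<lambda>x. (1 / - 1) *\<^sub>R x + - ((1 / - 1) *\<^sub>R T)) ` cbox 0 T)"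
    by (rule has_integral_affinity) (use assms in auto)
  moreover have "(\<lambda>x. (1 / - 1) *\<^sub>R x + - ((1 / - 1) *\<^sub>R T)) ` cbox 0 T = {0..T}"
    by (auto simp: image_iff intro!: bexI[of _ "T - _"])
  ultimately show ?thesis by (simp add: algebra_simps)
qed

locale linear_hawkes_horizon = linear_hawkes \<Theta> Q F \<tau> Z \<Lambda> \<beta> lam0 lam
  for \<Theta> :: "real measure" and Q :: "'w measure" and F :: "real \<Rightarrow> 'w measure"
    and \<tau> Z :: "nat \<Rightarrow> 'w \<Rightarrow> real" and \<Lambda> \<beta> lam0 :: real and lam :: "real \<Rightarrow> 'w \<Rightarrow> real" +
  fixes T :: real
  assumes horizon_pos: "0 < T" and mean_events_pos: "0 < expected_intensity Q lam T"
begin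

definition mean_loss :: real where "mean_loss = (\<integral>z. z \<partial>\<Theta>)"
definition branching :: real where "branching = \<Lambda> * mean_loss"
definition \<kappa> :: real where "\<kappa> = \<beta> - branching"

lemma mean_loss_pos: "0 < mean_loss" unfolding mean_loss_def by (rule law.mean_pos)
lemma branching_pos: "0 < branching" using mean_loss_pos excitation_pos by (simp add: branching_def)
lemma kappa_pos: "0 < \<kappa>" using subcritical by (simp add: \<kappa>_def branching_def mean_loss_def)

text \<open>The weight \<open>q\<close> is a function of the time left until the horizon.\<close>

definition discounted :: "(real \<Rightarrow> real) \<Rightarrow> 'w \<Rightarrow> ennreal" where
  "discounted q \<omega> = (\<integral>\<^sup>+t. (if 0 < t then intens \<omega> t * (if t \<le> T then ennreal (q (T - t)) else 0) else 0) \<partial>lborel)"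

definition mean_discounted :: "(real \<Rightarrow> real) \<Rightarrow> ennreal" where
  "mean_discounted q = (\<integral>\<^sup>+\<omega>. discounted q \<omega> \<partial>Q)"

lemma discounted_measurable:
  assumes [measurable]: "q \<in> borel_measurable borel" shows "discounted q \<in> borel_measurable Q"
proof -
  have [measurable]: "(\<lambda>p. intens (fst p) (snd p)) \<in> borel_measurable (Q \<Otimes>\<^sub>M lborel)"
    using measurable_compose[OF _ intens_measurable, of "\<lambda>q. (snd q, fst q)" "Q \<Otimes>\<^sub>M lborel"] by simp
  have "(\<lambda>(\<omega>, t). if 0 < t then intens \<omega> t * (if t \<le> T then ennreal (q (T - t)) else 0) else 0)
      \<in> borel_measurable (Q \<Otimes>\<^sub>M lborel)"
    unfolding case_prod_beta by measurable
  then show ?thesis unfolding discounted_def[abs_def] by (rule lborel.borel_measurable_nn_integral)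
qed

lemma intens_measurable_time: "\<omega> \<in> space Q \<Longrightarrow> intens \<omega> \<in> borel_measurable borel"
  using measurable_compose[OF _ intens_measurable, of "\<lambda>t. (t, \<omega>)" borel] by simp

lemma discounted_add:
  assumes [measurable]: "q \<in> borel_measurable borel" "r \<in> borel_measurable borel"
    and nonneg: "\<And>s. 0 \<le> s \<Longrightarrow> 0 \<le> q s" "\<And>s. 0 \<le> s \<Longrightarrow> 0 \<le> r s" and \<omega>: "\<omega> \<in> space Q"
  shows "discounted (\<lambda>s. q s + r s) \<omega> = discounted q \<omega> + discounted r \<omega>"
proof -
  note [measurable] = intens_measurable_time[OF \<omega>]
  show ?thesis unfolding discounted_def
    by (subst nn_integral_add[symmetric])
       (auto intro!: nn_integral_cong simp: distrib_left ennreal_plus nonneg)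
qed

lemma discounted_cmult:
  assumes [measurable]: "q \<in> borel_measurable borel" and "0 \<le> c" and \<omega>: "\<omega> \<in> space Q"
  shows "discounted (\<lambda>s. c * q s) \<omega> = ennreal c * discounted q \<omega>"
proof -
  note [measurable] = intens_measurable_time[OF \<omega>]
  show ?thesis unfolding discounted_def using assms(2)
    by (subst nn_integral_cmult[symmetric])
       (auto intro!: nn_integral_cong simp: ennreal_mult' mult_ac)
qed

lemma discounted_mono:
  assumes "\<And>s. 0 \<le> s \<Longrightarrow> s \<le> T \<Longrightarrow> q s \<le> r s"
  shows "discounted q \<omega> \<le> discounted r \<omega>"
  unfolding discounted_def using assms
  by (intro nn_integral_mono) (auto intro!: mult_left_mono ennreal_leI)

lemma mean_discounted_add:
  assumes "q \<in> borel_measurable borel" "r \<in> borel_measurable borel"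
    and "\<And>s. 0 \<le> s \<Longrightarrow> 0 \<le> q s" "\<And>s. 0 \<le> s \<Longrightarrow> 0 \<le> r s"
  shows "mean_discounted (\<lambda>s. q s + r s) = mean_discounted q + mean_discounted r"
proof -
  have "mean_discounted (\<lambda>s. q s + r s) = (\<integral>\<^sup>+\<omega>. discounted q \<omega> + discounted r \<omega> \<partial>Q)"
    unfolding mean_discounted_def by (rule nn_integral_cong) (rule discounted_add[OF assms])
  also have "\<dots> = mean_discounted q + mean_discounted r"
    unfolding mean_discounted_def by (rule nn_integral_add) (intro discounted_measurable assms)+
  finally show ?thesis .
qed

lemma mean_discounted_cmult:
  assumes "q \<in> borel_measurable borel" "0 \<le> c"
  shows "mean_discounted (\<lambda>s. c * q s) = ennreal c * mean_discounted q"
proof -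
  have "mean_discounted (\<lambda>s. c * q s) = (\<integral>\<^sup>+\<omega>. ennreal c * discounted q \<omega> \<partial>Q)"
    unfolding mean_discounted_def by (rule nn_integral_cong) (rule discounted_cmult[OF assms])
  also have "\<dots> = ennreal c * mean_discounted q"
    unfolding mean_discounted_def by (rule nn_integral_cmult) (intro discounted_measurable assms)
  finally show ?thesis .
qed

lemma mean_discounted_mono:
  "(\<And>s. 0 \<le> s \<Longrightarrow> s \<le> T \<Longrightarrow> q s \<le> r s) \<Longrightarrow> mean_discounted q \<le> mean_discounted r"
  unfolding mean_discounted_def by (intro nn_integral_mono discounted_mono)

text \<open>An event contributes \<open>\<Lambda> z exp (- \<beta> u)\<close> to the intensity after a further time \<open>u\<close>. The total contribution of this against \<open>q\<close> until
  the horizon is \<open>\<Lambda> z y\<close>, where \<open>y\<close> is the convolution of \<open>q\<close> with the exponential, characterised here by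
  its differential equation.\<close>

lemma discounted_eq:
  assumes \<omega>: "proper \<omega>"
    and y: "\<And>s. (y has_real_derivative q s - \<beta> * y s) (at s)" "y 0 = 0"
    and nonneg: "\<And>s. 0 \<le> s \<Longrightarrow> 0 \<le> q s" "\<And>s. 0 \<le> s \<Longrightarrow> 0 \<le> y s"
    and q: "continuous_on UNIV q"
  shows "discounted q \<omega> = ennreal (lam0 * integral {0..T} q)
    + (\<Sum>i. if \<tau> i \<omega> \<le> T then ennreal (\<Lambda> * Z i \<omega> * y (T - \<tau> i \<omega>)) else 0)"
proof -
  have \<omega>': "\<omega> \<in> space Q" using \<omega> by (simp add: proper_def)
  have [measurable]: "q \<in> borel_measurable borel" using q by (rule borel_measurable_continuous_onI)
  define f where "f i t = (if past i (t, \<omega>) then ennreal (\<Lambda> * Z i \<omega> * exp (- \<beta> * (t - \<tau> i \<omega>))) else 0)" for i t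
  define r where "r t = (if 0 < t \<and> t \<le> T then ennreal (q (T - t)) else 0)" for t
  have [measurable]: "r \<in> borel_measurable borel"
    unfolding r_def[abs_def] by measurable
  have [measurable]: "f i \<in> borel_measurable borel" for i
    unfolding f_def[abs_def] past_def fst_conv snd_conv by measurable
  have each: "(\<integral>\<^sup>+t. f i t * r t \<partial>lborel)
      = (if \<tau> i \<omega> \<le> T then ennreal (\<Lambda> * Z i \<omega> * y (T - \<tau> i \<omega>)) else 0)" for i
  proof (cases "\<tau> i \<omega> \<le> T")
    case True
    let ?c = "\<Lambda> * Z i \<omega>"
    have c: "0 \<le> ?c" using excitation_pos mark_nonneg[OF \<omega>', of i] by simp
    have "(\<integral>\<^sup>+t. f i t * r t \<partial>lborel)
        = (\<integral>\<^sup>+t. ennreal (?c * exp (- \<beta> * (t - \<tau> i \<omega>)) * q (T - t)) * indicator {\<tau> i \<omega>..T} t \<partial>lborel)"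
    proof (rule nn_integral_cong_AE, use AE_lborel_singleton[of "\<tau> i \<omega>"] in eventually_elim)
      case (elim t)
      then show ?case using proper_pos[OF \<omega>, of i] c nonneg
        by (auto simp: f_def r_def past_def ennreal_mult' indicator_def ennreal_mult)
    qed
    also have "\<dots> = ennreal (?c * y (T - \<tau> i \<omega>))"
    proof (rule nn_integral_has_integral_lebesgue')
      let ?Y = "\<lambda>t. - ?c * exp (- \<beta> * (t - \<tau> i \<omega>)) * y (T - t)"
      have "((\<lambda>t. ?c * exp (- \<beta> * (t - \<tau> i \<omega>)) * q (T - t)) has_integral (?Y T - ?Y (\<tau> i \<omega>))) {\<tau> i \<omega>..T}"
      proof (rule fundamental_theorem_of_calculus[OF True])
        fix t assume t: "t \<in> {\<tau> i \<omega>..T}"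
        have "((\<lambda>t. y (T - t)) has_real_derivative (q (T - t) - \<beta> * y (T - t)) * (- 1)) (at t within {\<tau> i \<omega>..T})"
          by (rule DERIV_chain2[OF y(1)]) (auto intro!: derivative_eq_intros)
        then show "(?Y has_vector_derivative ?c * exp (- \<beta> * (t - \<tau> i \<omega>)) * q (T - t)) (at t within {\<tau> i \<omega>..T})"
          unfolding has_real_derivative_iff_has_vector_derivative[symmetric]
          by (auto intro!: derivative_eq_intros simp: algebra_simps)
      qed
      then show "((\<lambda>t. ?c * exp (- \<beta> * (t - \<tau> i \<omega>)) * q (T - t)) has_integral ?c * y (T - \<tau> i \<omega>)) {\<tau> i \<omega>..T}"
        using y(2) by simp
    qed (use c nonneg in auto)
    finally show ?thesis using True by simp
  next
    case False
    then have "f i t * r t = 0" for t by (auto simp: f_def r_def past_def)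
    then have "(\<integral>\<^sup>+t. f i t * r t \<partial>lborel) = (\<integral>\<^sup>+t. 0 \<partial>(lborel :: real measure))" by (intro nn_integral_cong)
    then show ?thesis using False by simp
  qed
  have "discounted q \<omega> = (\<integral>\<^sup>+t. ennreal lam0 * r t + (\<Sum>i. f i t * r t) \<partial>lborel)"
    unfolding discounted_def intens_def f_def r_def
    by (intro nn_integral_cong) (simp add: distrib_right)
  also have "\<dots> = ennreal lam0 * (\<integral>\<^sup>+t. r t \<partial>lborel) + (\<Sum>i. \<integral>\<^sup>+t. f i t * r t \<partial>lborel)"
    by (simp add: nn_integral_add nn_integral_cmult nn_integral_suminf del: ennreal_suminf_multc)
  also have "(\<integral>\<^sup>+t. r t \<partial>lborel) = ennreal (integral {0..T} q)"
  proof -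
    have "(\<integral>\<^sup>+t. r t \<partial>lborel) = (\<integral>\<^sup>+t. ennreal (q (T - t)) * indicator {0..T} t \<partial>lborel)"
      by (rule nn_integral_cong_AE, use AE_lborel_singleton[of 0] in eventually_elim) (auto simp: r_def)
    also have "\<dots> = ennreal (integral {0..T} q)"
    proof (rule nn_integral_has_integral_lebesgue')
      have "q integrable_on {0..T}"
        using q by (intro integrable_continuous_interval) (rule continuous_on_subset, auto)
      then show "((\<lambda>t. q (T - t)) has_integral integral {0..T} q) {0..T}"
        by (intro has_integral_reverse integrable_integral)
    qed (use nonneg in auto)
    finally show ?thesis .
  qed
  finally show ?thesis using baseline_pos unfolding each by (simp add: ennreal_mult')
qed

lemma suminf_until_horizon:
  assumes "proper \<omega>" "\<And>i. \<tau> i \<omega> \<le> T \<Longrightarrow> 0 \<le> c i"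
  shows "(\<Sum>i. if \<tau> i \<omega> \<le> T then ennreal (c i) else 0) = ennreal (\<Sum>i | \<tau> i \<omega> \<le> T. c i)"
proof -
  have "(\<Sum>i. if \<tau> i \<omega> \<le> T then ennreal (c i) else 0) = (\<Sum>i | \<tau> i \<omega> \<le> T. ennreal (c i))"
    by (subst suminf_finite[OF proper_finite(2)[OF assms(1), of T]]) auto
  also have "\<dots> = ennreal (\<Sum>i | \<tau> i \<omega> \<le> T. c i)" using assms(2) by (intro sum_ennreal) auto
  finally show ?thesis .
qed

text \<open>A Bochner integral that does not exist has the value \<open>0\<close>, so a positive expected intensity already entails integrability.\<close>

lemma mean_discounted_one: "mean_discounted (\<lambda>_. 1) = ennreal (expected_intensity Q lam T)"
proof -
  let ?f = "\<lambda>\<omega>. \<integral>s\<in>{0..T}. lam s \<omega> \<partial>lborel"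
  have f: "AE \<omega> in Q. ennreal (?f \<omega>) = discounted (\<lambda>_. 1) \<omega> \<and> 0 \<le> ?f \<omega>"
    using intensity_explicit
  proof eventually_elim
    case (elim \<omega>)
    then have \<omega>: "proper \<omega>" "\<omega> \<in> space Q" by (auto simp: proper_def)
    note [measurable] = intens_measurable_time[OF \<omega>(2)]
    have "discounted (\<lambda>_. 1) \<omega> = ennreal (lam0 * integral {0..T} (\<lambda>_. 1))
        + (\<Sum>i. if \<tau> i \<omega> \<le> T then ennreal (\<Lambda> * Z i \<omega> * gain \<beta> (T - \<tau> i \<omega>)) else 0)"
    proof (rule discounted_eq[OF \<omega>(1)])
      show "(gain \<beta> has_real_derivative 1 - \<beta> * gain \<beta> s) (at s)" for s
        using gain_deriv[of \<beta> s UNIV] gain_deriv_eq[of \<beta> s] decay_pos by simp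
    qed (use decay_pos gain_bounds(1)[of \<beta>] in auto)
    also have "\<dots> < \<top>"
      by (subst suminf_until_horizon[OF \<omega>(1)])
         (use \<omega>(2) excitation_pos decay_pos in \<open>auto intro!: mult_nonneg_nonneg gain_bounds mark_nonneg\<close>)
    finally have fin: "discounted (\<lambda>_. 1) \<omega> < \<top>" .
    have lam: "lam s \<omega> = enn2real (intens \<omega> s)" "intens \<omega> s < \<top>" if "0 \<le> s" for s
    proof -
      have "0 \<le> lam s \<omega>" "intens \<omega> s = ennreal (lam s \<omega>)" using elim that by auto
      then show "lam s \<omega> = enn2real (intens \<omega> s)" "intens \<omega> s < \<top>" by auto
    qed
    have "?f \<omega> = (\<integral>s. indicator {0..T} s * enn2real (intens \<omega> s) \<partial>lborel)"
      unfolding set_lebesgue_integral_def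
      by (intro Bochner_Integration.integral_cong) (auto simp: indicator_def lam(1))
    also have "\<dots> = enn2real (\<integral>\<^sup>+s. ennreal (indicator {0..T} s * enn2real (intens \<omega> s)) \<partial>lborel)"
      by (rule integral_eq_nn_integral) auto
    also have "(\<integral>\<^sup>+s. ennreal (indicator {0..T} s * enn2real (intens \<omega> s)) \<partial>lborel) = discounted (\<lambda>_. 1) \<omega>"
      unfolding discounted_def
      by (rule nn_integral_cong_AE, use AE_lborel_singleton[of 0] in eventually_elim)
         (use lam(2) in \<open>auto simp: indicator_def\<close>)
    finally show ?case using fin by simp
  qed
  have "integrable Q ?f"
    using mean_events_pos not_integrable_integral_eq[of Q ?f] unfolding expected_intensity_def by fastforce
  have "mean_discounted (\<lambda>_. 1) = (\<integral>\<^sup>+\<omega>. ennreal (?f \<omega>) \<partial>Q)"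
    unfolding mean_discounted_def
    by (rule nn_integral_cong_AE, use f in eventually_elim) simp
  also have "\<dots> = ennreal (expected_intensity Q lam T)"
    unfolding expected_intensity_def
    by (rule nn_integral_eq_integral[OF \<open>integrable Q ?f\<close>], use f in eventually_elim) simp
  finally show ?thesis .
qed

text \<open>If \<open>q - x y = q\<^sub>0\<close> with \<open>x = branching\<close>, and \<open>mean_discounted y\<close> is finite, this determines \<open>mean_discounted q\<^sub>0\<close>. It is applied to \<open>q\<^sub>0 = 1\<close> with
  \<open>y = gain \<kappa>\<close>, and to \<open>q\<^sub>0 = gain \<kappa>\<close> with \<open>y = gain2 \<kappa>\<close>.\<close>

lemma mean_renewal:
  assumes y: "\<And>s. (y has_real_derivative q s - \<beta> * y s) (at s)" "y 0 = 0"
    and nonneg: "\<And>s. 0 \<le> s \<Longrightarrow> 0 \<le> q s" "\<And>s. 0 \<le> s \<Longrightarrow> 0 \<le> y s"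
    and q: "continuous_on UNIV q"
  shows "mean_discounted q = ennreal (lam0 * integral {0..T} q) + ennreal branching * mean_discounted y"
proof -
  have [measurable]: "y \<in> borel_measurable borel"
    using y(1) by (intro borel_measurable_continuous_onI continuous_at_imp_continuous_on ballI DERIV_isCont)
  let ?W = "\<lambda>p. if fst (fst p) \<le> T then ennreal (\<Lambda> * snd p * y (T - fst (fst p))) else 0"
  note [measurable] = predictable_time
  have "?W \<in> borel_measurable (predictable Q F \<Otimes>\<^sub>M borel_nonneg)" by measurable
  from compensator_explicit[OF this]
  have comp: "(\<integral>\<^sup>+\<omega>. (\<Sum>i. if \<tau> i \<omega> \<le> T then ennreal (\<Lambda> * Z i \<omega> * y (T - \<tau> i \<omega>)) else 0) \<partial>Q)
    = (\<integral>\<^sup>+\<omega>. (\<integral>\<^sup>+t. (if 0 < t then intens \<omega> t *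
      (\<integral>\<^sup>+z. (if t \<le> T then ennreal (\<Lambda> * z * y (T - t)) else 0) \<partial>\<Theta>) else 0) \<partial>lborel) \<partial>Q)"
    by (simp only: fst_conv snd_conv)
  have "(\<integral>\<^sup>+z. (if t \<le> T then ennreal (\<Lambda> * z * y (T - t)) else 0) \<partial>\<Theta>)
      = (if t \<le> T then ennreal (branching * y (T - t)) else 0)" for t
  proof (cases "t \<le> T")
    case True
    have "(\<integral>\<^sup>+z. ennreal (z * (\<Lambda> * y (T - t))) \<partial>\<Theta>) = ennreal (\<integral>z. z * (\<Lambda> * y (T - t)) \<partial>\<Theta>)"
      by (rule nn_integral_eq_integral, simp)
         (use law.AE_loss_nonneg True nonneg(2)[of "T - t"] excitation_pos in \<open>auto elim!: eventually_mono\<close>)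
    then show ?thesis using True by (simp add: branching_def mean_loss_def mult_ac)
  qed simp
  then have "(\<integral>\<^sup>+\<omega>. (\<Sum>i. if \<tau> i \<omega> \<le> T then ennreal (\<Lambda> * Z i \<omega> * y (T - \<tau> i \<omega>)) else 0) \<partial>Q)
      = mean_discounted (\<lambda>s. branching * y s)"
    unfolding comp mean_discounted_def discounted_def by (simp only:)
  also have "\<dots> = ennreal branching * mean_discounted y"
    using branching_pos by (intro mean_discounted_cmult) auto
  finally have sum: "(\<integral>\<^sup>+\<omega>. (\<Sum>i. if \<tau> i \<omega> \<le> T then ennreal (\<Lambda> * Z i \<omega> * y (T - \<tau> i \<omega>)) else 0) \<partial>Q)
      = ennreal branching * mean_discounted y" .
  have "mean_discounted q = (\<integral>\<^sup>+\<omega>. ennreal (lam0 * integral {0..T} q)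
    + (\<Sum>i. if \<tau> i \<omega> \<le> T then ennreal (\<Lambda> * Z i \<omega> * y (T - \<tau> i \<omega>)) else 0) \<partial>Q)"
    unfolding mean_discounted_def
    by (rule nn_integral_cong_AE, use AE_proper in eventually_elim) (rule discounted_eq[OF _ y nonneg q])
  also have "\<dots> = ennreal (lam0 * integral {0..T} q) + ennreal branching * mean_discounted y"
    unfolding sum[symmetric] by (subst nn_integral_add) (auto simp: emeasure_space_1)
  finally show ?thesis .
qed

text \<open>Per unit of baseline intensity, the expected integrals of the intensity and of its product with \<open>gain\<close>
  (\<open>mean_events\<close>, \<open>mean_gain\<close>).\<close>

definition mean_factor :: real where
  "mean_factor = integral {0..T} (\<lambda>t. 1 + branching * gain \<kappa> t)"

definition gain_factor :: real where
  "gain_factor = integral {0..T} (\<lambda>t. gain \<kappa> t + branching * gain2 \<kappa> t)"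

lemma gain_measurable [measurable]: "gain \<kappa> \<in> borel_measurable borel" "gain2 \<kappa> \<in> borel_measurable borel"
  by (auto intro!: borel_measurable_continuous_onI continuous_intros)

lemma gain_nonneg: "0 \<le> s \<Longrightarrow> 0 \<le> gain \<kappa> s" "0 \<le> s \<Longrightarrow> 0 \<le> gain2 \<kappa> s" "0 \<le> s \<Longrightarrow> s \<le> T \<Longrightarrow> gain \<kappa> s \<le> T"
  using gain_bounds[OF kappa_pos, of s] by auto

lemma gain_equation: "(gain \<kappa> has_real_derivative (1 + branching * gain \<kappa> s) - \<beta> * gain \<kappa> s) (at s)"
proof -
  have "(1 + branching * gain \<kappa> s) - \<beta> * gain \<kappa> s = exp (- \<kappa> * s)"
    using gain_deriv_eq[of \<kappa> s] kappa_pos by (simp add: \<kappa>_def algebra_simps)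
  then show ?thesis using gain_deriv[of \<kappa> s UNIV] kappa_pos by simp
qed

lemma gain2_equation:
  "(gain2 \<kappa> has_real_derivative (gain \<kappa> s + branching * gain2 \<kappa> s) - \<beta> * gain2 \<kappa> s) (at s)"
proof -
  have "(gain \<kappa> s + branching * gain2 \<kappa> s) - \<beta> * gain2 \<kappa> s = s * exp (- \<kappa> * s)"
    using gain2_deriv_eq[of \<kappa> s] kappa_pos by (simp add: \<kappa>_def algebra_simps)
  then show ?thesis using gain2_deriv[of \<kappa> s UNIV] kappa_pos by simp
qed

lemma mean_discounted_bounded:
  assumes "\<And>s. 0 \<le> s \<Longrightarrow> s \<le> T \<Longrightarrow> q s \<le> c" "0 \<le> c"
  shows "mean_discounted q < \<top>"
proof -
  have "mean_discounted q \<le> mean_discounted (\<lambda>s. c * 1)" using assms by (intro mean_discounted_mono) auto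
  also have "\<dots> = ennreal c * mean_discounted (\<lambda>_. 1)" using assms by (intro mean_discounted_cmult) auto
  also have "\<dots> < \<top>" unfolding mean_discounted_one by (simp add: ennreal_mult_less_top)
  finally show ?thesis .
qed

lemma mean_events: "expected_intensity Q lam T = lam0 * mean_factor"
proof -
  have "mean_discounted (\<lambda>_. 1) + ennreal branching * mean_discounted (gain \<kappa>)
      = mean_discounted (\<lambda>s. 1 + branching * gain \<kappa> s)"
    using branching_pos gain_nonneg
    by (subst mean_discounted_add) (auto simp: mean_discounted_cmult)
  also have "\<dots> = ennreal (lam0 * mean_factor) + ennreal branching * mean_discounted (gain \<kappa>)"
    unfolding mean_factor_def
    by (rule mean_renewal[OF gain_equation])
       (use branching_pos gain_nonneg in \<open>auto intro!: continuous_intros add_nonneg_nonneg\<close>)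
  finally have "ennreal (expected_intensity Q lam T) + ennreal branching * mean_discounted (gain \<kappa>)
    = ennreal (lam0 * mean_factor) + ennreal branching * mean_discounted (gain \<kappa>)"
    by (simp only: mean_discounted_one)
  moreover have "ennreal branching * mean_discounted (gain \<kappa>) < \<top>"
    using mean_discounted_bounded[of "gain \<kappa>" T] gain_nonneg(3) horizon_pos by (simp add: ennreal_mult_less_top)
  ultimately have "ennreal (expected_intensity Q lam T) = ennreal (lam0 * mean_factor)"
    by (metis ennreal_add_left_cancel add.commute infinity_ennreal_def less_irrefl)
  moreover have "0 \<le> mean_factor"
    unfolding mean_factor_def using branching_pos gain_nonneg
    by (intro integral_nonneg integrable_continuous_interval continuous_intros) auto
  ultimately show ?thesis using mean_events_pos baseline_pos by simp
qed

lemma mean_gain: "mean_discounted (gain \<kappa>) = ennreal (lam0 * gain_factor)"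
proof -
  have "mean_discounted (gain \<kappa>) + ennreal branching * mean_discounted (gain2 \<kappa>)
      = mean_discounted (\<lambda>s. gain \<kappa> s + branching * gain2 \<kappa> s)"
    using branching_pos gain_nonneg
    by (subst mean_discounted_add) (auto simp: mean_discounted_cmult)
  also have "\<dots> = ennreal (lam0 * gain_factor) + ennreal branching * mean_discounted (gain2 \<kappa>)"
    unfolding gain_factor_def
    by (rule mean_renewal[OF gain2_equation])
       (use branching_pos gain_nonneg in \<open>auto intro!: continuous_intros add_nonneg_nonneg\<close>)
  finally have "mean_discounted (gain \<kappa>) + ennreal branching * mean_discounted (gain2 \<kappa>)
    = ennreal (lam0 * gain_factor) + ennreal branching * mean_discounted (gain2 \<kappa>)" .
  moreover have "ennreal branching * mean_discounted (gain2 \<kappa>) < \<top>"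
  proof -
    have "gain2 \<kappa> s \<le> T\<^sup>2" if "0 \<le> s" "s \<le> T" for s
      using gain_bounds(4)[OF kappa_pos that(1)] power_mono[OF that(2,1), of 2] by simp
    then show ?thesis
      using mean_discounted_bounded[of "gain2 \<kappa>" "T\<^sup>2"] by (simp add: ennreal_mult_less_top)
  qed
  ultimately show ?thesis
    by (metis ennreal_add_left_cancel add.commute infinity_ennreal_def less_irrefl)
qed

lemma factor_nonneg: "0 \<le> mean_factor" "0 \<le> gain_factor"
  unfolding mean_factor_def gain_factor_def using branching_pos gain_nonneg
  by (intro integral_nonneg integrable_continuous_interval continuous_intros; simp)+

end

section \<open>Moments of the aggregate retained loss\<close>

lemma ennreal_mult_le_squares: "a * b \<le> a\<^sup>2 + (b::ennreal)\<^sup>2"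
proof (cases "a \<le> b")
  case True
  then have "a * b \<le> b\<^sup>2" unfolding power2_eq_square by (rule mult_right_mono) simp
  then show ?thesis by (simp add: add_increasing)
next
  case False
  then have "a * b \<le> a\<^sup>2" unfolding power2_eq_square by (intro mult_left_mono) auto
  then show ?thesis by (simp add: add_increasing2)
qed

lemma ennreal_square_add_le: "(a + b)\<^sup>2 \<le> 4 * (a\<^sup>2 + (b::ennreal)\<^sup>2)"
proof -
  have "(a + b)\<^sup>2 = a\<^sup>2 + b\<^sup>2 + 2 * (a * b)"
    unfolding mult_2 by (simp add: power2_eq_square distrib_left distrib_right mult.commute add_ac)
  also have "\<dots> \<le> a\<^sup>2 + b\<^sup>2 + 2 * (a\<^sup>2 + b\<^sup>2)"
    by (intro add_left_mono mult_left_mono ennreal_mult_le_squares) auto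
  also have "\<dots> \<le> 2 * (a\<^sup>2 + b\<^sup>2) + 2 * (a\<^sup>2 + b\<^sup>2)"
    by (intro add_right_mono) (simp add: mult_2)
  also have "\<dots> = (2 + 2) * (a\<^sup>2 + b\<^sup>2)" by (simp only: distrib_right)
  also have "\<dots> = 4 * (a\<^sup>2 + b\<^sup>2)" by simp
  finally show ?thesis .
qed

lemma ennreal_sum_square_le:
  fixes a :: "'i \<Rightarrow> ennreal"
  shows "(\<Sum>i\<in>I. a i)\<^sup>2 \<le> 2 * of_nat (card I) * (\<Sum>i\<in>I. (a i)\<^sup>2)"
proof -
  have "(\<Sum>i\<in>I. a i)\<^sup>2 = (\<Sum>i\<in>I. \<Sum>j\<in>I. a i * a j)" by (simp add: power2_eq_square sum_product)
  also have "\<dots> \<le> (\<Sum>i\<in>I. \<Sum>j\<in>I. (a i)\<^sup>2 + (a j)\<^sup>2)" by (intro sum_mono ennreal_mult_le_squares)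
  also have "\<dots> = 2 * of_nat (card I) * (\<Sum>i\<in>I. (a i)\<^sup>2)"
    by (simp add: sum.distrib sum_distrib_left[symmetric] mult_2 distrib_right)
  finally show ?thesis .
qed

lemma ennreal_square_diff:
  assumes "a < \<top>" "b < \<top>"
  shows "a\<^sup>2 + b\<^sup>2 = ennreal ((enn2real a - enn2real b)\<^sup>2) + 2 * (a * b)"
proof -
  obtain x y where xy: "a = ennreal x" "b = ennreal y" "0 \<le> x" "0 \<le> y"
    using assms by (auto simp: less_top_ennreal)
  have "a\<^sup>2 + b\<^sup>2 = ennreal (x\<^sup>2 + y\<^sup>2)" using xy by (simp add: ennreal_power)
  also have "x\<^sup>2 + y\<^sup>2 = (x - y)\<^sup>2 + 2 * (x * y)" by (simp add: power2_eq_square algebra_simps)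
  also have "ennreal \<dots> = ennreal ((x - y)\<^sup>2) + 2 * (a * b)"
    using xy by (simp add: ennreal_mult[symmetric]) (simp add: ennreal_mult ennreal_numeral[symmetric] del: ennreal_numeral)
  finally show ?thesis using xy by simp
qed

text \<open>The form in which the isometry is used: for square integrable \<open>A\<close> and \<open>B\<close>, the mixed term can be cancelled.\<close>

lemma square_integral_of_polarised:
  fixes A B :: "'a \<Rightarrow> ennreal"
  assumes [measurable]: "A \<in> borel_measurable M" "B \<in> borel_measurable M"
    and fin: "(\<integral>\<^sup>+x. (A x)\<^sup>2 \<partial>M) < \<top>" "(\<integral>\<^sup>+x. (B x)\<^sup>2 \<partial>M) < \<top>"
    and eq: "(\<integral>\<^sup>+x. (A x)\<^sup>2 \<partial>M) + (\<integral>\<^sup>+x. (B x)\<^sup>2 \<partial>M) = Y + 2 * (\<integral>\<^sup>+x. A x * B x \<partial>M)"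
  shows "(\<integral>\<^sup>+x. ennreal ((enn2real (A x) - enn2real (B x))\<^sup>2) \<partial>M) = Y"
proof -
  have AE: "AE x in M. A x < \<top> \<and> B x < \<top>"
    using nn_integral_PInf_AE[of "\<lambda>x. (A x)\<^sup>2" M] nn_integral_PInf_AE[of "\<lambda>x. (B x)\<^sup>2" M] fin
    by (auto simp: less_top[symmetric] power2_eq_square ennreal_mult_eq_top_iff elim!: eventually_elim2)
  let ?D = "\<integral>\<^sup>+x. ennreal ((enn2real (A x) - enn2real (B x))\<^sup>2) \<partial>M"
  have "(\<integral>\<^sup>+x. (A x)\<^sup>2 \<partial>M) + (\<integral>\<^sup>+x. (B x)\<^sup>2 \<partial>M) = (\<integral>\<^sup>+x. (A x)\<^sup>2 + (B x)\<^sup>2 \<partial>M)"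
    by (simp add: nn_integral_add)
  also have "\<dots> = (\<integral>\<^sup>+x. ennreal ((enn2real (A x) - enn2real (B x))\<^sup>2) + 2 * (A x * B x) \<partial>M)"
    by (rule nn_integral_cong_AE, use AE in eventually_elim) (simp add: ennreal_square_diff)
  also have "\<dots> = ?D + 2 * (\<integral>\<^sup>+x. A x * B x \<partial>M)" by (simp add: nn_integral_add nn_integral_cmult)
  finally have "?D + 2 * (\<integral>\<^sup>+x. A x * B x \<partial>M) = Y + 2 * (\<integral>\<^sup>+x. A x * B x \<partial>M)"
    by (rule trans[OF sym eq])
  then have "2 * (\<integral>\<^sup>+x. A x * B x \<partial>M) + ?D = 2 * (\<integral>\<^sup>+x. A x * B x \<partial>M) + Y"
    by (subst (1 2) add.commute)
  moreover have "2 * (\<integral>\<^sup>+x. A x * B x \<partial>M) < \<top>"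
  proof -
    have "(\<integral>\<^sup>+x. A x * B x \<partial>M) \<le> (\<integral>\<^sup>+x. (A x)\<^sup>2 + (B x)\<^sup>2 \<partial>M)"
      by (intro nn_integral_mono ennreal_mult_le_squares)
    also have "\<dots> < \<top>" using fin by (simp add: nn_integral_add)
    finally show ?thesis by (simp add: ennreal_mult_less_top)
  qed
  ultimately show ?thesis
    unfolding ennreal_add_left_cancel by (metis infinity_ennreal_def less_irrefl)
qed

context linear_hawkes_horizon
begin

lemma quadratic_total_eq: "quadratic_total h J \<omega> = atom_total (\<lambda>t z. (h t z)\<^sup>2) J \<omega>"
  unfolding quadratic_total_def atom_total_def atom_def by (intro arg_cong[where f=suminf] ext) auto

lemma expected_atom_total:
  assumes h: "(\<lambda>p. h (fst p) (snd p)) \<in> borel_measurable (borel \<Otimes>\<^sub>M borel)"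
    and q: "\<And>t. 0 < t \<Longrightarrow> t \<le> T \<Longrightarrow> (\<integral>\<^sup>+z. h t z \<partial>\<Theta>) = ennreal (q (T - t))"
    and 0: "\<And>t. T < t \<Longrightarrow> (\<integral>\<^sup>+z. h t z \<partial>\<Theta>) = 0"
  shows "(\<integral>\<^sup>+\<omega>. atom_total h {} \<omega> \<partial>Q) = mean_discounted q"
proof -
  have "drift h {} \<omega> t = (if 0 < t then intens \<omega> t * (if t \<le> T then ennreal (q (T - t)) else 0) else 0)" for \<omega> t
    using q[of t] 0[of t] by (auto simp: drift_def active_def)
  then show ?thesis
    using expected_atom_weighted[OF h, of "\<lambda>_. 1" "{}"]
    by (simp add: atom_total_def mean_discounted_def discounted_def)
qed

definition aggregate :: "(real \<Rightarrow> real) \<Rightarrow> 'w \<Rightarrow> real" where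
  "aggregate \<psi> \<omega> = enn2real (\<Sum>i. if \<tau> i \<omega> \<le> T then ennreal (\<psi> (Z i \<omega>)) else 0)"

text \<open>Retained losses are taken as functions on the whole line with pointwise bounds; every contract agrees almost
  everywhere with one whose retained loss has this form.\<close>

definition retention :: "(real \<Rightarrow> real) \<Rightarrow> bool" where
  "retention \<psi> \<longleftrightarrow> \<psi> \<in> borel_measurable borel \<and> (\<forall>z. 0 \<le> \<psi> z) \<and> (\<forall>z\<ge>0. \<psi> z \<le> z)"

lemma retention_contract: "retention \<psi> \<Longrightarrow> \<psi> \<in> contracts \<Theta>"
  unfolding retention_def law.contracts_iff
  by (intro conjI law.borel_measurable_loss) (use law.AE_loss_nonneg in \<open>auto elim!: eventually_mono\<close>)

text \<open>The effect of an event with mark \<open>z\<close> at time \<open>T - s\<close> on the conditional expectation of the aggregate: its own retained loss,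
  and the retained losses of the offspring expected in the remaining time \<open>s\<close>.\<close>

definition response :: "(real \<Rightarrow> real) \<Rightarrow> real \<Rightarrow> real \<Rightarrow> real" where
  "response \<psi> s z = \<psi> z + (\<integral>z. \<psi> z \<partial>\<Theta>) * \<Lambda> * z * gain \<kappa> s"

definition response_kernel :: "(real \<Rightarrow> real) \<Rightarrow> real \<Rightarrow> real \<Rightarrow> ennreal" where
  "response_kernel \<psi> t z = (if t \<le> T then ennreal (response \<psi> (T - t) z) else 0)"

context
  fixes \<psi> :: "real \<Rightarrow> real"
  assumes \<psi>: "retention \<psi>"
begin

lemma retention_facts: "\<psi> \<in> borel_measurable borel" "0 \<le> \<psi> z" "0 \<le> z \<Longrightarrow> \<psi> z \<le> z"
  using \<psi> by (auto simp: retention_def)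

lemma retention_integrable: "integrable \<Theta> \<psi>" "integrable \<Theta> (\<lambda>z. z * \<psi> z)" "integrable \<Theta> (\<lambda>z. (\<psi> z)\<^sup>2)"
  using law.integrable_contract[OF retention_contract[OF \<psi>]]
    law.integrable_contract_mult[OF law.id_contract retention_contract[OF \<psi>]]
    law.integrable_contract_mult[OF retention_contract[OF \<psi>] retention_contract[OF \<psi>]]
  by (simp_all add: power2_eq_square)

lemma retention_mean_nonneg: "0 \<le> (\<integral>z. \<psi> z \<partial>\<Theta>)"
  using retention_facts(2) by simp

lemma response_nonneg: "0 \<le> s \<Longrightarrow> 0 \<le> z \<Longrightarrow> 0 \<le> response \<psi> s z"
  unfolding response_def using retention_facts(2) retention_mean_nonneg excitation_pos gain_nonneg(1)
  by (intro add_nonneg_nonneg mult_nonneg_nonneg) auto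

lemma kernel_measurable: "(\<lambda>p. response_kernel \<psi> (fst p) (snd p)) \<in> borel_measurable (borel \<Otimes>\<^sub>M borel)"
proof -
  note [measurable] = retention_facts(1)
  show ?thesis unfolding response_kernel_def response_def by measurable
qed

lemma kernel_mean:
  assumes "0 < t" "t \<le> T"
  shows "(\<integral>\<^sup>+z. response_kernel \<psi> t z \<partial>\<Theta>) = ennreal ((\<integral>z. \<psi> z \<partial>\<Theta>) * (1 + branching * gain \<kappa> (T - t)))"
proof -
  have "(\<integral>\<^sup>+z. response_kernel \<psi> t z \<partial>\<Theta>) = (\<integral>\<^sup>+z. ennreal (response \<psi> (T - t) z) \<partial>\<Theta>)"
    using assms by (simp add: response_kernel_def)
  also have "\<dots> = ennreal (\<integral>z. response \<psi> (T - t) z \<partial>\<Theta>)"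
  proof (rule nn_integral_eq_integral)
    show "integrable \<Theta> (response \<psi> (T - t))" unfolding response_def[abs_def] using retention_integrable by simp
    show "AE z in \<Theta>. 0 \<le> response \<psi> (T - t) z"
      using law.AE_loss_nonneg by eventually_elim (use assms response_nonneg in simp)
  qed
  also have "(\<integral>z. response \<psi> (T - t) z \<partial>\<Theta>) = (\<integral>z. \<psi> z \<partial>\<Theta>) * (1 + branching * gain \<kappa> (T - t))"
    unfolding response_def using retention_integrable by (simp add: branching_def mean_loss_def algebra_simps)
  finally show ?thesis .
qed

text \<open>The mean of the squared response, expanded in powers of \<open>gain\<close>.\<close>

definition kernel_square :: "real \<Rightarrow> real" where
  "kernel_square s = (\<integral>z. (\<psi> z)\<^sup>2 \<partial>\<Theta>)
     + ((2 * \<Lambda> * (\<integral>z. \<psi> z \<partial>\<Theta>) * (\<integral>z. z * \<psi> z \<partial>\<Theta>)) * gain \<kappa> s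
     + (\<Lambda>\<^sup>2 * (\<integral>z. z\<^sup>2 \<partial>\<Theta>) * (\<integral>z. \<psi> z \<partial>\<Theta>)\<^sup>2) * (gain \<kappa> s)\<^sup>2)"

lemma kernel_square_mean:
  assumes "0 < t" "t \<le> T"
  shows "(\<integral>\<^sup>+z. (response_kernel \<psi> t z)\<^sup>2 \<partial>\<Theta>) = ennreal (kernel_square (T - t))"
proof -
  let ?p = "\<integral>z. \<psi> z \<partial>\<Theta>" and ?g = "gain \<kappa> (T - t)"
  have sq: "(response \<psi> (T - t) z)\<^sup>2 = (\<psi> z)\<^sup>2 + ((2 * \<Lambda> * ?p * ?g) * (z * \<psi> z) + (\<Lambda>\<^sup>2 * ?p\<^sup>2 * ?g\<^sup>2) * z\<^sup>2)" for z
    by (simp add: response_def power2_eq_square algebra_simps)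
  have "(\<integral>\<^sup>+z. (response_kernel \<psi> t z)\<^sup>2 \<partial>\<Theta>) = (\<integral>\<^sup>+z. ennreal ((response \<psi> (T - t) z)\<^sup>2) \<partial>\<Theta>)"
    by (rule nn_integral_cong_AE, use law.AE_loss_nonneg in eventually_elim)
       (use assms response_nonneg in \<open>simp add: response_kernel_def ennreal_power\<close>)
  also have "\<dots> = ennreal (\<integral>z. (response \<psi> (T - t) z)\<^sup>2 \<partial>\<Theta>)"
  proof (rule nn_integral_eq_integral)
    show "integrable \<Theta> (\<lambda>z. (response \<psi> (T - t) z)\<^sup>2)" unfolding sq using retention_integrable by simp
  qed simp
  also have "(\<integral>z. (response \<psi> (T - t) z)\<^sup>2 \<partial>\<Theta>) = kernel_square (T - t)"
    unfolding sq kernel_square_def using retention_integrable by (simp; simp add: mult_ac)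
  finally show ?thesis .
qed

lemma expected_quadratic:
  "(\<integral>\<^sup>+\<omega>. quadratic_total (response_kernel \<psi>) {} \<omega> \<partial>Q) = mean_discounted kernel_square"
  unfolding quadratic_total_eq
  by (rule expected_atom_total)
     (use kernel_measurable kernel_square_mean in \<open>auto simp: response_kernel_def\<close>)

lemma moment_products_nonneg: "0 \<le> (\<integral>z. z * \<psi> z \<partial>\<Theta>)" "0 \<le> (\<integral>z. z\<^sup>2 \<partial>\<Theta>)" "0 \<le> (\<integral>z. (\<psi> z)\<^sup>2 \<partial>\<Theta>)"
  using law.AE_loss_nonneg retention_facts(2) by (auto intro!: integral_nonneg_AE elim!: eventually_mono)

lemma mean_kernel_square:
  "mean_discounted kernel_square = ennreal (law.retained_variance (lam0 * mean_factor) (\<Lambda> * (lam0 * gain_factor))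
     (\<Lambda>\<^sup>2 * (\<integral>z. z\<^sup>2 \<partial>\<Theta>) * enn2real (mean_discounted (\<lambda>s. (gain \<kappa> s)\<^sup>2))) \<psi>)"
proof -
  let ?p = "\<integral>z. \<psi> z \<partial>\<Theta>"
  let ?c1 = "2 * \<Lambda> * ?p * (\<integral>z. z * \<psi> z \<partial>\<Theta>)" and ?c2 = "\<Lambda>\<^sup>2 * (\<integral>z. z\<^sup>2 \<partial>\<Theta>) * ?p\<^sup>2"
  have c: "0 \<le> ?c1" "0 \<le> ?c2" "0 \<le> (\<integral>z. (\<psi> z)\<^sup>2 \<partial>\<Theta>)"
    using moment_products_nonneg retention_mean_nonneg excitation_pos by simp_all
  define G2 where "G2 = enn2real (mean_discounted (\<lambda>s. (gain \<kappa> s)\<^sup>2))"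
  have "mean_discounted (\<lambda>s. (gain \<kappa> s)\<^sup>2) < \<top>"
    by (rule mean_discounted_bounded[of _ "T\<^sup>2"]) (use gain_nonneg in \<open>auto intro!: power_mono\<close>)
  then have G2: "mean_discounted (\<lambda>s. (gain \<kappa> s)\<^sup>2) = ennreal G2" "0 \<le> G2" by (simp_all add: G2_def)
  have "mean_discounted kernel_square = mean_discounted (\<lambda>s. (\<integral>z. (\<psi> z)\<^sup>2 \<partial>\<Theta>) * 1)
      + (mean_discounted (\<lambda>s. ?c1 * gain \<kappa> s) + mean_discounted (\<lambda>s. ?c2 * (gain \<kappa> s)\<^sup>2))"
    unfolding kernel_square_def[abs_def] using c gain_nonneg(1)
    by (subst mean_discounted_add[symmetric], (measurable)[2], simp, simp)
       (subst mean_discounted_add[symmetric], auto)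
  also have "\<dots> = ennreal (\<integral>z. (\<psi> z)\<^sup>2 \<partial>\<Theta>) * ennreal (lam0 * mean_factor)
      + (ennreal ?c1 * ennreal (lam0 * gain_factor) + ennreal ?c2 * ennreal G2)"
    using c by (simp only: mean_discounted_cmult mean_discounted_one mean_events mean_gain G2
      gain_measurable borel_measurable_const borel_measurable_power)
  also have "\<dots> = ennreal ((\<integral>z. (\<psi> z)\<^sup>2 \<partial>\<Theta>) * (lam0 * mean_factor)
      + (?c1 * (lam0 * gain_factor) + ?c2 * G2))"
    using c G2 factor_nonneg baseline_pos by (simp add: ennreal_mult'[symmetric] ennreal_plus[symmetric] del: ennreal_plus)
  finally show ?thesis by (simp add: law.retained_variance_def G2_def[symmetric] mult_ac add.assoc)
qed

lemma mean_kernel_square_finite: "mean_discounted kernel_square < \<top>"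
  unfolding mean_kernel_square by simp

lemma aggregate_eq: "proper \<omega> \<Longrightarrow> aggregate \<psi> \<omega> = (\<Sum>i | \<tau> i \<omega> \<le> T. \<psi> (Z i \<omega>))"
  unfolding aggregate_def
  by (subst suminf_until_horizon) (auto simp: retention_facts sum_nonneg)

lemma aggregate_measurable: "aggregate \<psi> \<in> borel_measurable Q"
proof -
  note [measurable] = retention_facts(1)
  show ?thesis unfolding aggregate_def[abs_def] by measurable
qed

lemma response_totals:
  assumes \<omega>: "proper \<omega>"
  defines "S \<equiv> (\<Sum>i | \<tau> i \<omega> \<le> T. \<Lambda> * Z i \<omega> * gain \<kappa> (T - \<tau> i \<omega>))"
  shows "atom_total (response_kernel \<psi>) {} \<omega> = ennreal (aggregate \<psi> \<omega> + (\<integral>z. \<psi> z \<partial>\<Theta>) * S)"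
    "drift_total (response_kernel \<psi>) {} \<omega> = ennreal ((\<integral>z. \<psi> z \<partial>\<Theta>) * (lam0 * mean_factor + S))"
    "0 \<le> S" "0 \<le> aggregate \<psi> \<omega>"
proof -
  let ?p = "\<integral>z. \<psi> z \<partial>\<Theta>"
  have \<omega>': "\<omega> \<in> space Q" using \<omega> by (simp add: proper_def)
  have summand: "0 \<le> \<Lambda> * Z i \<omega> * gain \<kappa> (T - \<tau> i \<omega>)" if "\<tau> i \<omega> \<le> T" for i
    using that mark_nonneg[OF \<omega>'] excitation_pos gain_nonneg(1) by simp
  then show S: "0 \<le> S" unfolding S_def by (intro sum_nonneg) auto
  show "0 \<le> aggregate \<psi> \<omega>" by (simp add: aggregate_def)
  have "atom_total (response_kernel \<psi>) {} \<omega>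
      = (\<Sum>i. if \<tau> i \<omega> \<le> T then ennreal (response \<psi> (T - \<tau> i \<omega>) (Z i \<omega>)) else 0)"
    by (simp add: atom_total_def atom_def active_def response_kernel_def)
  also have "\<dots> = ennreal (\<Sum>i | \<tau> i \<omega> \<le> T. response \<psi> (T - \<tau> i \<omega>) (Z i \<omega>))"
    by (rule suminf_until_horizon[OF \<omega>]) (use mark_nonneg[OF \<omega>'] response_nonneg in auto)
  also have "(\<Sum>i | \<tau> i \<omega> \<le> T. response \<psi> (T - \<tau> i \<omega>) (Z i \<omega>)) = aggregate \<psi> \<omega> + ?p * S"
    unfolding response_def aggregate_eq[OF \<omega>] S_def sum.distrib sum_distrib_left
    by (simp add: mult.assoc)
  finally show "atom_total (response_kernel \<psi>) {} \<omega> = ennreal (aggregate \<psi> \<omega> + ?p * S)" .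
  have "drift (response_kernel \<psi>) {} \<omega> t = (if 0 < t then intens \<omega> t *
      (if t \<le> T then ennreal (?p * (1 + branching * gain \<kappa> (T - t))) else 0) else 0)" for t
  proof (cases "t \<le> T")
    case True
    then show ?thesis using kernel_mean[of t] by (simp add: drift_def active_def)
  next
    case False
    then have "response_kernel \<psi> t = (\<lambda>_. 0)" by (simp add: fun_eq_iff response_kernel_def)
    with False show ?thesis by (simp add: drift_def active_def)
  qed
  then have "drift_total (response_kernel \<psi>) {} \<omega> = discounted (\<lambda>s. ?p * (1 + branching * gain \<kappa> s)) \<omega>"
    by (simp add: drift_total_def discounted_def)
  also have "\<dots> = ennreal ?p * discounted (\<lambda>s. 1 + branching * gain \<kappa> s) \<omega>"
    using retention_mean_nonneg \<omega>' by (intro discounted_cmult) auto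
  also have "discounted (\<lambda>s. 1 + branching * gain \<kappa> s) \<omega> = ennreal (lam0 * mean_factor)
      + (\<Sum>i. if \<tau> i \<omega> \<le> T then ennreal (\<Lambda> * Z i \<omega> * gain \<kappa> (T - \<tau> i \<omega>)) else 0)"
    unfolding mean_factor_def
    by (rule discounted_eq[OF \<omega> gain_equation])
       (use branching_pos gain_nonneg in \<open>auto intro!: continuous_intros add_nonneg_nonneg\<close>)
  also have "\<dots> = ennreal (lam0 * mean_factor + S)"
  proof -
    have "(\<Sum>i. if \<tau> i \<omega> \<le> T then ennreal (\<Lambda> * Z i \<omega> * gain \<kappa> (T - \<tau> i \<omega>)) else 0) = ennreal S"
      unfolding S_def by (rule suminf_until_horizon[OF \<omega> summand])
    then show ?thesis using S factor_nonneg baseline_pos by simp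
  qed
  finally show "drift_total (response_kernel \<psi>) {} \<omega> = ennreal (?p * (lam0 * mean_factor + S))"
    using retention_mean_nonneg S factor_nonneg baseline_pos by (simp add: ennreal_mult)
qed

text \<open>The contributions of the offspring to the two totals cancel, so the compensated sum of responses is the centred
  aggregate.\<close>

lemma compensated_response:
  assumes "proper \<omega>"
  shows "enn2real (atom_total (response_kernel \<psi>) {} \<omega>) - enn2real (drift_total (response_kernel \<psi>) {} \<omega>)
    = aggregate \<psi> \<omega> - (\<integral>z. \<psi> z \<partial>\<Theta>) * (lam0 * mean_factor)"
proof -
  let ?S = "\<Sum>i | \<tau> i \<omega> \<le> T. \<Lambda> * Z i \<omega> * gain \<kappa> (T - \<tau> i \<omega>)"
  note tot = response_totals[OF assms]
  have "enn2real (atom_total (response_kernel \<psi>) {} \<omega>) = aggregate \<psi> \<omega> + (\<integral>z. \<psi> z \<partial>\<Theta>) * ?S"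
    unfolding tot(1) using tot(3,4) retention_mean_nonneg by (intro enn2real_ennreal) simp
  moreover have "enn2real (drift_total (response_kernel \<psi>) {} \<omega>) = (\<integral>z. \<psi> z \<partial>\<Theta>) * (lam0 * mean_factor + ?S)"
    unfolding tot(2) using tot(3) retention_mean_nonneg factor_nonneg baseline_pos
    by (intro enn2real_ennreal mult_nonneg_nonneg add_nonneg_nonneg) auto
  ultimately show ?thesis by (simp add: distrib_left)
qed

lemma expected_aggregate: "(\<integral>\<^sup>+\<omega>. ennreal (aggregate \<psi> \<omega>) \<partial>Q) = ennreal ((\<integral>z. \<psi> z \<partial>\<Theta>) * (lam0 * mean_factor))"
proof -
  let ?h = "\<lambda>t z. if t \<le> T then ennreal (\<psi> z) else 0"
  note [measurable] = retention_facts(1)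
  have "(\<integral>\<^sup>+\<omega>. ennreal (aggregate \<psi> \<omega>) \<partial>Q) = (\<integral>\<^sup>+\<omega>. atom_total ?h {} \<omega> \<partial>Q)"
  proof (rule nn_integral_cong_AE, use AE_proper in eventually_elim)
    case (elim \<omega>)
    have "atom_total ?h {} \<omega> = (\<Sum>i. if \<tau> i \<omega> \<le> T then ennreal (\<psi> (Z i \<omega>)) else 0)"
      by (simp add: atom_total_def atom_def active_def)
    then show ?case unfolding aggregate_eq[OF elim]
      by (simp add: suminf_until_horizon[OF elim] retention_facts)
  qed
  also have "\<dots> = mean_discounted (\<lambda>_. (\<integral>z. \<psi> z \<partial>\<Theta>) * 1)"
  proof (rule expected_atom_total)
    show "(\<lambda>p. ?h (fst p) (snd p)) \<in> borel_measurable (borel \<Otimes>\<^sub>M borel)" by measurable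
    show "(\<integral>\<^sup>+z. ?h t z \<partial>\<Theta>) = ennreal ((\<integral>z. \<psi> z \<partial>\<Theta>) * 1)" if "t \<le> T" for t
      using that retention_integrable(1) retention_facts(2) by (simp add: nn_integral_eq_integral)
  qed auto
  also have "\<dots> = ennreal (\<integral>z. \<psi> z \<partial>\<Theta>) * ennreal (lam0 * mean_factor)"
    using retention_mean_nonneg by (subst mean_discounted_cmult) (auto simp: mean_discounted_one mean_events)
  finally show ?thesis using retention_mean_nonneg factor_nonneg baseline_pos by (simp add: ennreal_mult)
qed

text \<open>Stopped at the event with index \<open>n\<close>, the sum has at most \<open>n + 1\<close> terms, and its square is bounded by a multiple of the sum
  of squares.\<close>

lemma stopped_atom_total_square:
  "(\<integral>\<^sup>+\<omega>. (atom_total (response_kernel \<psi>) {n} \<omega>)\<^sup>2 \<partial>Q) < \<top>"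
proof -
  let ?h = "response_kernel \<psi>"
  note [measurable] = atom_measurable[OF kernel_measurable] atom_total_measurable[OF kernel_measurable]
  have "(\<integral>\<^sup>+\<omega>. (atom_total ?h {n} \<omega>)\<^sup>2 \<partial>Q)
      \<le> (\<integral>\<^sup>+\<omega>. 2 * of_nat (Suc n) * quadratic_total ?h {} \<omega> \<partial>Q)"
  proof (rule nn_integral_mono_AE, use AE_proper in eventually_elim)
    case (elim \<omega>)
    have act: "active {n} (\<tau> i \<omega>, \<omega>) \<longleftrightarrow> i \<le> n" for i
      using proper_pos[OF elim] proper_less_iff[OF elim] by (auto simp: active_def past_def)
    have "atom_total ?h {n} \<omega> = (\<Sum>i\<le>n. atom ?h {n} \<omega> i)"
      unfolding atom_total_def by (rule suminf_finite) (auto simp: atom_def act)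
    also have "\<dots> = (\<Sum>i\<le>n. atom ?h {} \<omega> i)"
      by (intro sum.cong) (simp_all add: atom_def act active_def[of "{}"])
    finally have "(atom_total ?h {n} \<omega>)\<^sup>2 \<le> 2 * of_nat (card {..n}) * (\<Sum>i\<le>n. (atom ?h {} \<omega> i)\<^sup>2)"
      using ennreal_sum_square_le by metis
    also have "\<dots> \<le> 2 * of_nat (Suc n) * quadratic_total ?h {} \<omega>"
      unfolding quadratic_total_def card_atMost
      by (intro mult_left_mono sum_le_suminf) auto
    finally show ?case .
  qed
  also have "\<dots> = 2 * of_nat (Suc n) * mean_discounted kernel_square"
    unfolding expected_quadratic[symmetric] quadratic_total_def
    by (rule nn_integral_cmult) measurable
  also have "\<dots> < \<top>" using mean_kernel_square_finite by (simp add: ennreal_mult_less_top of_nat_less_top)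
  finally show ?thesis .
qed

end

definition full_loss :: "real \<Rightarrow> real" where "full_loss z = max z 0"

lemma retention_full: "retention full_loss"
  by (auto simp: retention_def full_loss_def[abs_def])

lemma mean_full: "(\<integral>z. full_loss z \<partial>\<Theta>) = mean_loss"
  unfolding mean_loss_def
  by (intro Bochner_Integration.integral_cong refl) (simp add: full_loss_def law.space_loss)

text \<open>Until the event with index \<open>n\<close>, the intensity is at most the baseline plus \<open>\<Lambda>\<close> times the stopped sum of responses, which includes the
  losses themselves.\<close>

lemma stopped_drift_total_square:
  "(\<integral>\<^sup>+\<omega>. (drift_total (response_kernel full_loss) {n} \<omega>)\<^sup>2 \<partial>Q) < \<top>"
proof -
  let ?h = "response_kernel full_loss" and ?\<Lambda> = "ennreal \<Lambda>"
  \<comment> \<open>A bound for the mean response, as \<open>gain\<close> is at most the remaining time.\<close>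
  define C where "C = mean_loss * (1 + branching * T)"
  define c where "c = ennreal C * ennreal T"
  note [measurable] = atom_total_measurable[OF kernel_measurable[OF retention_full]]
  have drift_le: "drift_total ?h {n} \<omega> \<le> c * (ennreal lam0 + ?\<Lambda> * atom_total ?h {n} \<omega>)"
    if \<omega>: "proper \<omega>" for \<omega>
  proof -
    have \<omega>': "\<omega> \<in> space Q" using \<omega> by (simp add: proper_def)
    have intens_le: "intens \<omega> t \<le> ennreal lam0 + ?\<Lambda> * atom_total ?h {n} \<omega>"
      if t: "t \<le> T" "active {n} (t, \<omega>)" for t
    proof -
      have "(if past i (t, \<omega>) then ennreal (\<Lambda> * Z i \<omega> * exp (- \<beta> * (t - \<tau> i \<omega>))) else 0)
          \<le> ?\<Lambda> * atom ?h {n} \<omega> i" for i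
      proof (cases "past i (t, \<omega>)")
        case True
        then have i: "\<tau> i \<omega> < t" "\<tau> i \<omega> \<le> T" "\<tau> i \<omega> \<le> \<tau> n \<omega>" using t by (auto simp: past_def active_def)
        have z: "0 \<le> Z i \<omega>" by (rule mark_nonneg[OF \<omega>'])
        have "\<Lambda> * Z i \<omega> * exp (- \<beta> * (t - \<tau> i \<omega>)) \<le> \<Lambda> * Z i \<omega> * 1"
          using i z excitation_pos decay_pos by (intro mult_left_mono) auto
        also have "\<dots> \<le> \<Lambda> * response full_loss (T - \<tau> i \<omega>) (Z i \<omega>)"
          using i z excitation_pos mean_full mean_loss_pos gain_nonneg(1)[of "T - \<tau> i \<omega>"]
          by (simp add: response_def full_loss_def)
        finally have "ennreal (\<Lambda> * Z i \<omega> * exp (- \<beta> * (t - \<tau> i \<omega>)))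
            \<le> ennreal (\<Lambda> * response full_loss (T - \<tau> i \<omega>) (Z i \<omega>))"
          by (rule ennreal_leI)
        also have "\<dots> = ?\<Lambda> * atom ?h {n} \<omega> i"
          using i excitation_pos by (simp add: atom_def active_def past_def response_kernel_def ennreal_mult')
        finally show ?thesis using True by simp
      qed simp
      then show ?thesis
        unfolding intens_def atom_total_def ennreal_suminf_cmult[symmetric]
        by (intro add_left_mono suminf_le) auto
    qed
    have "drift_total ?h {n} \<omega> \<le> (\<integral>\<^sup>+t. (ennreal lam0 + ?\<Lambda> * atom_total ?h {n} \<omega>) * ennreal C * indicator {0<..T} t \<partial>lborel)"
      unfolding drift_total_def
    proof (rule nn_integral_mono)
      fix t
      show "drift ?h {n} \<omega> t \<le> (ennreal lam0 + ?\<Lambda> * atom_total ?h {n} \<omega>) * ennreal C * indicator {0<..T} t"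
      proof (cases "0 < t \<and> t \<le> T \<and> active {n} (t, \<omega>)")
        case True
        have "mean_loss * (1 + branching * gain \<kappa> (T - t)) \<le> C"
          unfolding C_def using True mean_loss_pos branching_pos gain_nonneg(3)[of "T - t"]
          by (intro mult_left_mono add_left_mono) auto
        then have "(\<integral>\<^sup>+z. ?h t z \<partial>\<Theta>) \<le> ennreal C"
          using True by (subst kernel_mean[OF retention_full]) (auto simp: mean_full intro: ennreal_leI)
        then show ?thesis using True intens_le[of t] by (simp add: drift_def mult_mono)
      next
        case False
        then have "t \<le> 0 \<or> \<not> active {n} (t, \<omega>) \<or> ?h t = (\<lambda>_. 0)"
          by (auto simp: response_kernel_def fun_eq_iff)
        then show ?thesis by (auto simp: drift_def)
      qed
    qed
    also have "\<dots> = (ennreal lam0 + ?\<Lambda> * atom_total ?h {n} \<omega>) * ennreal C * ennreal T"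
      using horizon_pos by (simp add: nn_integral_cmult)
    finally show ?thesis by (simp add: c_def mult_ac)
  qed
  have "(\<integral>\<^sup>+\<omega>. (drift_total ?h {n} \<omega>)\<^sup>2 \<partial>Q)
      \<le> (\<integral>\<^sup>+\<omega>. c\<^sup>2 * (4 * ((ennreal lam0)\<^sup>2 + ?\<Lambda>\<^sup>2 * (atom_total ?h {n} \<omega>)\<^sup>2)) \<partial>Q)"
  proof (rule nn_integral_mono_AE, use AE_proper in eventually_elim)
    case (elim \<omega>)
    have "(drift_total ?h {n} \<omega>)\<^sup>2 \<le> (c * (ennreal lam0 + ?\<Lambda> * atom_total ?h {n} \<omega>))\<^sup>2"
      by (rule power_mono[OF drift_le[OF elim]]) simp
    also have "\<dots> = c\<^sup>2 * (ennreal lam0 + ?\<Lambda> * atom_total ?h {n} \<omega>)\<^sup>2" by (rule power_mult_distrib)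
    also have "\<dots> \<le> c\<^sup>2 * (4 * ((ennreal lam0)\<^sup>2 + (?\<Lambda> * atom_total ?h {n} \<omega>)\<^sup>2))"
      by (intro mult_left_mono ennreal_square_add_le) simp
    finally show ?case by (simp add: power_mult_distrib)
  qed
  also have "\<dots> = c\<^sup>2 * (4 * ((ennreal lam0)\<^sup>2 + ?\<Lambda>\<^sup>2 * (\<integral>\<^sup>+\<omega>. (atom_total ?h {n} \<omega>)\<^sup>2 \<partial>Q)))"
    by (simp add: nn_integral_cmult nn_integral_add emeasure_space_1)
  also have "\<dots> < \<top>"
    using stopped_atom_total_square[OF retention_full, of n]
    by (simp add: c_def ennreal_mult_less_top power2_eq_square)
  finally show ?thesis .
qed

text \<open>The second moments of the stopped compensated sums are bounded by the expected quadratic total of the unstopped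
  process, uniformly in the stopping index. In almost every scenario the sums are eventually the centred aggregate, and
  Fatou's lemma applies.\<close>

lemma aggregate_full_square: "(\<integral>\<^sup>+\<omega>. ennreal ((aggregate full_loss \<omega>)\<^sup>2) \<partial>Q) < \<top>"
proof -
  let ?h = "response_kernel full_loss"
  let ?X = "\<lambda>n \<omega>. ennreal ((enn2real (atom_total ?h {n} \<omega>) - enn2real (drift_total ?h {n} \<omega>))\<^sup>2)"
  note h = kernel_measurable[OF retention_full]
  note [measurable] = atom_total_measurable[OF h] drift_total_measurable[OF h] aggregate_measurable[OF retention_full]
  define m where "m = mean_loss * (lam0 * mean_factor)"
  let ?V = "mean_discounted (kernel_square full_loss)"
  have bound: "(\<integral>\<^sup>+\<omega>. ?X n \<omega> \<partial>Q) \<le> ?V" for n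
  proof -
    have "(\<integral>\<^sup>+\<omega>. ?X n \<omega> \<partial>Q) = (\<integral>\<^sup>+\<omega>. quadratic_total ?h {n} \<omega> \<partial>Q)"
      by (rule square_integral_of_polarised)
         (use stopped_atom_total_square[OF retention_full] stopped_drift_total_square
            compensated_isometry[OF h] in simp_all)
    also have "\<dots> \<le> (\<integral>\<^sup>+\<omega>. quadratic_total ?h {} \<omega> \<partial>Q)"
      unfolding quadratic_total_def
      by (intro nn_integral_mono suminf_le) (auto simp: atom_def active_def)
    finally show ?thesis unfolding expected_quadratic[OF retention_full] .
  qed
  have lim: "AE \<omega> in Q. ennreal ((aggregate full_loss \<omega> - m)\<^sup>2) = liminf (\<lambda>n. ?X n \<omega>)"
    using AE_proper
  proof eventually_elim
    case (elim \<omega>)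
    have "\<forall>\<^sub>F n in sequentially. T < \<tau> n \<omega>" using elim by (auto simp: proper_def filterlim_at_top_dense)
    then have "\<forall>\<^sub>F n in sequentially. ?X n \<omega> = ennreal ((aggregate full_loss \<omega> - m)\<^sup>2)"
    proof eventually_elim
      case (elim n)
      have act: "t \<le> T \<Longrightarrow> active {n} (t, \<omega>)" for t using elim by (auto simp: active_def past_def)
      have kernel_0: "?h t = (\<lambda>_. 0)" if "T < t" for t using that by (simp add: response_kernel_def fun_eq_iff)
      have "atom ?h {n} \<omega> i = atom ?h {} \<omega> i" for i
        using act[of "\<tau> i \<omega>"] kernel_0[of "\<tau> i \<omega>"]
        by (cases "\<tau> i \<omega> \<le> T") (auto simp: atom_def active_def)
      moreover have "drift ?h {n} \<omega> t = drift ?h {} \<omega> t" for t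
        using act[of t] kernel_0[of t] by (cases "t \<le> T") (auto simp: drift_def active_def)
      ultimately have "atom_total ?h {n} \<omega> = atom_total ?h {} \<omega>" "drift_total ?h {n} \<omega> = drift_total ?h {} \<omega>"
        by (simp_all add: atom_total_def drift_total_def)
      then show ?case
        using compensated_response[OF retention_full \<open>proper \<omega>\<close>] by (simp add: mean_full m_def)
    qed
    then have "(\<lambda>n. ?X n \<omega>) \<longlonglongrightarrow> ennreal ((aggregate full_loss \<omega> - m)\<^sup>2)" by (rule tendsto_eventually)
    then show ?case by (intro lim_imp_Liminf[symmetric]) auto
  qed
  have "(\<integral>\<^sup>+\<omega>. ennreal ((aggregate full_loss \<omega> - m)\<^sup>2) \<partial>Q) = (\<integral>\<^sup>+\<omega>. liminf (\<lambda>n. ?X n \<omega>) \<partial>Q)"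
    by (rule nn_integral_cong_AE[OF lim])
  also have "\<dots> \<le> liminf (\<lambda>n. \<integral>\<^sup>+\<omega>. ?X n \<omega> \<partial>Q)" by (rule nn_integral_liminf) measurable
  also have "\<dots> \<le> liminf (\<lambda>n. ?V)" by (intro Liminf_mono always_eventually allI bound)
  also have "\<dots> = ?V" by (simp add: Liminf_const)
  finally have fin: "(\<integral>\<^sup>+\<omega>. ennreal ((aggregate full_loss \<omega> - m)\<^sup>2) \<partial>Q) < \<top>"
    using mean_kernel_square_finite[OF retention_full] by (rule le_less_trans)
  have "(\<integral>\<^sup>+\<omega>. ennreal ((aggregate full_loss \<omega>)\<^sup>2) \<partial>Q)
      \<le> (\<integral>\<^sup>+\<omega>. 2 * ennreal ((aggregate full_loss \<omega> - m)\<^sup>2) + ennreal (2 * m\<^sup>2) \<partial>Q)"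
  proof (rule nn_integral_mono)
    fix \<omega>
    have "0 \<le> (aggregate full_loss \<omega> - 2 * m)\<^sup>2" by simp
    then have "(aggregate full_loss \<omega>)\<^sup>2 \<le> 2 * (aggregate full_loss \<omega> - m)\<^sup>2 + 2 * m\<^sup>2"
      by (simp add: power2_eq_square algebra_simps)
    then have "ennreal ((aggregate full_loss \<omega>)\<^sup>2) \<le> ennreal (2 * (aggregate full_loss \<omega> - m)\<^sup>2 + 2 * m\<^sup>2)"
      by (rule ennreal_leI)
    then show "ennreal ((aggregate full_loss \<omega>)\<^sup>2)
        \<le> 2 * ennreal ((aggregate full_loss \<omega> - m)\<^sup>2) + ennreal (2 * m\<^sup>2)"
      by (simp add: ennreal_mult)
  qed
  also have "\<dots> = 2 * (\<integral>\<^sup>+\<omega>. ennreal ((aggregate full_loss \<omega> - m)\<^sup>2) \<partial>Q) + ennreal (2 * m\<^sup>2)"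
    by (simp add: nn_integral_add nn_integral_cmult emeasure_space_1)
  also have "\<dots> < \<top>" using fin by (simp add: ennreal_mult_less_top)
  finally show ?thesis .
qed

text \<open>The total loss has a finite second moment and dominates both totals up to constants, so the isometry
  applies with \<open>J\<close> empty.\<close>

lemma aggregate_variance:
  assumes \<psi>: "retention \<psi>"
  defines "m \<equiv> (\<integral>z. \<psi> z \<partial>\<Theta>) * (lam0 * mean_factor)"
  shows "(\<integral>\<^sup>+\<omega>. ennreal ((aggregate \<psi> \<omega> - m)\<^sup>2) \<partial>Q) = mean_discounted (kernel_square \<psi>)"
proof -
  let ?h = "response_kernel \<psi>" and ?p = "\<integral>z. \<psi> z \<partial>\<Theta>"
  note h = kernel_measurable[OF \<psi>]
  note [measurable] = atom_total_measurable[OF h] drift_total_measurable[OF h]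
    aggregate_measurable[OF retention_full]
  \<comment> \<open>Each response to a mark is at most \<open>c\<close> times the mark.\<close>
  define c where "c = 1 + ?p * \<Lambda> * T"
  have p: "0 \<le> ?p" by (rule retention_mean_nonneg[OF \<psi>])
  have c: "0 \<le> c" unfolding c_def using p excitation_pos horizon_pos by simp
  have m: "0 \<le> m" unfolding m_def using p factor_nonneg baseline_pos by simp
  have dom: "atom_total ?h {} \<omega> \<le> ennreal (c * aggregate full_loss \<omega>)"
    "drift_total ?h {} \<omega> \<le> ennreal (c * aggregate full_loss \<omega>) + ennreal m"
    if \<omega>: "proper \<omega>" for \<omega>
  proof -
    have \<omega>': "\<omega> \<in> space Q" using \<omega> by (simp add: proper_def)
    let ?S = "\<Sum>i | \<tau> i \<omega> \<le> T. \<Lambda> * Z i \<omega> * gain \<kappa> (T - \<tau> i \<omega>)"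
    note tot = response_totals[OF \<psi> \<omega>]
    have "aggregate \<psi> \<omega> + ?p * ?S = (\<Sum>i | \<tau> i \<omega> \<le> T. response \<psi> (T - \<tau> i \<omega>) (Z i \<omega>))"
      unfolding response_def aggregate_eq[OF \<psi> \<omega>] sum.distrib sum_distrib_left
      by (simp add: mult.assoc)
    also have "\<dots> \<le> (\<Sum>i | \<tau> i \<omega> \<le> T. c * full_loss (Z i \<omega>))"
    proof (rule sum_mono)
      fix i assume i: "i \<in> {i. \<tau> i \<omega> \<le> T}"
      have z: "0 \<le> Z i \<omega>" by (rule mark_nonneg[OF \<omega>'])
      have "?p * \<Lambda> * Z i \<omega> * gain \<kappa> (T - \<tau> i \<omega>) \<le> ?p * \<Lambda> * Z i \<omega> * T"
        using i z p excitation_pos proper_pos[OF \<omega>, of i]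
        by (intro mult_left_mono gain_nonneg(3)) auto
      then show "response \<psi> (T - \<tau> i \<omega>) (Z i \<omega>) \<le> c * full_loss (Z i \<omega>)"
        using retention_facts(3)[OF \<psi> z] z by (simp add: response_def c_def full_loss_def algebra_simps)
    qed
    also have "\<dots> = c * aggregate full_loss \<omega>"
      by (simp add: aggregate_eq[OF retention_full \<omega>] sum_distrib_left)
    finally have le: "aggregate \<psi> \<omega> + ?p * ?S \<le> c * aggregate full_loss \<omega>" .
    then show "atom_total ?h {} \<omega> \<le> ennreal (c * aggregate full_loss \<omega>)"
      unfolding tot(1) by (rule ennreal_leI)
    have "?p * (lam0 * mean_factor + ?S) \<le> c * aggregate full_loss \<omega> + m"
      using le tot(4) by (simp add: m_def distrib_left)
    then have "ennreal (?p * (lam0 * mean_factor + ?S)) \<le> ennreal (c * aggregate full_loss \<omega> + m)"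
      by (rule ennreal_leI)
    then show "drift_total ?h {} \<omega> \<le> ennreal (c * aggregate full_loss \<omega>) + ennreal m"
      unfolding tot(2) using m c response_totals(4)[OF retention_full \<omega>] by simp
  qed
  let ?L2 = "\<integral>\<^sup>+\<omega>. (ennreal (c * aggregate full_loss \<omega>))\<^sup>2 \<partial>Q"
  have "?L2 = (\<integral>\<^sup>+\<omega>. ennreal (c\<^sup>2) * ennreal ((aggregate full_loss \<omega>)\<^sup>2) \<partial>Q)"
    using c by (intro nn_integral_cong)
      (simp add: aggregate_def ennreal_power power_mult_distrib ennreal_mult)
  also have "\<dots> < \<top>" using aggregate_full_square by (simp add: nn_integral_cmult ennreal_mult_less_top)
  finally have L2: "?L2 < \<top>" .
  have "(\<integral>\<^sup>+\<omega>. (atom_total ?h {} \<omega>)\<^sup>2 \<partial>Q) \<le> ?L2"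
    by (rule nn_integral_mono_AE, use AE_proper in eventually_elim) (intro power_mono dom, auto)
  then have finA: "(\<integral>\<^sup>+\<omega>. (atom_total ?h {} \<omega>)\<^sup>2 \<partial>Q) < \<top>" using L2 by (rule le_less_trans)
  have "(\<integral>\<^sup>+\<omega>. (drift_total ?h {} \<omega>)\<^sup>2 \<partial>Q)
      \<le> (\<integral>\<^sup>+\<omega>. 4 * ((ennreal (c * aggregate full_loss \<omega>))\<^sup>2 + (ennreal m)\<^sup>2) \<partial>Q)"
  proof (rule nn_integral_mono_AE, use AE_proper in eventually_elim)
    case (elim \<omega>)
    have "(drift_total ?h {} \<omega>)\<^sup>2 \<le> (ennreal (c * aggregate full_loss \<omega>) + ennreal m)\<^sup>2"
      by (intro power_mono dom elim) auto
    then show ?case using ennreal_square_add_le by (rule order_trans)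
  qed
  also have "\<dots> = 4 * (?L2 + (ennreal m)\<^sup>2)"
    by (simp add: nn_integral_cmult nn_integral_add emeasure_space_1)
  also have "\<dots> < \<top>" using L2 by (simp add: ennreal_mult_less_top power2_eq_square)
  finally have finB: "(\<integral>\<^sup>+\<omega>. (drift_total ?h {} \<omega>)\<^sup>2 \<partial>Q) < \<top>" .
  have "(\<integral>\<^sup>+\<omega>. ennreal ((aggregate \<psi> \<omega> - m)\<^sup>2) \<partial>Q)
      = (\<integral>\<^sup>+\<omega>. ennreal ((enn2real (atom_total ?h {} \<omega>) - enn2real (drift_total ?h {} \<omega>))\<^sup>2) \<partial>Q)"
    by (rule nn_integral_cong_AE, use AE_proper in eventually_elim) (simp add: compensated_response[OF \<psi>] m_def)
  also have "\<dots> = (\<integral>\<^sup>+\<omega>. quadratic_total ?h {} \<omega> \<partial>Q)"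
    by (rule square_integral_of_polarised) (use finA finB compensated_isometry[OF h] in simp_all)
  finally show ?thesis unfolding expected_quadratic[OF \<psi>] .
qed

end

context linear_hawkes_horizon
begin

section \<open>Mean and variance of the wealth\<close>

text \<open>The expected number of marks in a null set of \<open>\<Theta>\<close> is \<open>0\<close>, by the compensator.\<close>

lemma AE_marks:
  assumes "AE z in \<Theta>. P z"
  shows "AE \<omega> in Q. \<forall>i. P (Z i \<omega>)"
proof -
  obtain N where N: "N \<in> null_sets \<Theta>" "{z \<in> space \<Theta>. \<not> P z} \<subseteq> N"
    using assms by (auto simp: eventually_ae_filter)
  have [measurable]: "N \<in> sets borel_nonneg" using N by (auto simp: law.sets_loss)
  let ?W = "\<lambda>p. indicator N (snd p) :: ennreal"
  have "?W \<in> borel_measurable (predictable Q F \<Otimes>\<^sub>M borel_nonneg)" by measurable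
  from compensator_explicit[OF this]
  have "(\<integral>\<^sup>+\<omega>. (\<Sum>i. indicator N (Z i \<omega>)) \<partial>Q) = (\<integral>\<^sup>+\<omega>. (\<integral>\<^sup>+t. (if 0 < t then intens \<omega> t *
      (\<integral>\<^sup>+z. indicator N z \<partial>\<Theta>) else 0) \<partial>lborel) \<partial>Q)"
    by (simp only: snd_conv)
  also have "(\<integral>\<^sup>+z. indicator N z \<partial>\<Theta>) = 0" using N by auto
  finally have "(\<integral>\<^sup>+\<omega>. (\<Sum>i. indicator N (Z i \<omega>)) \<partial>Q) = 0" by (simp cong: if_cong)
  moreover have [measurable]: "Z i \<in> Q \<rightarrow>\<^sub>M borel_nonneg" for i
    by (rule measurable_pre_sigma_Q[OF marks_measurable])
  ultimately have "AE \<omega> in Q. (\<Sum>i. indicator N (Z i \<omega>)) = (0 :: ennreal)"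
    by (subst (asm) nn_integral_0_iff_AE) auto
  then show ?thesis using AE_space
  proof eventually_elim
    case (elim \<omega>)
    have "indicator N (Z i \<omega>) \<le> (\<Sum>i. indicator N (Z i \<omega>) :: ennreal)" for i
      using sum_le_suminf[of "\<lambda>i. indicator N (Z i \<omega>) :: ennreal" "{i}"] by simp
    then have "Z i \<omega> \<notin> N" for i using elim(1) by (auto simp: indicator_def split: if_splits)
    then show ?case using N(2) mark_nonneg[OF elim(2)] by (auto simp: law.space_loss)
  qed
qed

lemma contract_retention:
  assumes \<phi>: "\<phi> \<in> contracts \<Theta>"
  obtains \<psi> where "retention \<psi>" "AE z in \<Theta>. z - \<phi> z = \<psi> z"
proof
  let ?\<psi> = "\<lambda>z. max 0 (min z (z - indicator {0..} z *\<^sub>R \<phi> z))"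
  have "\<phi> \<in> borel_measurable (restrict_space borel {0..})"
    using \<phi> by (simp add: law.contracts_iff law.measurable_loss)
  then have [measurable]: "(\<lambda>z. indicator {0..} z *\<^sub>R \<phi> z) \<in> borel_measurable borel"
    by (subst (asm) borel_measurable_restrict_space_iff) auto
  have "?\<psi> \<in> borel_measurable borel" by measurable
  then show "retention ?\<psi>" by (auto simp: retention_def)
  have "AE z in \<Theta>. 0 \<le> \<phi> z \<and> \<phi> z \<le> z" using \<phi> by (simp add: law.contracts_iff)
  then show "AE z in \<Theta>. z - \<phi> z = ?\<psi> z"
    using law.AE_loss_nonneg by eventually_elim auto
qed

lemma wealth_eq_aggregate:
  assumes \<phi>: "\<phi> \<in> contracts \<Theta>" and \<psi>: "retention \<psi>" "AE z in \<Theta>. z - \<phi> z = \<psi> z"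
  shows "AE \<omega> in Q. wealth \<tau> Z \<Theta> R0 \<rho> c \<phi> T \<omega>
    = R0 + \<rho> * mean_loss * T - c * T * (\<integral>z. \<phi> z \<partial>\<Theta>) - aggregate \<psi> \<omega>"
  using AE_proper AE_marks[OF \<psi>(2)]
proof eventually_elim
  case (elim \<omega>)
  have "(\<lambda>z. \<phi> z - z) \<in> borel_measurable borel_nonneg"
    using \<phi> unfolding law.contracts_iff law.measurable_loss by (intro borel_measurable_diff) auto
  moreover have S: "{i. \<tau> i \<omega> \<in> {0<..T}} = {i. \<tau> i \<omega> \<le> T}" using proper_pos[OF elim(1)] by auto
  ultimately have "(\<integral>p\<in>{0<..T} \<times> {0..}. (\<phi> (snd p) - snd p) \<partial>counting_measure \<tau> Z \<omega>)
      = (\<Sum>i | \<tau> i \<omega> \<le> T. \<phi> (Z i \<omega>) - Z i \<omega>)"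
    using counting_integral[OF elim(1), of "\<lambda>z. \<phi> z - z" "{0<..T}"] proper_finite[OF elim(1)] by simp
  also have "\<dots> = (\<Sum>i | \<tau> i \<omega> \<le> T. - \<psi> (Z i \<omega>))"
  proof (rule sum.cong[OF refl])
    fix i
    have "Z i \<omega> - \<phi> (Z i \<omega>) = \<psi> (Z i \<omega>)" using elim(2) by blast
    then show "\<phi> (Z i \<omega>) - Z i \<omega> = - \<psi> (Z i \<omega>)" by linarith
  qed
  also have "\<dots> = - aggregate \<psi> \<omega>" by (simp add: aggregate_eq[OF \<psi>(1) elim(1)] sum_negf)
  finally show ?case by (simp add: wealth_def mean_loss_def)
qed

lemma mean_variance_wealth:
  assumes \<phi>: "\<phi> \<in> contracts \<Theta>"
  shows "mean_variance Q \<gamma> (wealth \<tau> Z \<Theta> R0 \<rho> c \<phi> T)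
    = R0 + \<rho> * mean_loss * T - c * T * mean_loss
      + ((c * T - lam0 * mean_factor) * (\<integral>z. z - \<phi> z \<partial>\<Theta>)
      - \<gamma> * law.retained_variance (lam0 * mean_factor) (\<Lambda> * (lam0 * gain_factor))
        (\<Lambda>\<^sup>2 * (\<integral>z. z\<^sup>2 \<partial>\<Theta>) * enn2real (mean_discounted (\<lambda>s. (gain \<kappa> s)\<^sup>2))) (\<lambda>z. z - \<phi> z))"
proof -
  obtain \<psi> where \<psi>: "retention \<psi>" "AE z in \<Theta>. z - \<phi> z = \<psi> z" by (rule contract_retention[OF \<phi>])
  let ?X = "wealth \<tau> Z \<Theta> R0 \<rho> c \<phi> T"
  let ?V = "law.retained_variance (lam0 * mean_factor) (\<Lambda> * (lam0 * gain_factor))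
        (\<Lambda>\<^sup>2 * (\<integral>z. z\<^sup>2 \<partial>\<Theta>) * enn2real (mean_discounted (\<lambda>s. (gain \<kappa> s)\<^sup>2)))"
  define d where "d = R0 + \<rho> * mean_loss * T - c * T * (\<integral>z. \<phi> z \<partial>\<Theta>)"
  define m where "m = (\<integral>z. \<psi> z \<partial>\<Theta>) * (lam0 * mean_factor)"
  have agg_meas [measurable]: "aggregate \<psi> \<in> borel_measurable Q" by (rule aggregate_measurable[OF \<psi>(1)])
  have X: "AE \<omega> in Q. ?X \<omega> = d - aggregate \<psi> \<omega>"
    unfolding d_def by (rule wealth_eq_aggregate[OF \<phi> \<psi>])
  have X_meas [measurable]: "?X \<in> borel_measurable Q"
    by (rule complete_measure.borel_measurable_AE_eq[OF Q_complete _ X]) measurable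
  have m: "0 \<le> m"
    unfolding m_def using retention_mean_nonneg[OF \<psi>(1)] factor_nonneg baseline_pos by simp
  have agg: "(\<integral>\<^sup>+\<omega>. ennreal (aggregate \<psi> \<omega>) \<partial>Q) = ennreal m"
    unfolding m_def by (rule expected_aggregate[OF \<psi>(1)])
  have "integrable Q (aggregate \<psi>)"
    by (rule integrableI_nonneg) (use agg in \<open>auto simp: aggregate_def\<close>)
  moreover have "(\<integral>\<omega>. aggregate \<psi> \<omega> \<partial>Q) = m"
    using agg m by (subst integral_eq_nn_integral) (auto simp: aggregate_def)
  moreover have "(\<integral>\<omega>. ?X \<omega> \<partial>Q) = (\<integral>\<omega>. d - aggregate \<psi> \<omega> \<partial>Q)"
    by (intro integral_cong_AE X) measurable
  ultimately have EX: "(\<integral>\<omega>. ?X \<omega> \<partial>Q) = d - m" by (simp add: prob_space)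
  have "(\<integral>\<omega>. (?X \<omega> - (d - m))\<^sup>2 \<partial>Q) = (\<integral>\<omega>. (aggregate \<psi> \<omega> - m)\<^sup>2 \<partial>Q)"
  proof (rule integral_cong_AE)
    show "AE \<omega> in Q. (?X \<omega> - (d - m))\<^sup>2 = (aggregate \<psi> \<omega> - m)\<^sup>2"
      using X by eventually_elim (simp add: power2_commute[of m])
  qed (intro borel_measurable_power borel_measurable_diff borel_measurable_const X_meas agg_meas)+
  also have "\<dots> = enn2real (\<integral>\<^sup>+\<omega>. ennreal ((aggregate \<psi> \<omega> - m)\<^sup>2) \<partial>Q)"
    by (rule integral_eq_nn_integral) auto
  also have "\<dots> = ?V \<psi>"
    unfolding m_def aggregate_variance[OF \<psi>(1)] mean_kernel_square[OF \<psi>(1)]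
    using moment_products_nonneg[OF \<psi>(1)] retention_mean_nonneg[OF \<psi>(1)] factor_nonneg baseline_pos excitation_pos
    by (intro enn2real_ennreal) (simp add: law.retained_variance_def)
  finally have VX: "(\<integral>\<omega>. (?X \<omega> - (d - m))\<^sup>2 \<partial>Q) = ?V \<psi>" .
  have int: "integrable \<Theta> \<phi>" by (rule law.integrable_contract[OF \<phi>])
  have ret: "(\<lambda>z. z - \<phi> z) \<in> borel_measurable \<Theta>" "\<psi> \<in> borel_measurable \<Theta>"
    using law.uncovered_contract[OF \<phi>] retention_contract[OF \<psi>(1)] by (auto simp: law.contracts_iff)
  have id: "(\<lambda>z. z) \<in> borel_measurable \<Theta>" by (rule mark_to_real)
  have H: "(\<integral>z. \<psi> z \<partial>\<Theta>) = (\<integral>z. z - \<phi> z \<partial>\<Theta>)"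
    "(\<integral>z. z * \<psi> z \<partial>\<Theta>) = (\<integral>z. z * (z - \<phi> z) \<partial>\<Theta>)"
    "(\<integral>z. (\<psi> z)\<^sup>2 \<partial>\<Theta>) = (\<integral>z. (z - \<phi> z)\<^sup>2 \<partial>\<Theta>)"
    by (rule integral_cong_AE; (intro borel_measurable_times borel_measurable_power id ret)?;
        use \<psi>(2) in eventually_elim, simp)+
  have "mean_variance Q \<gamma> ?X = (d - m) - \<gamma> * ?V \<psi>"
    unfolding mean_variance_def EX VX ..
  also have "?V \<psi> = ?V (\<lambda>z. z - \<phi> z)" by (simp only: law.retained_variance_def H)
  also have "d - m = R0 + \<rho> * mean_loss * T - c * T * mean_loss
      + (c * T - lam0 * mean_factor) * (\<integral>z. z - \<phi> z \<partial>\<Theta>)"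
    unfolding d_def m_def H(1) using int by (simp add: mean_loss_def algebra_simps)
  finally show ?thesis by simp
qed

text \<open>The optimality of \<open>\<phi>\<close> in terms of the loss distribution alone. In the formula for \<open>k\<close> the baseline intensity cancels, which
  leaves the retained share of the mean loss times the branching ratio.\<close>

lemma optimal_contract_cover:
  assumes \<gamma>: "0 < \<gamma>" and loading: "0 < c * T - expected_intensity Q lam T"
    and opt: "optimal_contract Q \<tau> Z \<Theta> R0 \<rho> c \<gamma> T \<phi>"
  shows "\<phi> \<in> contracts \<Theta>" "(\<integral>z. \<phi> z \<partial>\<Theta>) < mean_loss"
    "\<exists>a\<ge>0. AE z in \<Theta>. \<phi> z
      = cover ((1 - (\<integral>z. \<phi> z \<partial>\<Theta>) / mean_loss) * branching_ratio \<beta> T branching) a z"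
proof -
  let ?M = "lam0 * mean_factor" and ?G = "\<Lambda> * (lam0 * gain_factor)"
    and ?W = "\<Lambda>\<^sup>2 * (\<integral>z. z\<^sup>2 \<partial>\<Theta>) * enn2real (mean_discounted (\<lambda>s. (gain \<kappa> s)\<^sup>2))"
  show \<phi>: "\<phi> \<in> contracts \<Theta>" using opt by (simp add: optimal_contract_def is_arg_max_def)
  have M: "0 < ?M" using mean_events_pos mean_events by simp
  have best: "(c * T - ?M) * (\<integral>z. z - h z \<partial>\<Theta>) - \<gamma> * law.retained_variance ?M ?G ?W (\<lambda>z. z - h z)
      \<le> (c * T - ?M) * (\<integral>z. z - \<phi> z \<partial>\<Theta>) - \<gamma> * law.retained_variance ?M ?G ?W (\<lambda>z. z - \<phi> z)"
    if h: "h \<in> contracts \<Theta>" for h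
  proof -
    have "mean_variance Q \<gamma> (wealth \<tau> Z \<Theta> R0 \<rho> c h T) \<le> mean_variance Q \<gamma> (wealth \<tau> Z \<Theta> R0 \<rho> c \<phi> T)"
      using opt h by (auto simp: optimal_contract_def is_arg_max_def not_less)
    then show ?thesis unfolding mean_variance_wealth[OF h] mean_variance_wealth[OF \<phi>] by simp
  qed
  have l: "0 < c * T - ?M" using loading mean_events by simp
  have G: "0 \<le> ?G" using excitation_pos baseline_pos factor_nonneg by simp
  note cover = law.optimal_cover[OF M \<gamma> l G \<phi> best]
  show "(\<integral>z. \<phi> z \<partial>\<Theta>) < mean_loss" using cover(1) by (simp add: mean_loss_def)
  have ratio: "branching_ratio \<beta> T branching = branching * gain_factor / mean_factor"
    by (simp add: branching_ratio_def gain_factor_def mean_factor_def \<kappa>_def)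
  have "(1 - (\<integral>z. \<phi> z \<partial>\<Theta>) / mean_loss) * branching_ratio \<beta> T branching
      = ?G * ((\<integral>z. z \<partial>\<Theta>) - (\<integral>z. \<phi> z \<partial>\<Theta>)) / ?M"
  proof -
    have "mean_factor \<noteq> 0" "lam0 \<noteq> 0" "mean_loss \<noteq> 0" using M baseline_pos mean_loss_pos by auto
    then show ?thesis
      unfolding ratio unfolding mean_loss_def[symmetric] branching_def
      by (simp add: field_simps)
  qed
  then show "\<exists>a\<ge>0. AE z in \<Theta>. \<phi> z
      = cover ((1 - (\<integral>z. \<phi> z \<partial>\<Theta>) / mean_loss) * branching_ratio \<beta> T branching) a z"
    using cover(2) by simp
qed

end

section \<open>Vanishing self-excitation\<close>

theorem corollary4:
  fixes \<Theta> :: "real measure" and T \<beta> c R0 \<rho> \<Lambda>max lamP C :: real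
    and Q :: "real \<Rightarrow> 'w measure" and F :: "real \<Rightarrow> real \<Rightarrow> 'w measure"
    and \<tau> Z :: "real \<Rightarrow> nat \<Rightarrow> 'w \<Rightarrow> real" and lam :: "real \<Rightarrow> real \<Rightarrow> 'w \<Rightarrow> real"
    and lam0 \<gamma> :: "real \<Rightarrow> real" and \<phi> :: "real \<Rightarrow> real \<Rightarrow> real"
  assumes T: "0 < T"
    and \<Lambda>max: "0 < \<Lambda>max"
    and \<Theta>_sets: "sets \<Theta> = sets borel_nonneg"
    and \<Theta>_moments: "integrable \<Theta> (\<lambda>z. 1 + z + z\<^sup>2)"
    and \<Theta>_unbounded: "\<not> bounded (measure_support \<Theta>)"
    and subcritical: "\<And>\<Lambda>. \<Lambda> \<in> {0<..<\<Lambda>max} \<Longrightarrow> \<Lambda> * (\<integral>z. z \<partial>\<Theta>) < \<beta>"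
    and lam0: "\<And>\<Lambda>. \<Lambda> \<in> {0<..<\<Lambda>max} \<Longrightarrow> 0 < lam0 \<Lambda>"
    and \<gamma>: "\<And>\<Lambda>. \<Lambda> \<in> {0<..<\<Lambda>max} \<Longrightarrow> 0 < \<gamma> \<Lambda>"
    and hawkes: "\<And>\<Lambda>. \<Lambda> \<in> {0<..<\<Lambda>max} \<Longrightarrow>
      marked_hawkes (Q \<Lambda>) (F \<Lambda>) (\<tau> \<Lambda>) (Z \<Lambda>) \<Theta> (\<lambda>z. \<Lambda> * z) \<beta> (lam0 \<Lambda>) (lam0 \<Lambda>) (lam \<Lambda>)"
    and loading: "\<And>\<Lambda>. \<Lambda> \<in> {0<..<\<Lambda>max} \<Longrightarrow> c * T - expected_intensity (Q \<Lambda>) (lam \<Lambda>) T > 0"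
    and lamP: "0 < lamP"
    and same_events: "\<And>\<Lambda>. \<Lambda> \<in> {0<..<\<Lambda>max} \<Longrightarrow> expected_intensity (Q \<Lambda>) (lam \<Lambda>) T = lamP * T"
    and optimal: "\<And>\<Lambda>. \<Lambda> \<in> {0<..<\<Lambda>max} \<Longrightarrow>
      optimal_contract (Q \<Lambda>) (\<tau> \<Lambda>) (Z \<Lambda>) \<Theta> R0 \<rho> c (\<gamma> \<Lambda>) T (\<phi> \<Lambda>)"
    and same_cost: "\<And>\<Lambda>. \<Lambda> \<in> {0<..<\<Lambda>max} \<Longrightarrow> (\<integral>z. \<phi> \<Lambda> z \<partial>\<Theta>) = C"
  shows "(\<exists>a b. (\<forall>\<Lambda>\<in>{0<..<\<Lambda>max}. has_thresholds \<Theta> (\<phi> \<Lambda>) (a \<Lambda>) (b \<Lambda>)) \<and>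
            tends_to_excess_of_loss a b \<and> monotone_thresholds {0<..<\<Lambda>max} a b) \<and>
         (\<forall>a b. (\<forall>\<Lambda>\<in>{0<..<\<Lambda>max}. has_thresholds \<Theta> (\<phi> \<Lambda>) (a \<Lambda>) (b \<Lambda>)) \<longrightarrow>
            tends_to_excess_of_loss a b \<and>
            (measure_support \<Theta> = {0..} \<longrightarrow> monotone_thresholds {0<..<\<Lambda>max} a b))"
proof -
  interpret law: loss_distribution \<Theta>
    using \<Theta>_sets \<Theta>_moments \<Theta>_unbounded by unfold_locales
  define \<mu> where "\<mu> = (\<integral>z. z \<partial>\<Theta>)"
  have \<mu>: "0 < \<mu>" unfolding \<mu>_def by (rule law.mean_pos)
  define k where "k \<Lambda> = (1 - C / \<mu>) * branching_ratio \<beta> T (\<Lambda> * \<mu>)" for \<Lambda>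
  have opt: "\<phi> \<Lambda> \<in> contracts \<Theta>" "C < \<mu>" "\<exists>a\<ge>0. AE z in \<Theta>. \<phi> \<Lambda> z = cover (k \<Lambda>) a z"
    if \<Lambda>: "\<Lambda> \<in> {0<..<\<Lambda>max}" for \<Lambda>
  proof -
    interpret marked_hawkes "Q \<Lambda>" "F \<Lambda>" "\<tau> \<Lambda>" "Z \<Lambda>" \<Theta> "\<lambda>z. \<Lambda> * z" \<beta> "lam0 \<Lambda>" "lam0 \<Lambda>" "lam \<Lambda>"
      by (rule hawkes[OF \<Lambda>])
    interpret linear_hawkes_horizon \<Theta> "Q \<Lambda>" "F \<Lambda>" "\<tau> \<Lambda>" "Z \<Lambda>" \<Lambda> \<beta> "lam0 \<Lambda>" "lam \<Lambda>" T
      using \<Lambda> lam0[OF \<Lambda>] subcritical[OF \<Lambda>] T lamP same_events[OF \<Lambda>] by unfold_locales auto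
    note res = optimal_contract_cover[OF \<gamma>[OF \<Lambda>] loading[OF \<Lambda>] optimal[OF \<Lambda>]]
    show "\<phi> \<Lambda> \<in> contracts \<Theta>" by (rule res(1))
    show "C < \<mu>" using res(2) by (simp add: same_cost[OF \<Lambda>] mean_loss_def \<mu>_def)
    show "\<exists>a\<ge>0. AE z in \<Theta>. \<phi> \<Lambda> z = cover (k \<Lambda>) a z"
      using res(3) by (simp add: same_cost[OF \<Lambda>] k_def branching_def mean_loss_def \<mu>_def)
  qed
  have mid: "\<Lambda>max / 2 \<in> {0<..<\<Lambda>max}" using \<Lambda>max by simp
  have C: "C < \<mu>" by (rule opt(2)[OF mid])
  then have share: "0 < 1 - C / \<mu>" using \<mu> by simp
  have \<beta>: "0 < \<beta>" using subcritical[OF mid] mid \<mu> unfolding \<mu>_def by (meson greaterThanLessThan_iff less_trans mult_pos_pos)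
  obtain a0 where a0: "\<And>\<Lambda>. \<Lambda> \<in> {0<..<\<Lambda>max} \<Longrightarrow> 0 \<le> a0 \<Lambda> \<and> (AE z in \<Theta>. \<phi> \<Lambda> z = cover (k \<Lambda>) (a0 \<Lambda>) z)"
    using opt(3) by metis
  show ?thesis
  proof (rule law.threshold_family[OF \<Lambda>max, of k a0 \<phi> C])
    fix \<Lambda> assume \<Lambda>: "\<Lambda> \<in> {0<..<\<Lambda>max}"
    show "0 < k \<Lambda>" unfolding k_def
      using \<Lambda> share \<mu> T subcritical[OF \<Lambda>] by (intro mult_pos_pos branching_ratio_pos) (auto simp: \<mu>_def)
    show "0 \<le> a0 \<Lambda>" "AE z in \<Theta>. \<phi> \<Lambda> z = cover (k \<Lambda>) (a0 \<Lambda>) z" using a0[OF \<Lambda>] by auto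
    show "\<phi> \<Lambda> \<in> borel_measurable \<Theta>" using opt(1)[OF \<Lambda>] by (simp add: law.contracts_iff)
    show "(\<integral>z. \<phi> \<Lambda> z \<partial>\<Theta>) = C" by (rule same_cost[OF \<Lambda>])
  next
    show "mono_on {0<..<\<Lambda>max} k"
    proof (rule mono_onI)
      fix x y assume xy: "x \<in> {0<..<\<Lambda>max}" "y \<in> {0<..<\<Lambda>max}" "x \<le> y"
      then show "k x \<le> k y" unfolding k_def using share \<mu> T subcritical[OF xy(2)]
        by (intro mult_left_mono branching_ratio_mono) (auto simp: \<mu>_def)
    qed
    have "filterlim (\<lambda>\<Lambda>. \<Lambda> * \<mu>) (at_right 0) (at_right 0)"
      unfolding filterlim_at
    proof
      show "\<forall>\<^sub>F \<Lambda> in at_right 0. \<Lambda> * \<mu> \<in> {0<..} \<and> \<Lambda> * \<mu> \<noteq> 0"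
        using eventually_at_right_less by eventually_elim (use \<mu> in auto)
      show "((\<lambda>\<Lambda>. \<Lambda> * \<mu>) \<longlongrightarrow> 0) (at_right 0)" by (auto intro!: tendsto_eq_intros)
    qed
    from filterlim_compose[OF branching_ratio_tendsto_0[OF T \<beta>] this]
    have "((\<lambda>\<Lambda>. (1 - C / \<mu>) * branching_ratio \<beta> T (\<Lambda> * \<mu>)) \<longlongrightarrow> (1 - C / \<mu>) * 0) (at_right 0)"
      by (intro tendsto_mult tendsto_const)
    then show "(k \<longlongrightarrow> 0) (at_right 0)" by (simp add: k_def[abs_def])
    show "C < (\<integral>z. z \<partial>\<Theta>)" using C by (simp add: \<mu>_def)
  qed
qed

end
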